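(* Let $A$ be a C*-algebra of stable rank one, and let $E_1\subseteq F_1$ and $E_2\subseteq F_2$ be countably generated Hilbert $A$-modules with $E_i$ a closed submodule of $F_i$, such that $E_1\cong E_2$ and $F_1\cong F_2$. Then for every isomorphism $u\colon E_1\to E_2$, every finite subset $S\subseteq E_1$ and every $\varepsilon>0$ there is an isomorphism $v\colon F_1\to F_2$ with $\|v\xi-u\xi\|<\varepsilon$ for all $\xi\in S$. If $F_1=F_2=F$, then $v$ may be chosen to be a unitary element of $\mathfrak{K}(F)^\sim$. If instead of $F_1\cong F_2$ one only assumes that $F_2$ contains a closed countably generated submodule isomorphic to $F_1$, the same conclusion holds with $v$ an isomorphism of $F_1$ onto some closed submodule of $F_2$.
   Context: Hilbert modules are right Hilbert $A$-modules; an isomorphism means a surjective module map preserving the $A$-valued inner product. $\mathfrak{K}(F)$ denotes the C*-algebra of compact (i.e. norm limits of finite-rank) endomorphisms of $F$, and $\mathfrak{K}(F)^\sim$ its unitization, acting on $F$. *)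

theory Defs
  imports "HOL-Analysis.Analysis"
begin

text \<open>Complex scalar multiplication given as an explicit operation (HOL has only real vector spaces).\<close>
definition cvec :: "(complex \<Rightarrow> 'v::ab_group_add \<Rightarrow> 'v) \<Rightarrow> bool" where
  "cvec sc \<longleftrightarrow> (\<forall>x. sc 1 x = x) \<and> (\<forall>a b x. sc a (sc b x) = sc (a * b) x)
     \<and> (\<forall>a x y. sc a (x + y) = sc a x + sc a y) \<and> (\<forall>a b x. sc (a + b) x = sc a x + sc b x)"

definition cstar_algebra :: "(complex \<Rightarrow> 'a::{real_normed_algebra,banach} \<Rightarrow> 'a) \<Rightarrow> ('a \<Rightarrow> 'a) \<Rightarrow> bool" where
  "cstar_algebra sc st \<longleftrightarrow> cvec sc
     \<and> (\<forall>r x. sc (complex_of_real r) x = r *\<^sub>R x)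
     \<and> (\<forall>a x. norm (sc a x) = cmod a * norm x)
     \<and> (\<forall>a x y. sc a (x * y) = sc a x * y \<and> sc a (x * y) = x * sc a y)
     \<and> (\<forall>x. st (st x) = x) \<and> (\<forall>x y. st (x + y) = st x + st y)
     \<and> (\<forall>a x. st (sc a x) = sc (cnj a) (st x)) \<and> (\<forall>x y. st (x * y) = st y * st x)
     \<and> (\<forall>x. norm (st x * x) = (norm x)\<^sup>2)"

definition is_unit_of :: "'a::ring \<Rightarrow> bool" where
  "is_unit_of e \<longleftrightarrow> (\<forall>x. e * x = x \<and> x * e = x)"

definition unitz_mult :: "(complex \<Rightarrow> 'a::ring \<Rightarrow> 'a) \<Rightarrow> complex \<times> 'a \<Rightarrow> complex \<times> 'a \<Rightarrow> complex \<times> 'a" where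
  "unitz_mult sc p q = (fst p * fst q, sc (fst p) (snd q) + sc (fst q) (snd p) + snd p * snd q)"

definition unitz_invertible :: "(complex \<Rightarrow> 'a::ring \<Rightarrow> 'a) \<Rightarrow> complex \<times> 'a \<Rightarrow> bool" where
  "unitz_invertible sc p \<longleftrightarrow> (\<exists>q. unitz_mult sc p q = (1, 0) \<and> unitz_mult sc q p = (1, 0))"

definition stable_rank_one :: "(complex \<Rightarrow> 'a::{real_normed_algebra} \<Rightarrow> 'a) \<Rightarrow> bool" where
  "stable_rank_one sc \<longleftrightarrow>
     (if \<exists>e::'a. is_unit_of e then
        (\<forall>(e::'a) x (\<epsilon>::real). is_unit_of e \<and> \<epsilon> > 0 \<longrightarrow>
            (\<exists>y. (\<exists>z. y * z = e \<and> z * y = e) \<and> norm (x - y) < \<epsilon>))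
      else
        (\<forall>(l::complex) x (\<epsilon>::real). \<epsilon> > 0 \<longrightarrow>
            (\<exists>m y. unitz_invertible sc (m, y) \<and> cmod (l - m) + norm (x - y) < \<epsilon>)))"

definition positive_elt :: "('a::times \<Rightarrow> 'a) \<Rightarrow> 'a \<Rightarrow> bool" where
  "positive_elt st a \<longleftrightarrow> (\<exists>b. a = st b * b)"

definition hmnorm :: "('m \<Rightarrow> 'm \<Rightarrow> 'a::real_normed_vector) \<Rightarrow> 'm \<Rightarrow> real" where
  "hmnorm ip x = sqrt (norm (ip x x))"

definition hilbert_module ::
  "(complex \<Rightarrow> 'a::{real_normed_algebra,banach} \<Rightarrow> 'a) \<Rightarrow> ('a \<Rightarrow> 'a) \<Rightarrow>
   (complex \<Rightarrow> 'm::ab_group_add \<Rightarrow> 'm) \<Rightarrow> ('m \<Rightarrow> 'a \<Rightarrow> 'm) \<Rightarrow> ('m \<Rightarrow> 'm \<Rightarrow> 'a) \<Rightarrow> bool" where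
  "hilbert_module sc st scm ra ip \<longleftrightarrow> cvec scm
     \<and> (\<forall>x y a. ra (x + y) a = ra x a + ra y a)
     \<and> (\<forall>x a b. ra x (a + b) = ra x a + ra x b)
     \<and> (\<forall>x a b. ra x (a * b) = ra (ra x a) b)
     \<and> (\<forall>l x a. scm l (ra x a) = ra (scm l x) a \<and> scm l (ra x a) = ra x (sc l a))
     \<and> (\<forall>x y z. ip x (y + z) = ip x y + ip x z)
     \<and> (\<forall>l x y. ip x (scm l y) = sc l (ip x y))
     \<and> (\<forall>x y a. ip x (ra y a) = ip x y * a)
     \<and> (\<forall>x y. ip y x = st (ip x y))
     \<and> (\<forall>x. positive_elt st (ip x x))
     \<and> (\<forall>x. ip x x = 0 \<longrightarrow> x = 0)
     \<and> (\<forall>X. (\<forall>\<epsilon>>0. \<exists>N::nat. \<forall>m\<ge>N. \<forall>n\<ge>N. hmnorm ip (X m - X n) < \<epsilon>) \<longrightarrow>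
            (\<exists>L. \<forall>\<epsilon>>0. \<exists>N::nat. \<forall>n\<ge>N. hmnorm ip (X n - L) < \<epsilon>))"

definition hsubmodule :: "(complex \<Rightarrow> 'm::ab_group_add \<Rightarrow> 'm) \<Rightarrow> ('m \<Rightarrow> 'a \<Rightarrow> 'm) \<Rightarrow> 'm set \<Rightarrow> bool" where
  "hsubmodule scm ra S \<longleftrightarrow> 0 \<in> S \<and> (\<forall>x\<in>S. \<forall>y\<in>S. x + y \<in> S)
     \<and> (\<forall>l. \<forall>x\<in>S. scm l x \<in> S) \<and> (\<forall>x\<in>S. \<forall>a. ra x a \<in> S)"

definition hclosure :: "('m::ab_group_add \<Rightarrow> 'm \<Rightarrow> 'a::real_normed_vector) \<Rightarrow> 'm set \<Rightarrow> 'm set" where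
  "hclosure ip S = {x. \<forall>\<epsilon>>0. \<exists>y\<in>S. hmnorm ip (x - y) < \<epsilon>}"

definition closed_submodule ::
  "(complex \<Rightarrow> 'm::ab_group_add \<Rightarrow> 'm) \<Rightarrow> ('m \<Rightarrow> 'a \<Rightarrow> 'm) \<Rightarrow> ('m \<Rightarrow> 'm \<Rightarrow> 'a::real_normed_vector) \<Rightarrow> 'm set \<Rightarrow> bool" where
  "closed_submodule scm ra ip S \<longleftrightarrow> hsubmodule scm ra S \<and> hclosure ip S \<subseteq> S"

definition countably_generated ::
  "(complex \<Rightarrow> 'm::ab_group_add \<Rightarrow> 'm) \<Rightarrow> ('m \<Rightarrow> 'a \<Rightarrow> 'm) \<Rightarrow> ('m \<Rightarrow> 'm \<Rightarrow> 'a::real_normed_vector) \<Rightarrow> 'm set \<Rightarrow> bool" where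
  "countably_generated scm ra ip S \<longleftrightarrow>
     (\<exists>G. countable G \<and> G \<subseteq> S \<and> S \<subseteq> hclosure ip (\<Inter>{T. G \<subseteq> T \<and> hsubmodule scm ra T}))"

definition hiso ::
  "(complex \<Rightarrow> 'm::ab_group_add \<Rightarrow> 'm) \<Rightarrow> ('m \<Rightarrow> 'a \<Rightarrow> 'm) \<Rightarrow> ('m \<Rightarrow> 'm \<Rightarrow> 'a) \<Rightarrow>
   (complex \<Rightarrow> 'n::ab_group_add \<Rightarrow> 'n) \<Rightarrow> ('n \<Rightarrow> 'a \<Rightarrow> 'n) \<Rightarrow> ('n \<Rightarrow> 'n \<Rightarrow> 'a) \<Rightarrow>
   'm set \<Rightarrow> 'n set \<Rightarrow> ('m \<Rightarrow> 'n) \<Rightarrow> bool" where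
  "hiso scm1 ra1 ip1 scm2 ra2 ip2 E E' u \<longleftrightarrow> u ` E = E'
     \<and> (\<forall>x\<in>E. \<forall>y\<in>E. u (x + y) = u x + u y \<and> ip2 (u x) (u y) = ip1 x y)
     \<and> (\<forall>l. \<forall>x\<in>E. u (scm1 l x) = scm2 l (u x))
     \<and> (\<forall>x\<in>E. \<forall>a. u (ra1 x a) = ra2 (u x) a)"

text \<open>Compact operators K(F) on F (carrier the whole type): operator-norm limits of finite sums
  of rank-one operators theta_{x,y} z = x <y,z>.\<close>
definition compact_op :: "('m::ab_group_add \<Rightarrow> 'a \<Rightarrow> 'm) \<Rightarrow> ('m \<Rightarrow> 'm \<Rightarrow> 'a::real_normed_vector) \<Rightarrow> ('m \<Rightarrow> 'm) \<Rightarrow> bool" where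
  "compact_op ra ip T \<longleftrightarrow> (\<forall>\<epsilon>>0. \<exists>(n::nat) xs ys. \<forall>z.
      hmnorm ip (T z - (\<Sum>i<n. ra (xs i) (ip (ys i) z))) \<le> \<epsilon> * hmnorm ip z)"

text \<open>Unitary element of the unitization K(F)~ acting on F: an operator l*id + k, k compact,
  which is a unitary (surjective, inner-product preserving) map of F.\<close>
definition unitary_Kunitz ::
  "(complex \<Rightarrow> 'm::ab_group_add \<Rightarrow> 'm) \<Rightarrow> ('m \<Rightarrow> 'a \<Rightarrow> 'm) \<Rightarrow> ('m \<Rightarrow> 'm \<Rightarrow> 'a::real_normed_vector) \<Rightarrow> ('m \<Rightarrow> 'm) \<Rightarrow> bool" where
  "unitary_Kunitz scm ra ip v \<longleftrightarrow>
     (\<exists>l k. compact_op ra ip k \<and> (\<forall>z. v z = scm l z + k z))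
     \<and> hiso scm ra ip scm ra ip UNIV UNIV v"

definition cg_hilbert_module ::
  "(complex \<Rightarrow> 'a::{real_normed_algebra,banach} \<Rightarrow> 'a) \<Rightarrow> ('a \<Rightarrow> 'a) \<Rightarrow>
   (complex \<Rightarrow> 'm::ab_group_add \<Rightarrow> 'm) \<Rightarrow> ('m \<Rightarrow> 'a \<Rightarrow> 'm) \<Rightarrow> ('m \<Rightarrow> 'm \<Rightarrow> 'a) \<Rightarrow> bool" where
  "cg_hilbert_module sc st scm ra ip \<longleftrightarrow> hilbert_module sc st scm ra ip \<and> countably_generated scm ra ip UNIV"

end

theory Submission
  imports Defs
begin

text \<open>
  All three statements follow from the case F1 = F2 = F by composing with the given embedding of F1.
  For finite S in E1 let T be the square of a multiple of the sum of the rank one operators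
  theta(xi, xi), xi in S; then T has approximately the vectors of S in its range, uT has finite rank on F and
  (uT)*(uT) = T^2.  If y is invertible in the unitization of K(F) and close to uT, then in the polar
  decomposition y = v |y| the modulus |y| is close to T, so vT is close to uT and the unitary v is
  close to u on S.

  Invertible elements close to a finite rank operator are found by adding one rank one operator at a time:
  if z is invertible, then z + theta(xi, eta) is invertible if and only if 1 + <eta, z^-1 xi> is invertible in the unitization of A,
  and stable rank one allows xi to be moved slightly so that this holds.

  Square roots come from the iteration b := (c + b^2) / 2, and the positivity of b*b is proved without
  spectral theory.
\<close>

section \<open>Positivity in C*-algebras\<close>

text \<open>A closed submodule need not be complemented, so u need not extend to an adjointable
  operator on F. Composed with a finite rank operator with range in E1 it does; the operator called
  T above is \<open>P\<close> in the code, where \<open>T\<close> is the plain sum of rank one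
  operators. With X = uP one has X* X = P^2, that is |X| = P.

  That vP is close to uP says something about x in S only if x is near P z for some z whose norm is
  known before the precision is chosen. Such a z is Q x, where 1 - (1 - P)^n = P Q and (1 - P)^n is
  small on S. So n and Q are fixed first, the distance from y to X last.

  The argument needs |y| to depend continuously on y* y and to stay in the unitization of K(F). Both
  are read off the square root iteration: it converges uniformly on the unit ball, and its iterates
  are polynomials. The theory of positive elements is set up abstractly because it is used twice:
  for operators on A itself, where it gives the Cauchy-Schwarz inequality, and then for operators on
  F.\<close>

primrec sqrt_scalar :: "real \<Rightarrow> nat \<Rightarrow> real" where
  "sqrt_scalar g 0 = 0"
| "sqrt_scalar g (Suc n) = (g + (sqrt_scalar g n)\<^sup>2) / 2"

lemma sqrt_scalar_range: assumes "0 \<le> g" "g \<le> 1" shows "0 \<le> sqrt_scalar g n \<and> sqrt_scalar g n \<le> 1"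
proof (induction n)
  case (Suc n)
  then have "(sqrt_scalar g n)\<^sup>2 \<le> 1" by (simp add: power_le_one)
  then show ?case using assms by simp
qed simp

lemma sqrt_scalar_incseq: assumes "0 \<le> g" "g \<le> 1" shows "incseq (sqrt_scalar g)"
proof (rule incseq_SucI)
  show "sqrt_scalar g n \<le> sqrt_scalar g (Suc n)" for n
  proof (induction n)
    case (Suc n)
    then have "(sqrt_scalar g n)\<^sup>2 \<le> (sqrt_scalar g (Suc n))\<^sup>2"
      using sqrt_scalar_range[OF assms] by (intro power_mono) auto
    then show ?case by simp
  qed (use assms in simp)
qed

lemma sqrt_scalar_convergent: assumes "0 \<le> g" "g \<le> 1" shows "convergent (sqrt_scalar g)"
  using sqrt_scalar_range[OF assms] sqrt_scalar_incseq[OF assms]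
  by (intro Bseq_monoseq_convergent BseqI'[where K=1]) (auto simp: incseq_imp_monoseq)

text \<open>The limit of \<open>sqrt_scalar g\<close> is 1 - sqrt (1 - g). At g = 1 the iteration
  majorizes the operator iteration for every c of norm at most one; other values of g follow the
  scalar parts in a unitization.\<close>

abbreviation "sqrt_bound \<equiv> sqrt_scalar 1"

lemmas sqrt_bound_range = sqrt_scalar_range[of 1, OF zero_le_one order_refl]
lemmas sqrt_bound_incseq = sqrt_scalar_incseq[of 1, OF zero_le_one order_refl]
lemmas sqrt_bound_convergent = sqrt_scalar_convergent[of 1, OF zero_le_one order_refl]

lemma LIMSEQ_zero_squeeze:
  fixes f g :: "nat \<Rightarrow> real"
  assumes "g \<longlonglongrightarrow> 0" "\<And>n. 0 \<le> f n" "\<And>n. f n \<le> g n"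
  shows "f \<longlonglongrightarrow> 0"
  by (rule tendsto_sandwich[where f="\<lambda>_. 0" and h=g]) (use assms in auto)

text \<open>The carrier \<open>C\<close> allows the ring to be a part of a type, here of all
  additive endomorphisms, and the scalars enter as central elements. \<open>nrm_cs_le\<close> is an
  inequality because the ring may be zero. Of the C*-identity only the hard inequality is assumed;
  the other one follows from \<open>nrm_star\<close>.\<close>

locale cstar_ring =
  fixes C :: "'r::{ring,monoid_mult} set" and star :: "'r \<Rightarrow> 'r" and cs :: "complex \<Rightarrow> 'r"
    and nrm :: "'r \<Rightarrow> real"
  assumes cs_closed [simp, intro]: "cs l \<in> C"
    and add_closed [simp, intro]: "x \<in> C \<Longrightarrow> y \<in> C \<Longrightarrow> x + y \<in> C"
    and mult_closed [simp, intro]: "x \<in> C \<Longrightarrow> y \<in> C \<Longrightarrow> x * y \<in> C"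
    and star_closed [simp, intro]: "x \<in> C \<Longrightarrow> star x \<in> C"
    and cs_add: "cs (a + b) = cs a + cs b"
    and cs_mult: "cs (a * b) = cs a * cs b"
    and cs_one [simp]: "cs 1 = 1"
    and cs_commute: "x \<in> C \<Longrightarrow> x * cs l = cs l * x"
    and star_add: "x \<in> C \<Longrightarrow> y \<in> C \<Longrightarrow> star (x + y) = star x + star y"
    and star_mult: "x \<in> C \<Longrightarrow> y \<in> C \<Longrightarrow> star (x * y) = star y * star x"
    and star_star [simp]: "x \<in> C \<Longrightarrow> star (star x) = x"
    and star_cs [simp]: "star (cs l) = cs (cnj l)"
    and nrm_nonneg [simp]: "0 \<le> nrm x"
    and nrm_triangle: "x \<in> C \<Longrightarrow> y \<in> C \<Longrightarrow> nrm (x + y) \<le> nrm x + nrm y"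
    and nrm_mult: "x \<in> C \<Longrightarrow> y \<in> C \<Longrightarrow> nrm (x * y) \<le> nrm x * nrm y"
    and nrm_cs_le: "nrm (cs l) \<le> cmod l"
    and nrm_zeroD: "x \<in> C \<Longrightarrow> nrm x = 0 \<Longrightarrow> x = 0"
    and nrm_star_mult: "x \<in> C \<Longrightarrow> (nrm x)\<^sup>2 \<le> nrm (star x * x)"
    and complete: "(\<And>n. X n \<in> C) \<Longrightarrow> (\<And>e. 0 < e \<Longrightarrow> \<exists>N. \<forall>m\<ge>N. \<forall>n\<ge>N. nrm (X m - X n) < e)
      \<Longrightarrow> \<exists>L\<in>C. (\<lambda>n. nrm (X n - L)) \<longlonglongrightarrow> 0"
begin

section \<open>Scalars, involution and norm in a C*-ring\<close>

lemma cs_zero [simp]: "cs 0 = 0"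
  using cs_add[of 0 0] by simp

lemma cs_minus: "cs (- l) = - cs l"
  using cs_add[of l "- l"] by (simp add: eq_neg_iff_add_eq_0 add.commute)

lemma cs_diff: "cs (a - b) = cs a - cs b"
  using cs_add[of a "- b"] by (simp add: cs_minus)

lemma zero_closed [simp, intro]: "0 \<in> C"
  using cs_closed[of 0] by simp

lemma one_closed [simp, intro]: "1 \<in> C"
  using cs_closed[of 1] by simp

lemma minus_closed [simp, intro]: "x \<in> C \<Longrightarrow> - x \<in> C"
  using mult_closed[OF cs_closed[of "-1"]] by (simp add: cs_minus)

lemma diff_closed [simp, intro]: "x \<in> C \<Longrightarrow> y \<in> C \<Longrightarrow> x - y \<in> C"
  using add_closed[of x "- y"] by simp

lemma power_closed [simp, intro]: "x \<in> C \<Longrightarrow> x ^ n \<in> C"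
  by (induction n) auto

lemma cs_left_commute: "x \<in> C \<Longrightarrow> x * (cs l * y) = cs l * (x * y)"
  by (metis cs_commute mult.assoc)

lemma cs_mult_mult_cs: "x \<in> C \<Longrightarrow> cs a * x * (cs b * y) = cs (a * b) * (x * y)"
  by (simp add: mult.assoc cs_mult cs_left_commute[of x])

lemma cs_cancel: "l \<noteq> 0 \<Longrightarrow> cs l * x = cs l * y \<Longrightarrow> x = y"
  by (drule arg_cong[where f="\<lambda>z. cs (inverse l) * z"]) (simp flip: mult.assoc cs_mult)

lemma cs_inverse [simp]: "l \<noteq> 0 \<Longrightarrow> cs (inverse l) * (cs l * x) = x"
  "l \<noteq> 0 \<Longrightarrow> cs l * (cs (inverse l) * x) = x"
  by (simp_all flip: mult.assoc cs_mult)

lemma star_minus: "x \<in> C \<Longrightarrow> star (- x) = - star x"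
  using star_add[of x "- x"] star_cs[of 0] by (simp add: eq_neg_iff_add_eq_0 add.commute)

lemma star_zero [simp]: "star 0 = 0"
  using star_cs[of 0] by simp

lemma star_one [simp]: "star 1 = 1"
  using star_cs[of 1] by simp

lemma star_diff: "x \<in> C \<Longrightarrow> y \<in> C \<Longrightarrow> star (x - y) = star x - star y"
  using star_add[of x "- y"] by (simp add: star_minus)

lemma nrm_zero [simp]: "nrm 0 = 0"
  using nrm_cs_le[of 0] nrm_nonneg[of 0] by simp

lemma nrm_cs_mult: "x \<in> C \<Longrightarrow> nrm (cs l * x) \<le> cmod l * nrm x"
  using nrm_mult[of "cs l" x] nrm_cs_le[of l] mult_right_mono[OF nrm_cs_le[of l] nrm_nonneg[of x]] by simp

lemma nrm_minus [simp]: "x \<in> C \<Longrightarrow> nrm (- x) = nrm x"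
  using nrm_cs_mult[of x "-1"] nrm_cs_mult[of "- x" "-1"] by (simp add: cs_minus)

lemma nrm_diff_commute: "x \<in> C \<Longrightarrow> y \<in> C \<Longrightarrow> nrm (x - y) = nrm (y - x)"
  using nrm_minus[of "x - y"] by simp

lemma nrm_triangle_diff: "x \<in> C \<Longrightarrow> y \<in> C \<Longrightarrow> nrm (x - y) \<le> nrm x + nrm y"
  using nrm_triangle[of x "- y"] by simp

lemma nrm_dist_triangle: "x \<in> C \<Longrightarrow> y \<in> C \<Longrightarrow> z \<in> C \<Longrightarrow> nrm (x - z) \<le> nrm (x - y) + nrm (y - z)"
  using nrm_triangle[of "x - y" "y - z"] by simp

lemma nrm_star [simp]: assumes "x \<in> C" shows "nrm (star x) = nrm x"
proof -
  have le: "nrm y \<le> nrm (star y)" if "y \<in> C" for y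
  proof (cases "nrm y = 0")
    case False
    have "nrm y * nrm y \<le> nrm (star y) * nrm y"
      using nrm_star_mult[OF that] nrm_mult[of "star y" y] that by (simp add: power2_eq_square)
    with False nrm_nonneg[of y] show ?thesis by (metis mult_right_le_imp_le order_le_less)
  qed simp
  show ?thesis using le[of x] le[of "star x"] assms by simp
qed

lemma nrm_self_adjoint_square: "x \<in> C \<Longrightarrow> star x = x \<Longrightarrow> nrm (x * x) = (nrm x)\<^sup>2"
  using nrm_star_mult[of x] nrm_mult[of x x] by (simp add: power2_eq_square)

lemma self_adjoint_square_zeroD: "x \<in> C \<Longrightarrow> star x = x \<Longrightarrow> x * x = 0 \<Longrightarrow> x = 0"
  using nrm_self_adjoint_square[of x] nrm_zeroD[of x] by simp

lemma star_mult_zeroD: "x \<in> C \<Longrightarrow> star x * x = 0 \<Longrightarrow> x = 0"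
  using nrm_star_mult[of x] nrm_zeroD[of x] by simp

lemma nrm_add_le: "x \<in> C \<Longrightarrow> y \<in> C \<Longrightarrow> nrm x \<le> a \<Longrightarrow> nrm y \<le> b \<Longrightarrow> nrm (x + y) \<le> a + b"
  using nrm_triangle[of x y] by simp

section \<open>Norm convergence\<close>

definition conv :: "(nat \<Rightarrow> 'r) \<Rightarrow> 'r \<Rightarrow> bool" where
  "conv X L \<longleftrightarrow> (\<forall>n. X n \<in> C) \<and> L \<in> C \<and> (\<lambda>n. nrm (X n - L)) \<longlonglongrightarrow> 0"

lemma conv_bound:
  assumes "conv X L" "\<And>n. nrm (X n) \<le> K" shows "nrm L \<le> K"
proof -
  have "(\<lambda>n. nrm (X n - L) + K) \<longlonglongrightarrow> 0 + K"
    using assms unfolding conv_def by (intro tendsto_intros) auto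
  moreover have "nrm L \<le> nrm (X n - L) + K" for n
  proof -
    have "nrm L \<le> nrm (L - X n) + nrm (X n)"
      using assms(1) nrm_triangle[of "L - X n" "X n"] unfolding conv_def by simp
    then show ?thesis using assms nrm_diff_commute[of L "X n"] unfolding conv_def by (smt (verit))
  qed
  ultimately show ?thesis
    using LIMSEQ_le_const[of "\<lambda>n. nrm (X n - L) + K" "0 + K" "nrm L"] by simp
qed

lemma conv_const: "x \<in> C \<Longrightarrow> conv (\<lambda>n. x) x"
  by (simp add: conv_def)

lemma conv_add: assumes "conv X L" "conv Y M" shows "conv (\<lambda>n. X n + Y n) (L + M)"
proof -
  have lim: "(\<lambda>n. nrm (X n - L) + nrm (Y n - M)) \<longlonglongrightarrow> 0 + 0"
    using assms unfolding conv_def by (intro tendsto_intros) auto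
  have le: "nrm (X n + Y n - (L + M)) \<le> nrm (X n - L) + nrm (Y n - M)" for n
    using assms nrm_triangle[of "X n - L" "Y n - M"] unfolding conv_def by (simp add: algebra_simps)
  have "(\<lambda>n. nrm (X n + Y n - (L + M))) \<longlonglongrightarrow> 0"
    by (rule LIMSEQ_zero_squeeze[OF _ nrm_nonneg le]) (use lim in simp)
  then show ?thesis using assms unfolding conv_def by auto
qed

lemma conv_mult: assumes "conv X L" "conv Y M" shows "conv (\<lambda>n. X n * Y n) (L * M)"
proof -
  have m: "X n \<in> C" "Y n \<in> C" "L \<in> C" "M \<in> C" for n
    using assms unfolding conv_def by auto
  have lim: "(\<lambda>n. nrm (X n - L) * (nrm (Y n - M) + nrm M) + nrm L * nrm (Y n - M)) \<longlonglongrightarrow> 0 * (0 + nrm M) + nrm L * 0"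
    using assms unfolding conv_def by (intro tendsto_intros) auto
  have le: "nrm (X n * Y n - L * M) \<le> nrm (X n - L) * (nrm (Y n - M) + nrm M) + nrm L * nrm (Y n - M)" for n
  proof -
    have "nrm (Y n) \<le> nrm (Y n - M) + nrm M"
      using nrm_triangle[of "Y n - M" M] m by simp
    then have 1: "nrm ((X n - L) * Y n) \<le> nrm (X n - L) * (nrm (Y n - M) + nrm M)"
      using nrm_mult[of "X n - L" "Y n"] m mult_left_mono[of "nrm (Y n)" _ "nrm (X n - L)"] by fastforce
    have 2: "nrm (L * (Y n - M)) \<le> nrm L * nrm (Y n - M)"
      using nrm_mult m by simp
    have "X n * Y n - L * M = (X n - L) * Y n + L * (Y n - M)"
      by (simp add: algebra_simps)
    then show ?thesis using nrm_add_le[OF _ _ 1 2] m by simp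
  qed
  have "(\<lambda>n. nrm (X n * Y n - L * M)) \<longlonglongrightarrow> 0"
    by (rule LIMSEQ_zero_squeeze[OF _ nrm_nonneg le]) (use lim in simp)
  then show ?thesis using m unfolding conv_def by auto
qed

lemma conv_star: assumes "conv X L" shows "conv (\<lambda>n. star (X n)) (star L)"
proof -
  have "nrm (star (X n) - star L) = nrm (X n - L)" for n
    using assms nrm_star[of "X n - L"] unfolding conv_def by (simp add: star_diff)
  then show ?thesis using assms unfolding conv_def by simp
qed

lemma conv_unique: assumes "conv X L" "conv X M" shows "L = M"
proof -
  have m: "X n \<in> C" "L \<in> C" "M \<in> C" for n
    using assms unfolding conv_def by auto
  have "(\<lambda>n. nrm (X n - L) + nrm (X n - M)) \<longlonglongrightarrow> 0 + 0"
    using assms unfolding conv_def by (intro tendsto_intros) auto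
  moreover have "nrm (L - M) \<le> nrm (X n - L) + nrm (X n - M)" for n
    using nrm_dist_triangle[of L "X n" M] nrm_diff_commute[of L "X n"] m by simp
  ultimately have "nrm (L - M) \<le> 0"
    using LIMSEQ_le_const[of "\<lambda>n. nrm (X n - L) + nrm (X n - M)" "0 + 0" "nrm (L - M)"] by simp
  then show ?thesis using nrm_zeroD[of "L - M"] nrm_nonneg[of "L - M"] m by simp
qed

lemma conv_Suc: "conv X L \<Longrightarrow> conv (\<lambda>n. X (Suc n)) L"
  unfolding conv_def using LIMSEQ_Suc[of "\<lambda>n. nrm (X n - L)"] by auto

section \<open>Square roots by iteration\<close>

primrec sqrt_iter :: "'r \<Rightarrow> nat \<Rightarrow> 'r" where
  "sqrt_iter c 0 = 0"
| "sqrt_iter c (Suc n) = cs (1/2) * (c + sqrt_iter c n * sqrt_iter c n)"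

lemma sqrt_iter_closed [simp, intro]: "c \<in> C \<Longrightarrow> sqrt_iter c n \<in> C"
  by (induction n) auto

lemma nrm_sqrt_iter:
  assumes "c \<in> C" "nrm c \<le> 1" shows "nrm (sqrt_iter c n) \<le> sqrt_bound n"
proof (induction n)
  case (Suc n)
  let ?b = "sqrt_iter c n"
  have "nrm (?b * ?b) \<le> (sqrt_bound n)\<^sup>2"
    using nrm_mult[of ?b ?b] Suc assms by (smt (verit) mult_mono nrm_nonneg power2_eq_square sqrt_iter_closed)
  then have "nrm (c + ?b * ?b) \<le> 1 + (sqrt_bound n)\<^sup>2"
    using nrm_add_le assms by simp
  then show ?case using nrm_cs_mult[of "c + ?b * ?b" "1/2"] assms by simp
qed simp

text \<open>In the noncommutative difference of squares a^2 - b^2 = (a - b) a + b (a - b) every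
  factor is bounded by its scalar counterpart, and the bounds add up to exactly s^2 - t^2. So the
  majorant reproduces itself.\<close>

lemma nrm_sqrt_iter_Suc_diff:
  assumes "c \<in> C" "nrm c \<le> 1"
  shows "nrm (sqrt_iter c (Suc n) - sqrt_iter c n) \<le> sqrt_bound (Suc n) - sqrt_bound n"
proof (induction n)
  case 0
  then show ?case using assms nrm_cs_mult[of c "1/2"] by simp
next
  case (Suc n)
  let ?a = "sqrt_iter c (Suc n)" and ?b = "sqrt_iter c n"
  let ?s = "sqrt_bound (Suc n)" and ?t = "sqrt_bound n"
  have m: "?a \<in> C" "?b \<in> C" using assms(1) by (blast intro: sqrt_iter_closed)+
  have d: "sqrt_iter c (Suc (Suc n)) - sqrt_iter c (Suc n) = cs (1/2) * ((?a - ?b) * ?a + ?b * (?a - ?b))"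
  proof -
    have "sqrt_iter c (Suc (Suc n)) - sqrt_iter c (Suc n)
        = cs (1/2) * (c + ?a * ?a) - cs (1/2) * (c + ?b * ?b)"
      by simp
    then show ?thesis by (simp add: algebra_simps del: sqrt_iter.simps)
  qed
  have "nrm ((?a - ?b) * ?a) \<le> (?s - ?t) * ?s"
    by (rule order_trans[OF nrm_mult mult_mono])
      (use m Suc nrm_sqrt_iter[OF assms, of "Suc n"] sqrt_bound_range incseq_SucD[OF sqrt_bound_incseq] in \<open>auto simp del: sqrt_iter.simps sqrt_scalar.simps intro: order_trans[OF nrm_nonneg]\<close>)
  moreover have "nrm (?b * (?a - ?b)) \<le> ?t * (?s - ?t)"
    by (rule order_trans[OF nrm_mult mult_mono])
      (use m Suc nrm_sqrt_iter[OF assms, of n] sqrt_bound_range incseq_SucD[OF sqrt_bound_incseq] in \<open>auto simp del: sqrt_iter.simps sqrt_scalar.simps intro: order_trans[OF nrm_nonneg]\<close>)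
  ultimately have "nrm ((?a - ?b) * ?a + ?b * (?a - ?b)) \<le> (?s - ?t) * ?s + ?t * (?s - ?t)"
    using m by (intro nrm_add_le) (auto simp del: sqrt_iter.simps sqrt_scalar.simps)
  then have "nrm (sqrt_iter c (Suc (Suc n)) - sqrt_iter c (Suc n)) \<le> ((?s - ?t) * ?s + ?t * (?s - ?t)) / 2"
    unfolding d using nrm_cs_mult[of "(?a - ?b) * ?a + ?b * (?a - ?b)" "1/2"] m
    by (simp del: sqrt_iter.simps sqrt_scalar.simps)
  also have "\<dots> = (?s\<^sup>2 - ?t\<^sup>2) / 2" by (simp add: algebra_simps power2_eq_square)
  also have "\<dots> = sqrt_bound (Suc (Suc n)) - sqrt_bound (Suc n)"
    by (simp add: field_simps)
  finally show ?case .
qed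

lemma nrm_sqrt_iter_diff:
  assumes "c \<in> C" "nrm c \<le> 1"
  shows "nrm (sqrt_iter c (n + k) - sqrt_iter c n) \<le> sqrt_bound (n + k) - sqrt_bound n"
proof (induction k)
  case (Suc k)
  have "sqrt_iter c i \<in> C" for i using assms(1) by blast
  then show ?case
    using nrm_dist_triangle[of "sqrt_iter c (Suc (n + k))" "sqrt_iter c (n + k)" "sqrt_iter c n"]
      nrm_sqrt_iter_Suc_diff[OF assms, of "n + k"] Suc by (simp del: sqrt_iter.simps sqrt_scalar.simps)
qed simp

text \<open>The iteration solves b = (c + b^2) / 2, so 1 - b is a square root of 1 - c.  Comparison with
  the scalar iteration at c = 1 gives convergence up to and including norm one.\<close>
definition sqrt_lim :: "'r \<Rightarrow> 'r" where
  "sqrt_lim c = (SOME b. conv (sqrt_iter c) b)"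

lemma conv_sqrt_lim:
  assumes "c \<in> C" "nrm c \<le> 1" shows "conv (sqrt_iter c) (sqrt_lim c)"
proof -
  have "\<exists>N. \<forall>m\<ge>N. \<forall>n\<ge>N. nrm (sqrt_iter c m - sqrt_iter c n) < e" if "0 < e" for e
  proof -
    obtain N where "\<forall>m\<ge>N. \<forall>n\<ge>N. norm (sqrt_bound m - sqrt_bound n) < e"
      using CauchyD[OF convergent_Cauchy[OF sqrt_bound_convergent] \<open>0 < e\<close>] by blast
    then have N: "\<And>m n. m \<ge> N \<Longrightarrow> n \<ge> N \<Longrightarrow> \<bar>sqrt_bound m - sqrt_bound n\<bar> < e" by simp
    have le: "nrm (sqrt_iter c m - sqrt_iter c n) < e" if "m \<ge> n" "n \<ge> N" for m n
      using nrm_sqrt_iter_diff[OF assms, of n "m - n"] N[of m n] that by auto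
    then have "nrm (sqrt_iter c m - sqrt_iter c n) < e" if "m \<ge> N" "n \<ge> N" for m n
      using that nrm_diff_commute[of "sqrt_iter c m" "sqrt_iter c n"] assms(1)
      by (metis nle_le sqrt_iter_closed)
    then show ?thesis by blast
  qed
  then obtain L where "L \<in> C" "(\<lambda>n. nrm (sqrt_iter c n - L)) \<longlonglongrightarrow> 0"
    using complete[of "sqrt_iter c"] assms(1) by blast
  then have "conv (sqrt_iter c) L" using assms(1) by (simp add: conv_def)
  then show ?thesis unfolding sqrt_lim_def by (rule someI)
qed

lemma sqrt_lim_closed [simp, intro]: "c \<in> C \<Longrightarrow> nrm c \<le> 1 \<Longrightarrow> sqrt_lim c \<in> C"
  using conv_sqrt_lim unfolding conv_def by blast

lemma nrm_sqrt_lim: "c \<in> C \<Longrightarrow> nrm c \<le> 1 \<Longrightarrow> nrm (sqrt_lim c) \<le> 1"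
  using conv_bound[OF conv_sqrt_lim, of c 1] nrm_sqrt_iter sqrt_bound_range order_trans by blast

lemma sqrt_lim_square:
  assumes "c \<in> C" "nrm c \<le> 1" shows "(1 - sqrt_lim c) * (1 - sqrt_lim c) = 1 - c"
proof -
  let ?b = "sqrt_lim c"
  have "conv (\<lambda>n. cs (1/2) * (c + sqrt_iter c n * sqrt_iter c n)) (cs (1/2) * (c + ?b * ?b))"
    by (intro conv_mult conv_add conv_const conv_sqrt_lim assms cs_closed)
  then have "?b = cs (1/2) * (c + ?b * ?b)"
    using conv_unique conv_Suc[OF conv_sqrt_lim[OF assms]] by simp
  then have "cs 2 * ?b = cs 2 * (cs (1/2) * (c + ?b * ?b))" by simp
  also have "\<dots> = c + ?b * ?b" using cs_inverse(2)[of 2] by (simp add: field_simps)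
  also have "cs 2 * ?b = ?b + ?b" using cs_add[of 1 1] by (simp add: algebra_simps)
  finally show ?thesis by (simp add: algebra_simps)
qed

lemma sqrt_lim_star:
  assumes "c \<in> C" "nrm c \<le> 1" "star c = c" shows "star (sqrt_lim c) = sqrt_lim c"
proof -
  have "star (sqrt_iter c n) = sqrt_iter c n" for n
    by (induction n) (use assms in \<open>simp_all add: star_mult star_add cs_commute\<close>)
  then have "conv (sqrt_iter c) (star (sqrt_lim c))"
    using conv_star[OF conv_sqrt_lim[OF assms(1,2)]] by simp
  then show ?thesis using conv_unique conv_sqrt_lim[OF assms(1,2)] by blast
qed

text \<open>The iterates are polynomials with the same coefficients for \<open>a\<close> and
  \<open>b\<close>, so intertwining passes to them and then to the limit. Two different elements are
  allowed because c intertwines c* c with c c*.\<close>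

lemma sqrt_lim_intertwine:
  assumes "a \<in> C" "nrm a \<le> 1" "b \<in> C" "nrm b \<le> 1" "x \<in> C" "x * a = b * x"
  shows "x * sqrt_lim a = sqrt_lim b * x"
proof -
  have "x * sqrt_iter a n = sqrt_iter b n * x" for n
  proof (induction n)
    case (Suc n)
    have "x * (sqrt_iter a n * sqrt_iter a n) = sqrt_iter b n * sqrt_iter b n * x"
      by (metis Suc mult.assoc)
    then show ?case using assms by (simp add: cs_left_commute distrib_left distrib_right mult.assoc)
  qed simp
  then have "conv (\<lambda>n. x * sqrt_iter a n) (sqrt_lim b * x)"
    using conv_mult[OF conv_sqrt_lim[OF assms(3,4)] conv_const[OF assms(5)]] by simp
  then show ?thesis
    using conv_unique conv_mult[OF conv_const[OF assms(5)] conv_sqrt_lim[OF assms(1,2)]] by blast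
qed

section \<open>Positive elements\<close>

abbreviation rs :: "real \<Rightarrow> 'r" where "rs t \<equiv> cs (complex_of_real t)"

lemma nrm_rs_mult: "x \<in> C \<Longrightarrow> 0 \<le> t \<Longrightarrow> nrm (rs t * x) = t * nrm x"
proof (cases "t = 0")
  case False
  assume "x \<in> C" "0 \<le> t"
  then have "nrm x \<le> inverse t * nrm (rs t * x)"
    using nrm_cs_mult[of "rs t * x" "of_real (inverse t)"] False cs_inverse(1)[of "of_real t" x] by (simp add: norm_inverse)
  with \<open>0 \<le> t\<close> False have "t * nrm x \<le> nrm (rs t * x)" by (simp add: field_simps)
  with nrm_cs_mult[of x "of_real t"] \<open>x \<in> C\<close> \<open>0 \<le> t\<close> show ?thesis by simp
qed simp

lemma rs_add: "rs (s + t) = rs s + rs t" by (simp add: cs_add)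
lemma rs_diff: "rs (s - t) = rs s - rs t" by (simp add: cs_diff)
lemma rs_mult: "rs (s * t) = rs s * rs t" by (simp add: cs_mult)

lemma nrm_rs_le: "0 \<le> t \<Longrightarrow> nrm (rs t) \<le> t"
  using nrm_cs_le[of "of_real t"] by simp

text \<open>For selfadjoint elements this describes those with nonnegative spectrum.\<close>
definition pos :: "'r \<Rightarrow> bool" where
  "pos a \<longleftrightarrow> a \<in> C \<and> star a = a \<and> (\<exists>t\<ge>0. nrm (rs t - a) \<le> t)"

lemma pos_closed [simp, intro]: "pos a \<Longrightarrow> a \<in> C" and pos_star: "pos a \<Longrightarrow> star a = a"
  by (auto simp: pos_def)

text \<open>Enlarging the radius lets two positive elements share one \<open>t\<close>, as needed
  for simultaneous square roots.\<close>

lemma pos_bound_mono: "a \<in> C \<Longrightarrow> 0 \<le> t \<Longrightarrow> nrm (rs t - a) \<le> t \<Longrightarrow> t \<le> t' \<Longrightarrow> nrm (rs t' - a) \<le> t'"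
  using nrm_triangle[of "rs (t' - t)" "rs t - a"] nrm_rs_le[of "t' - t"] by (simp add: cs_diff)

lemma pos_obtain_bound: assumes "pos a" "pos b" obtains t where "t > 0" "nrm (rs t - a) \<le> t" "nrm (rs t - b) \<le> t"
proof -
  obtain s t where st: "0 \<le> s" "nrm (rs s - a) \<le> s" "0 \<le> t" "nrm (rs t - b) \<le> t"
    using assms unfolding pos_def by blast
  show ?thesis
  proof (rule that[of "s + t + 1"])
    show "nrm (rs (s + t + 1) - a) \<le> s + t + 1" by (rule pos_bound_mono[of _ s]) (use st assms in auto)
    show "nrm (rs (s + t + 1) - b) \<le> s + t + 1" by (rule pos_bound_mono[of _ t]) (use st assms in auto)
  qed (use st in simp)
qed

lemma pos_zero [simp]: "pos 0"
  unfolding pos_def by (auto intro: exI[of _ 0])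

lemma pos_add: assumes "pos a" "pos b" shows "pos (a + b)"
proof -
  obtain t where t: "t > 0" "nrm (rs t - a) \<le> t" "nrm (rs t - b) \<le> t"
    using pos_obtain_bound[OF assms] .
  have "nrm ((rs t - a) + (rs t - b)) \<le> t + t"
    using t assms by (intro nrm_add_le) auto
  then have "nrm (rs (t + t) - (a + b)) \<le> t + t"
    by (simp only: rs_add) (simp add: algebra_simps)
  then show ?thesis using t assms unfolding pos_def
    by (auto simp: star_add intro!: exI[of _ "t + t"])
qed

lemma pos_scale: assumes "pos a" "0 \<le> r" shows "pos (rs r * a)"
proof -
  obtain t where t: "t \<ge> 0" "nrm (rs t - a) \<le> t" using assms unfolding pos_def by blast
  have "rs (r * t) - rs r * a = rs r * (rs t - a)" by (simp add: cs_mult right_diff_distrib)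
  then have "nrm (rs (r * t) - rs r * a) \<le> r * t"
    using nrm_cs_mult[of "rs t - a" "of_real r"] t assms by (smt (verit) diff_closed cs_closed mult_left_mono norm_of_real pos_closed)
  moreover have "star (rs r * a) = rs r * a" using assms by (simp add: star_mult pos_star cs_commute)
  ultimately show ?thesis using t assms unfolding pos_def by (auto intro!: exI[of _ "r * t"])
qed

lemma pos_scaleD: "0 < r \<Longrightarrow> pos (rs r * a) \<Longrightarrow> pos a"
  using pos_scale[of "rs r * a" "inverse r"] cs_inverse(1)[of "of_real r" a] by simp

lemma nrm_pos_normalized:
  assumes "a \<in> C" "t > 0" "nrm (rs t - a) \<le> t" shows "nrm (1 - rs (inverse t) * a) \<le> 1"
proof -
  have "1 - rs (inverse t) * a = rs (inverse t) * (rs t - a)"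
    using assms by (simp add: right_diff_distrib flip: cs_mult)
  then have "nrm (1 - rs (inverse t) * a) = inverse t * nrm (rs t - a)"
    using nrm_rs_mult[of "rs t - a" "inverse t"] assms by simp
  also have "\<dots> \<le> inverse t * t" using assms by (intro mult_left_mono) auto
  finally show ?thesis using assms by simp
qed

text \<open>The root of y is sqrt t (1 - b), where b is the limit of the iteration at 1 - y/t. Both
  elements are divided by the same \<open>t\<close>, since otherwise an intertwiner of
  \<open>a\<close> and \<open>b\<close> would not intertwine the rescaled elements.\<close>

lemma pos_sqrt_intertwine:
  assumes "pos a" "pos b"
  obtains r s where "pos r" "pos s" "r * r = a" "s * s = b"
    "\<forall>x\<in>C. x * a = b * x \<longrightarrow> x * r = s * x" "\<forall>x\<in>C. x * a = a * x \<longrightarrow> x * r = r * x"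
proof -
  obtain t where t: "t > 0" "nrm (rs t - a) \<le> t" "nrm (rs t - b) \<le> t"
    using pos_obtain_bound[OF assms] .
  define N where "N y = 1 - rs (inverse t) * y" for y
  define R where "R y = rs (sqrt t) * (1 - sqrt_lim (N y))" for y
  have N: "N y \<in> C" "nrm (N y) \<le> 1" if "y = a \<or> y = b" for y
    using that t assms nrm_pos_normalized[of y t] unfolding N_def by auto
  have "star (N y) = N y" if "y = a \<or> y = b" for y
    using that assms unfolding N_def by (auto simp: star_diff star_mult pos_star cs_commute)
  with N have sl: "star (sqrt_lim (N y)) = sqrt_lim (N y)" if "y = a \<or> y = b" for y
    using that sqrt_lim_star by blast
  have sq: "R y * R y = y" if "y = a \<or> y = b" for y
  proof -
    have "R y * R y = rs (sqrt t * sqrt t) * ((1 - sqrt_lim (N y)) * (1 - sqrt_lim (N y)))"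
      using N[OF that] unfolding R_def by (simp only: of_real_mult cs_mult_mult_cs diff_closed one_closed sqrt_lim_closed)
    also have "\<dots> = rs (sqrt t * sqrt t) * (1 - N y)"
      by (simp only: sqrt_lim_square[OF N[OF that]])
    also have "\<dots> = y" using t cs_inverse(2)[of "of_real t" y] unfolding N_def by simp
    finally show ?thesis .
  qed
  have ps: "pos (R y)" if "y = a \<or> y = b" for y
  proof -
    have "rs (sqrt t) - R y = rs (sqrt t) * sqrt_lim (N y)" unfolding R_def by (simp add: algebra_simps)
    then have "nrm (rs (sqrt t) - R y) \<le> sqrt t"
      using nrm_rs_mult[of "sqrt_lim (N y)" "sqrt t"] nrm_sqrt_lim[OF N[OF that]] N[OF that] t
      by (simp add: mult_left_le)
    moreover have "star (R y) = R y" using N[OF that] sl[OF that] unfolding R_def by (simp add: star_mult star_diff cs_commute)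
    ultimately show ?thesis using N[OF that] t unfolding pos_def by (auto simp: R_def intro!: exI[of _ "sqrt t"])
  qed
  have tw: "x * R y = R z * x" if "x \<in> C" "x * y = z * x" "y = a \<or> y = b" "z = a \<or> z = b" for x y z
  proof -
    have "x * N y = N z * x" using that(1,2) unfolding N_def
      by (simp add: algebra_simps cs_left_commute[of x])
    then have "x * sqrt_lim (N y) = sqrt_lim (N z) * x"
      using sqrt_lim_intertwine N that by blast
    then show ?thesis using that(1) unfolding R_def
      by (simp add: algebra_simps cs_left_commute[of x] cs_commute[of x])
  qed
  show ?thesis by (rule that[of "R a" "R b"]) (use ps sq tw in auto)
qed

lemma pos_sqrt:
  assumes "pos a"
  obtains r where "pos r" "r * r = a" "\<And>x. x \<in> C \<Longrightarrow> x * a = a * x \<Longrightarrow> x * r = r * x"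
  using pos_sqrt_intertwine[OF assms assms] by metis

text \<open>If commuting selfadjoint q, r satisfy q^2 + r^2 = t, then (q + ir)*(q + ir) = t.\<close>
lemma nrm_le_of_sum_squares:
  assumes "q \<in> C" "star q = q" "r \<in> C" "star r = r" "q * r = r * q" "q * q + r * r = rs t" "0 \<le> t"
  shows "nrm r \<le> sqrt t"
proof -
  let ?w = "q + cs \<i> * r"
  have sw: "star ?w = q - cs \<i> * r" using assms by (simp add: star_add star_mult cs_minus cs_commute)
  have "star ?w * ?w = q * q - cs \<i> * (cs \<i> * (r * r)) + cs \<i> * (q * r - r * q)"
    using assms(1,3) unfolding sw
    by (simp add: algebra_simps cs_left_commute[of q] cs_left_commute[of r])
  also have "\<dots> = q * q + r * r"
    using assms(5) by (simp add: cs_minus flip: mult.assoc cs_mult)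
  finally have "(nrm ?w)\<^sup>2 \<le> t"
    using nrm_star_mult[of ?w] nrm_rs_le[of t] assms by simp
  then have w: "nrm ?w \<le> sqrt t" by (simp add: real_le_rsqrt)
  moreover have "nrm (star ?w) = nrm ?w" using assms by simp
  \<comment> \<open>\<open>r\<close> is the imaginary part of \<open>?w\<close>, so its norm is at
    most that of \<open>?w\<close>.\<close>
  ultimately have "nrm (?w - star ?w) \<le> sqrt t + sqrt t"
    using nrm_triangle_diff[of ?w "star ?w"] assms by simp
  moreover have "r = cs (- \<i> / 2) * (?w - star ?w)"
  proof -
    have "cs (- \<i> / 2) * (?w - star ?w) = cs (- \<i> / 2) * (cs (2 * \<i>) * r)"
      unfolding sw using cs_add[of \<i> \<i>] by (simp add: algebra_simps)
    then show ?thesis by (simp flip: mult.assoc cs_mult)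
  qed
  ultimately show ?thesis
    using nrm_cs_mult[of "?w - star ?w" "- \<i> / 2"] assms by (simp add: norm_mult norm_divide)
qed

text \<open>For a selfadjoint contraction h the iteration at h^2 gives a selfadjoint s commuting
  with h such that h^2 + s^2 = 1. Then s has norm at most one, and so has 1 - h^2 = s^2, which is
  positivity of h^2 with radius one. Rescaling gives the general case.\<close>

lemma pos_square: assumes "h \<in> C" "star h = h" shows "pos (h * h)"
proof -
  have 1: "pos (h * h)" if h: "h \<in> C" "star h = h" "nrm h \<le> 1" for h
  proof -
    have hh: "h * h \<in> C" "nrm (h * h) \<le> 1"
      using h nrm_mult[of h h] mult_le_one[of "nrm h" "nrm h"] by auto
    let ?s = "1 - sqrt_lim (h * h)"
    have hs: "h * ?s = ?s * h"
      using sqrt_lim_intertwine[OF hh hh h(1)] by (simp add: algebra_simps)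
    have ss: "star ?s = ?s" using sqrt_lim_star[OF hh] h hh by (simp add: star_diff star_mult)
    have "nrm ?s \<le> sqrt 1"
      by (rule nrm_le_of_sum_squares[of h]) (use h hh hs ss sqrt_lim_square[OF hh] in auto)
    then have "nrm (1 - h * h) \<le> 1"
      using sqrt_lim_square[OF hh] nrm_mult[of ?s ?s] hh mult_le_one[of "nrm ?s" "nrm ?s"] by auto
    then show ?thesis using h unfolding pos_def by (auto simp: star_mult intro!: exI[of _ 1])
  qed
  let ?r = "inverse (1 + nrm h)"
  have r: "?r > 0" using nrm_nonneg[of h] by (simp add: add_pos_nonneg)
  let ?k = "rs ?r * h"
  have "nrm ?k = ?r * nrm h" using nrm_rs_mult[of h ?r] assms r by simp
  also have "\<dots> \<le> 1"
  proof -
    have "0 < 1 + nrm h" using nrm_nonneg[of h] by linarith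
    then show ?thesis by (simp add: pos_divide_le_eq field_simps)
  qed
  finally have "nrm ?k \<le> 1" .
  then have "pos (?k * ?k)" using 1[of ?k] assms by (simp add: star_mult cs_commute)
  also have "?k * ?k = rs (?r * ?r) * (h * h)"
    unfolding of_real_mult by (rule cs_mult_mult_cs[OF assms(1)])
  finally show ?thesis using pos_scaleD r mult_pos_pos by blast
qed

text \<open>The square roots of \<open>x\<close> and \<open>rs t - x\<close> commute and their
  squares add up to t, so \<open>nrm_le_of_sum_squares\<close> bounds the root of \<open>x\<close>
  by sqrt t.\<close>

lemma nrm_le_of_pos:
  assumes "pos x" "pos (rs t - x)" "0 \<le> t" shows "nrm x \<le> t"
proof -
  obtain r where r: "pos r" "r * r = x" "\<And>y. y \<in> C \<Longrightarrow> y * x = x * y \<Longrightarrow> y * r = r * y"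
    using pos_sqrt[OF assms(1)] by blast
  obtain q where q: "pos q" "q * q = rs t - x" "\<And>y. y \<in> C \<Longrightarrow> y * (rs t - x) = (rs t - x) * y \<Longrightarrow> y * q = q * y"
    using pos_sqrt[OF assms(2)] by blast
  have "r * x = x * r" using r(2) mult.assoc by metis
  then have "r * q = q * r" using q(3)[of r] r(1) by (simp add: algebra_simps cs_commute)
  then have "nrm r \<le> sqrt t"
    using nrm_le_of_sum_squares[of q r t] q(1,2) r(1,2) assms by (simp add: pos_star)
  then have "nrm r * nrm r \<le> sqrt t * sqrt t" by (intro mult_mono) (use assms in auto)
  then show ?thesis using nrm_mult[of r r] r(1,2) assms by simp
qed

lemma pos_rs: "0 \<le> t \<Longrightarrow> pos (rs t)"
  unfolding pos_def by (auto intro!: exI[of _ t])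

lemma pos_one [simp]: "pos 1" using pos_rs[of 1] by simp

lemma pos_rs_diff: "x \<in> C \<Longrightarrow> star x = x \<Longrightarrow> nrm x \<le> t \<Longrightarrow> pos (rs t - x)"
  unfolding pos_def using order_trans[OF nrm_nonneg, of x t] by (auto simp: star_diff intro!: exI[of _ t])

text \<open>Apply \<open>nrm_le_of_pos\<close> to \<open>rs t - x\<close>, whose complement in
  \<open>rs t\<close> is \<open>x\<close>. So any bound of the norm serves as radius in
  \<open>pos\<close>.\<close>

lemma pos_imp_bound: "pos x \<Longrightarrow> nrm x \<le> t \<Longrightarrow> nrm (rs t - x) \<le> t"
  using nrm_le_of_pos[of "rs t - x" t] pos_rs_diff[of x t] order_trans[OF nrm_nonneg, of x t]
  by (simp add: pos_star)

lemma nrm_mono_pos: assumes "pos x" "pos (y - x)" "y \<in> C" shows "nrm x \<le> nrm y"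
proof -
  have "star y = y" using pos_star[OF pos_add[OF assms(1,2)]] by simp
  then have "pos ((rs (nrm y) - y) + (y - x))"
    using assms by (intro pos_add pos_rs_diff) auto
  then show ?thesis using nrm_le_of_pos[OF assms(1), of "nrm y"] by simp
qed

lemma pos_antisym: "pos x \<Longrightarrow> pos (- x) \<Longrightarrow> x = 0"
  using nrm_le_of_pos[of x 0] nrm_zeroD[of x] nrm_nonneg[of x] by simp

lemma pos_mult_commuting: assumes "pos a" "pos b" "a * b = b * a" shows "pos (a * b)"
proof -
  obtain r where r: "pos r" "r * r = a" "\<And>y. y \<in> C \<Longrightarrow> y * a = a * y \<Longrightarrow> y * r = r * y"
    using pos_sqrt[OF assms(1)] by blast
  obtain q where q: "pos q" "q * q = b" "\<And>y. y \<in> C \<Longrightarrow> y * b = b * y \<Longrightarrow> y * q = q * y"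
    using pos_sqrt[OF assms(2)] by blast
  have "b * r = r * b" using r(3)[of b] assms by simp
  then have rq: "r * q = q * r" using q(3)[of r] r(1) by simp
  then have "star (r * q) = r * q" using r(1) q(1) by (simp add: star_mult pos_star)
  then have "pos (r * q * (r * q))" using pos_square r(1) q(1) by blast
  also have "r * q * (r * q) = a * b" using rq r(2) q(2) by (metis mult.assoc)
  finally show ?thesis .
qed

text \<open>If s and t commute, put d = s - t. Then d^2 s and d^2 t are positive with sum d (s^2 -
  t^2) = 0, so both vanish; hence d^3 = 0 and d = 0. In general both roots are compared with the
  constructed root of t^2, which commutes with everything that commutes with t^2.\<close>

lemma pos_sqrt_unique: assumes "pos s" "pos t" "s * s = t * t" shows "s = t"
proof -
  have *: "s = t" if s: "pos s" and t: "pos t" and c: "s * t = t * s" and sq: "s * s = t * t" for s t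
  proof -
    let ?d = "s - t"
    have d: "?d \<in> C" "star ?d = ?d" "pos (?d * ?d)"
      using s t by (auto simp: star_diff pos_star intro!: pos_square)
    have "?d * s = s * ?d" "?d * t = t * ?d" using c by (auto simp: algebra_simps)
    then have c2: "?d * ?d * s = s * (?d * ?d)" "?d * ?d * t = t * (?d * ?d)"
      by (metis mult.assoc)+
    have p: "pos (?d * ?d * s)" "pos (?d * ?d * t)"
      using pos_mult_commuting d(3) s t c2 by blast+
    have st: "?d * (s + t) = 0" using c sq by (simp add: algebra_simps)
    have "?d * ?d * s + ?d * ?d * t = ?d * (?d * (s + t))" by (simp add: distrib_left mult.assoc)
    also have "\<dots> = 0" unfolding st by simp
    finally have z: "?d * ?d * s + ?d * ?d * t = 0" .
    then have "?d * ?d * t = - (?d * ?d * s)" by (simp add: eq_neg_iff_add_eq_0 add.commute)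
    then have "?d * ?d * s = 0" "?d * ?d * t = 0" using pos_antisym p z by auto
    then have "?d * ?d * ?d = 0" by (simp only: right_diff_distrib) simp
    then have "(?d * ?d) * (?d * ?d) = 0" by (metis mult.assoc mult_zero_left)
    then have "?d * ?d = 0" using self_adjoint_square_zeroD d(3) pos_star by blast
    then have "?d = 0" using self_adjoint_square_zeroD d(1,2) by blast
    then show ?thesis by simp
  qed
  have "pos (t * t)" using assms(2) by (auto intro!: pos_square simp: pos_star)
  then obtain r where r: "pos r" "r * r = t * t" "\<And>y. y \<in> C \<Longrightarrow> y * (t * t) = (t * t) * y \<Longrightarrow> y * r = r * y"
    using pos_sqrt by blast
  have tr: "t * r = r * t" using r(3)[of t] assms(2) by (simp add: mult.assoc)
  have sr: "s * r = r * s" using r(3)[of s] assms(1) unfolding assms(3)[symmetric] by (simp add: mult.assoc)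
  show ?thesis
    by (rule trans[OF *[OF assms(1) r(1) sr trans[OF assms(3) r(2)[symmetric]]]
          *[OF assms(2) r(1) tr r(2)[symmetric], symmetric]])
qed

text \<open>Kaplansky's argument, with intertwining of square roots in place of spectra: if c*c = - r and
  q = cc*, then q is positive as well, so c r = - q c while c (r^2)^(1/2) = (q^2)^(1/2) c.\<close>
lemma star_mult_neg_pos_zero:
  assumes c: "c \<in> C" and r: "pos (- (star c * c))" shows "c = 0"
proof -
  let ?r = "- (star c * c)" and ?q = "c * star c"
  \<comment> \<open>Up to sign these are twice the real and imaginary parts of \<open>c\<close>.
    Their squares add up to 2 (c c* + c* c), which makes c c* a sum of positive elements.\<close>
  let ?x = "c + star c" and ?y = "cs \<i> * (c - star c)"
  have "star ?x = ?x" "star ?y = ?y"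
    using c by (simp_all add: star_add star_diff star_mult cs_minus cs_commute right_diff_distrib add.commute)
  then have "pos (?x * ?x + ?y * ?y)"
    using c by (intro pos_add pos_square) auto
  moreover have "?y * ?y = - ((c - star c) * (c - star c))"
  proof -
    have "?y * ?y = cs (\<i> * \<i>) * ((c - star c) * (c - star c))"
      using c by (intro cs_mult_mult_cs) auto
    then show ?thesis by (simp add: cs_minus)
  qed
  then have "?x * ?x + ?y * ?y = rs 2 * (?q + star c * c)"
    using cs_add[of 1 1] by (simp add: algebra_simps)
  ultimately have "pos (?q + star c * c)" using pos_scaleD[of 2] by simp
  from pos_add[OF this r] have q: "pos ?q" by simp
  have cr: "c * ?r = - (?q * c)" by (simp add: mult.assoc)
  then have "c * (?r * ?r) = (?q * ?q) * c"
    by (metis cr mult.assoc mult_minus_left mult_minus_right minus_minus)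
  moreover have pp: "pos (?r * ?r)" "pos (?q * ?q)" using pos_square[OF pos_closed[OF r] pos_star[OF r]] pos_square[OF pos_closed[OF q] pos_star[OF q]] by auto
  obtain r' q' where rq: "pos r'" "pos q'" "r' * r' = ?r * ?r" "q' * q' = ?q * ?q"
    "\<forall>x\<in>C. x * (?r * ?r) = (?q * ?q) * x \<longrightarrow> x * r' = q' * x"
    by (rule pos_sqrt_intertwine[OF pp])
  have "r' = ?r" "q' = ?q"
    using pos_sqrt_unique[OF rq(1) r rq(3)] pos_sqrt_unique[OF rq(2) q rq(4)] by blast+
  ultimately have "c * ?r = ?q * c" using rq(5) c by metis
  with cr have "rs 2 * (?q * c) = rs 2 * 0"
    using cs_add[of 1 1] by (simp add: distrib_right neg_eq_iff_add_eq_0)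
  then have "?q * c = 0" using cs_cancel[of "of_real 2"] by (metis of_real_numeral zero_neq_numeral)
  then have "(star c * c) * (star c * c) = 0" by (simp add: mult.assoc)
  then have "star c * c = 0"
    using self_adjoint_square_zeroD[of "star c * c"] c by (simp add: star_mult)
  then show ?thesis using star_mult_zeroD[OF c] by blast
qed

text \<open>For a = b* b put k = |a|, so that g = k - a is twice the negative part of a, and a g = -
  k g. Then b g has square (b g)* b g = g a g = - k g^2, and \<open>star_mult_neg_pos_zero\<close>
  gives b g = 0. Now a g = k g = 0, so g^2 = 0 and a = k.\<close>

lemma pos_star_mult: assumes b: "b \<in> C" shows "pos (star b * b)"
proof -
  let ?a = "star b * b"
  have a: "?a \<in> C" "star ?a = ?a" using b by (auto simp: star_mult)
  obtain k where k: "pos k" "k * k = ?a * ?a" "\<And>y. y \<in> C \<Longrightarrow> y * (?a * ?a) = (?a * ?a) * y \<Longrightarrow> y * k = k * y"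
    using pos_sqrt[OF pos_square[OF a]] by blast
  have ak: "?a * k = k * ?a" using k(3)[of ?a] a by (simp add: mult.assoc)
  let ?g = "k - ?a"
  have g: "?g \<in> C" "star ?g = ?g" using k(1) a by (auto simp: star_diff pos_star)
  have ag: "?a * ?g = - (k * ?g)" using ak k(2) by (simp add: right_diff_distrib)
  have gk: "?g * k = k * ?g" using ak by (simp add: algebra_simps)
  have gag: "?g * ?a * ?g = - (k * (?g * ?g))"
    using ag gk by (metis mult.assoc mult_minus_right)
  have "pos (?g * ?g)" using g pos_square by blast
  moreover have "k * (?g * ?g) = ?g * ?g * k" using gk by (metis mult.assoc)
  ultimately have "pos (k * (?g * ?g))" using pos_mult_commuting[OF k(1)] by blast
  moreover have "star (b * ?g) * (b * ?g) = ?g * ?a * ?g"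
    using star_mult[OF b g(1)] unfolding g(2) by (simp add: mult.assoc)
  ultimately have "b * ?g = 0"
    using star_mult_neg_pos_zero[of "b * ?g"] gag b g by simp
  then have ag0: "?a * ?g = 0" by (simp add: mult.assoc)
  then have "k * ?g = 0" using ag by simp
  with ag0 have "?g * ?g = 0" by (simp only: left_diff_distrib) simp
  then have "?g = 0" using self_adjoint_square_zeroD g by blast
  then show ?thesis using k(1) by simp
qed

lemma pos_conjugate: assumes "pos p" "c \<in> C" shows "pos (star c * p * c)"
proof -
  obtain r where r: "pos r" "r * r = p" by (rule pos_sqrt[OF assms(1)])
  have "star (r * c) * (r * c) = star c * p * c"
    using r assms by (simp add: star_mult pos_star mult.assoc flip: r(2))
  then show ?thesis using pos_star_mult[of "r * c"] r assms by auto
qed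

section \<open>Continuity of the positive square root\<close>

lemma nrm_sqrt_iter_continuous:
  assumes "a \<in> C" "nrm a \<le> 1" "b \<in> C" "nrm b \<le> 1"
  shows "nrm (sqrt_iter a n - sqrt_iter b n) \<le> real n * nrm (a - b)"
proof (induction n)
  case (Suc n)
  let ?a = "sqrt_iter a n" and ?b = "sqrt_iter b n"
  have m: "?a \<in> C" "?b \<in> C" using assms by auto
  have le1: "nrm ?a \<le> 1" "nrm ?b \<le> 1"
    using nrm_sqrt_iter assms sqrt_bound_range order_trans by blast+
  have d: "sqrt_iter a (Suc n) - sqrt_iter b (Suc n) = cs (1/2) * ((a - b) + ((?a - ?b) * ?a + ?b * (?a - ?b)))"
    by (simp add: algebra_simps)
  have "nrm ((?a - ?b) * ?a) \<le> real n * nrm (a - b)"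
    using nrm_mult[of "?a - ?b" ?a] m le1 Suc mult_left_le[of "nrm ?a" "nrm (?a - ?b)"] by simp
  moreover have "nrm (?b * (?a - ?b)) \<le> real n * nrm (a - b)"
    using nrm_mult[of ?b "?a - ?b"] m le1 Suc mult_left_le_one_le[of "nrm (?a - ?b)" "nrm ?b"] by simp
  ultimately have "nrm ((a - b) + ((?a - ?b) * ?a + ?b * (?a - ?b)))
      \<le> nrm (a - b) + (real n * nrm (a - b) + real n * nrm (a - b))"
    using m assms by (intro nrm_add_le) auto
  then have "nrm (sqrt_iter a (Suc n) - sqrt_iter b (Suc n)) \<le> (nrm (a - b) + (real n * nrm (a - b) + real n * nrm (a - b))) / 2"
    unfolding d using nrm_cs_mult[of "(a - b) + ((?a - ?b) * ?a + ?b * (?a - ?b))" "1/2"] m assms by simp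
  \<comment> \<open>Halving cancels the factor 2 from differentiating a square on the unit ball;
    each step adds only half of \<open>nrm (a - b)\<close>.\<close>
  also have "\<dots> \<le> real (Suc n) * nrm (a - b)" by (simp add: algebra_simps)
  finally show ?case .
qed simp

text \<open>The bound does not depend on \<open>c\<close>: convergence is uniform on the unit ball,
  so the limit inherits continuity from the iterates.\<close>

lemma nrm_sqrt_lim_iter:
  assumes "c \<in> C" "nrm c \<le> 1"
  shows "nrm (sqrt_lim c - sqrt_iter c n) \<le> lim sqrt_bound - sqrt_bound n"
proof -
  have "conv (\<lambda>k. sqrt_iter c (k + n)) (sqrt_lim c)"
    using conv_sqrt_lim[OF assms] LIMSEQ_ignore_initial_segment[of "\<lambda>k. nrm (sqrt_iter c k - sqrt_lim c)" 0 n]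
    unfolding conv_def by auto
  from conv_add[OF this conv_const[of "- sqrt_iter c n"]]
  have *: "conv (\<lambda>k. sqrt_iter c (k + n) - sqrt_iter c n) (sqrt_lim c - sqrt_iter c n)"
    using assms by simp
  have "sqrt_bound \<longlonglongrightarrow> lim sqrt_bound" using sqrt_bound_convergent convergent_LIMSEQ_iff by blast
  then have "sqrt_bound k \<le> lim sqrt_bound" for k by (rule incseq_le[OF sqrt_bound_incseq])
  then have "nrm (sqrt_iter c (k + n) - sqrt_iter c n) \<le> lim sqrt_bound - sqrt_bound n" for k
    using nrm_sqrt_iter_diff[OF assms, of n k] by (smt (verit) add.commute)
  then show ?thesis using conv_bound[OF *] by blast
qed

text \<open>By uniqueness of roots every positive contraction is recovered from its square by the
  iteration, so estimates for \<open>sqrt_lim\<close> become estimates for arbitrary positive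
  roots.\<close>

lemma sqrt_lim_eq:
  assumes "pos s" "nrm s \<le> 1" shows "sqrt_lim (1 - s * s) = 1 - s" "nrm (1 - s * s) \<le> 1"
proof -
  have ss: "pos (s * s)" "nrm (s * s) \<le> 1"
    using assms pos_square[of s] nrm_mult[of s s] mult_le_one[of "nrm s" "nrm s"] by (auto simp: pos_star)
  let ?c = "1 - s * s"
  show n: "nrm ?c \<le> 1" using pos_imp_bound[OF ss] by simp
  have c: "?c \<in> C" "star ?c = ?c" using ss by (auto simp: star_diff pos_star)
  have "pos (1 - sqrt_lim ?c)"
    unfolding pos_def using n c sqrt_lim_star nrm_sqrt_lim by (auto simp: star_diff intro!: exI[of _ 1])
  moreover have "(1 - sqrt_lim ?c) * (1 - sqrt_lim ?c) = s * s"
    using sqrt_lim_square n c by simp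
  ultimately have "1 - sqrt_lim ?c = s" using pos_sqrt_unique assms by blast
  then show "sqrt_lim ?c = 1 - s" by (simp add: algebra_simps)
qed

text \<open>Both roots are written as limits of the iteration, the limits are replaced by the n-th
  iterates at a cost independent of s, and the iterates are compared by their Lipschitz
  bound.\<close>

lemma pos_sqrt_continuous:
  assumes t: "pos t" and e: "0 < e"
  obtains d where "0 < d" "\<And>s. pos s \<Longrightarrow> nrm (s * s - t * t) < d \<Longrightarrow> nrm (s - t) < e"
proof -
  \<comment> \<open>Any s with \<open>nrm (s * s - t * t) < 1\<close> has norm at most
    \<open>M\<close>, so division by \<open>M\<close> brings both roots into the unit ball.\<close>
  define M where "M = 1 + nrm t"
  have M: "M \<ge> 1" "nrm t \<le> M" by (auto simp: M_def)
  have "sqrt_bound \<longlonglongrightarrow> lim sqrt_bound" using sqrt_bound_convergent convergent_LIMSEQ_iff by blast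
  then obtain n where n: "\<bar>sqrt_bound n - lim sqrt_bound\<bar> < e / (4 * M)"
    using e M unfolding LIMSEQ_def dist_real_def by (metis divide_pos_pos le_refl less_le_trans mult_pos_pos zero_less_numeral zero_less_one)
  \<comment> \<open>The bound 1 keeps s below \<open>M\<close>; the other bound pays for the
    Lipschitz constant n and leaves e/2. With the two tails of e/4 the total is e, everything being
    divided by \<open>M\<close>.\<close>
  define d where "d = min 1 (e / (2 * (real n + 1)))"
  have d: "0 < d" "d \<le> 1" "real n * d < e / 2"
  proof -
    show "0 < d" "d \<le> 1" using e by (auto simp: d_def)
    have "real n * d \<le> real n * (e / (2 * (real n + 1)))" by (intro mult_left_mono) (auto simp: d_def)
    also have "\<dots> < e / 2" using e by (simp add: field_simps)
    finally show "real n * d < e / 2" .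
  qed
  show ?thesis
  proof (rule that[OF d(1)])
    fix s assume s: "pos s" and near: "nrm (s * s - t * t) < d"
    have "(nrm s)\<^sup>2 \<le> nrm (s * s - t * t) + nrm (t * t)"
      using nrm_triangle[of "s * s - t * t" "t * t"] nrm_self_adjoint_square[of s] s t by (simp add: pos_star)
    also have "\<dots> \<le> 1 + (nrm t)\<^sup>2" using near d(2) nrm_self_adjoint_square[of t] t by (simp add: pos_star)
    also have "\<dots> \<le> M\<^sup>2" unfolding M_def by (simp add: power2_eq_square algebra_simps)
    finally have sM: "nrm s \<le> M" by (rule power2_le_imp_le) (use M in simp)
    define N where "N y = rs (inverse M) * y" for y
    have N: "pos (N y)" "nrm (N y) \<le> 1" if "pos y" "nrm y \<le> M" for y
    proof -
      show "pos (N y)" unfolding N_def by (rule pos_scale) (use that M in auto)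
      have "nrm (N y) = inverse M * nrm y" unfolding N_def by (rule nrm_rs_mult) (use that M in auto)
      also have "\<dots> \<le> inverse M * M" by (rule mult_left_mono) (use that M in auto)
      finally show "nrm (N y) \<le> 1" using M by simp
    qed
    let ?a = "1 - N s * N s" and ?b = "1 - N t * N t"
    have ab: "?a \<in> C" "nrm ?a \<le> 1" "?b \<in> C" "nrm ?b \<le> 1"
      using sqrt_lim_eq N[OF s sM] N[OF t M(2)] by auto
    have "N t * N t - N s * N s = rs (inverse M) * (rs (inverse M) * (t * t - s * s))"
      using cs_mult_mult_cs[OF pos_closed[OF s]] cs_mult_mult_cs[OF pos_closed[OF t]]
      unfolding N_def by (simp only: cs_mult mult.assoc right_diff_distrib)
    then have "nrm (?a - ?b) = inverse M * (inverse M * nrm (s * s - t * t))"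
      using nrm_rs_mult[of "t * t - s * s" "inverse M"] nrm_rs_mult[of "rs (inverse M) * (t * t - s * s)" "inverse M"]
        s t M nrm_diff_commute[of "t * t" "s * s"] by simp
    also have "\<dots> \<le> inverse M * (1 * nrm (s * s - t * t))"
      using M by (intro mult_left_mono mult_right_mono) (auto simp: inverse_le_1_iff)
    finally have "nrm (?a - ?b) \<le> inverse M * nrm (s * s - t * t)" by simp
    then have "real n * nrm (?a - ?b) \<le> inverse M * (real n * d)"
      using near M mult_left_mono[of "nrm (?a - ?b)" "inverse M * d" "real n"]
      by (smt (verit) inverse_nonnegative_iff_nonnegative mult.left_commute mult_left_mono of_nat_0_le_iff)
    also have "\<dots> \<le> inverse M * (e / 2)" using d M by (intro mult_left_mono) auto
    finally have 1: "nrm (sqrt_iter ?a n - sqrt_iter ?b n) \<le> e / (2 * M)"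
      using nrm_sqrt_iter_continuous[OF ab, of n] by (simp add: field_simps)
    have 2: "nrm (sqrt_lim ?a - sqrt_iter ?a n) < e / (4 * M)" "nrm (sqrt_lim ?b - sqrt_iter ?b n) < e / (4 * M)"
      using nrm_sqrt_lim_iter[OF ab(1,2), of n] nrm_sqrt_lim_iter[OF ab(3,4), of n] n by auto
    have m: "sqrt_lim ?a \<in> C" "sqrt_lim ?b \<in> C" "sqrt_iter ?a n \<in> C" "sqrt_iter ?b n \<in> C"
      using ab by blast+
    have "nrm (sqrt_lim ?a - sqrt_lim ?b) < e / (4 * M) + e / (2 * M) + e / (4 * M)"
      using nrm_dist_triangle[of "sqrt_lim ?a" "sqrt_iter ?a n" "sqrt_lim ?b"]
        nrm_dist_triangle[of "sqrt_iter ?a n" "sqrt_iter ?b n" "sqrt_lim ?b"]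
        nrm_diff_commute[of "sqrt_iter ?b n" "sqrt_lim ?b"] m 1 2 by linarith
    also have "\<dots> = e / M" using M by (simp add: field_simps)
    also have "sqrt_lim ?a - sqrt_lim ?b = N t - N s"
      using sqrt_lim_eq(1) N[OF s sM] N[OF t M(2)] by simp
    also have "\<dots> = rs (inverse M) * (t - s)" by (simp add: N_def right_diff_distrib)
    finally show "nrm (s - t) < e"
      using nrm_rs_mult[of "t - s" "inverse M"] s t M nrm_diff_commute[of s t] by (simp add: field_simps)
  qed
qed

section \<open>Powers of 1 - p for a positive contraction p\<close>

lemma pos_power: "pos a \<Longrightarrow> pos (a ^ n)"
proof (induction n)
  case (Suc n)
  then show ?case using pos_mult_commuting[of a "a ^ n"] by (simp add: power_commutes)
qed simp

text \<open>Summing the decreasing terms (1 - p)^j p for j = 0..n telescopes to 1 - (1 - p)^(n+1), which is at most 1.\<close>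
lemma nrm_one_minus_power_mult:
  assumes p: "pos p" "nrm p \<le> 1"
  shows "(real n + 1) * nrm ((1 - p) ^ n * p) \<le> 1"
proof -
  let ?e = "1 - p"
  have e: "pos ?e" using pos_rs_diff[of p 1] p by (simp add: pos_star)
  have ep: "?e * p = p * ?e" by (simp add: algebra_simps)
  have cm: "?e ^ j * p = p * ?e ^ j" for j
    using power_commuting_commutes[OF ep] .
  have pe: "pos (?e ^ j)" for j using pos_power[OF e] .
  have pep: "pos (?e ^ j * p)" for j using pos_mult_commuting[OF pe p(1) cm] .
  have diff: "?e ^ j * p - ?e ^ Suc j * p = ?e ^ j * (p * p)" for j
  proof -
    have "?e ^ Suc j * p = ?e ^ j * (?e * p)" by (simp only: power_Suc2 mult.assoc)
    then show ?thesis by (simp add: algebra_simps)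
  qed
  have "pos (?e ^ j * (p * p))" for j
    by (rule pos_mult_commuting[OF pe]) (use p cm in \<open>auto intro!: pos_square simp: pos_star\<close>, metis cm mult.assoc)
  then have step: "pos (?e ^ j * p - ?e ^ Suc j * p)" for j using diff by simp
  \<comment> \<open>Instead of the sum, the induction carries n + 1 copies of its smallest term and
    the remainder \<open>?e ^ Suc n\<close>. Each step lowers all copies to the next term and splits
    one more off the remainder.\<close>
  have "pos (1 - rs (real n + 1) * (?e ^ n * p) - ?e ^ Suc n)"
  proof (induction n)
    case 0
    show ?case by simp
  next
    case (Suc n)
    have "pos (rs (real n + 1) * (?e ^ n * p - ?e ^ Suc n * p))" using step by (intro pos_scale) auto
    from pos_add[OF Suc this] have *: "pos (1 - rs (real n + 1) * (?e ^ Suc n * p) - ?e ^ Suc n)"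
      by (simp add: right_diff_distrib diff_diff_eq add.commute)
    have "?e ^ Suc (Suc n) = ?e ^ Suc n - ?e ^ Suc n * p"
      by (simp only: power_Suc2[of _ "Suc n"] right_diff_distrib) simp
    moreover have "rs (real (Suc n) + 1) * (?e ^ Suc n * p) = rs (real n + 1) * (?e ^ Suc n * p) + ?e ^ Suc n * p"
    proof -
      have "complex_of_real (real (Suc n) + 1) = complex_of_real (real n + 1) + 1" by simp
      then show ?thesis by (simp only: cs_add distrib_right) simp
    qed
    ultimately have "1 - rs (real (Suc n) + 1) * (?e ^ Suc n * p) - ?e ^ Suc (Suc n)
       = 1 - rs (real n + 1) * (?e ^ Suc n * p) - ?e ^ Suc n"
      by (simp only:) simp
    then show ?case using * by (simp only:)
  qed
  from pos_add[OF this pe[of "Suc n"]]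
  have "pos (rs 1 - rs (real n + 1) * (?e ^ n * p))" by simp
  then have "nrm (rs (real n + 1) * (?e ^ n * p)) \<le> 1"
    using pos_scale[OF pep[of n], of "real n + 1"] nrm_le_of_pos[of _ 1] by simp
  then show ?thesis using nrm_rs_mult[of "?e ^ n * p" "real n + 1"] pep[of n] by simp
qed

lemma sum_closed: "(\<And>i. i \<in> I \<Longrightarrow> f i \<in> C) \<Longrightarrow> sum f I \<in> C"
  by (induction I rule: infinite_finite_induct) auto

lemma star_sum: "(\<And>i. i \<in> I \<Longrightarrow> f i \<in> C) \<Longrightarrow> star (sum f I) = (\<Sum>i\<in>I. star (f i))"
  by (induction I rule: infinite_finite_induct) (auto simp: star_add sum_closed)

text \<open>This turns smallness of (1 - P)^n x into an approximation of x by P (Q x) with a fixed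
  bounded operator Q.\<close>

lemma one_minus_power_factor: assumes "P \<in> C" shows "\<exists>Q\<in>C. 1 - (1 - P) ^ n = P * Q"
proof (induction n)
  case 0
  show ?case by (auto intro!: bexI[of _ 0])
next
  case (Suc n)
  then obtain Q where Q: "Q \<in> C" "1 - (1 - P) ^ n = P * Q" by blast
  have "1 - (1 - P) ^ Suc n = (1 - (1 - P) ^ n) + P * (1 - P) ^ n" by (simp add: left_diff_distrib)
  also have "\<dots> = P * (Q + (1 - P) ^ n)" unfolding Q(2) by (simp add: distrib_left)
  finally show ?case using Q(1) assms by blast
qed

section \<open>Closed ideals, their unitizations and polar decomposition\<close>

definition closed_ideal :: "'r set \<Rightarrow> bool" where
  "closed_ideal J \<longleftrightarrow> J \<subseteq> C \<and> 0 \<in> J \<and> (\<forall>x\<in>J. \<forall>y\<in>J. x + y \<in> J)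
     \<and> (\<forall>x\<in>J. \<forall>a\<in>C. a * x \<in> J \<and> x * a \<in> J) \<and> (\<forall>x\<in>J. star x \<in> J)
     \<and> (\<forall>X L. conv X L \<longrightarrow> (\<forall>n. X n \<in> J) \<longrightarrow> L \<in> J)"

definition unitized :: "'r set \<Rightarrow> 'r set" where
  "unitized J = {x \<in> C. \<exists>l. x - cs l \<in> J}"

context
  fixes J assumes J: "closed_ideal J"
begin

lemma ideal_closed: "x \<in> J \<Longrightarrow> x \<in> C"
  and ideal_zero: "0 \<in> J"
  and ideal_add: "x \<in> J \<Longrightarrow> y \<in> J \<Longrightarrow> x + y \<in> J"
  and ideal_mult_left: "x \<in> J \<Longrightarrow> a \<in> C \<Longrightarrow> a * x \<in> J"
  and ideal_mult_right: "x \<in> J \<Longrightarrow> a \<in> C \<Longrightarrow> x * a \<in> J"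
  and ideal_star: "x \<in> J \<Longrightarrow> star x \<in> J"
  and ideal_limit: "conv X L \<Longrightarrow> (\<And>n. X n \<in> J) \<Longrightarrow> L \<in> J"
  using J unfolding closed_ideal_def by blast+

lemma ideal_uminus: "x \<in> J \<Longrightarrow> - x \<in> J"
  using ideal_mult_left[of x "cs (-1)"] by (simp add: cs_minus)

lemma unitized_closed: "x \<in> unitized J \<Longrightarrow> x \<in> C"
  by (simp add: unitized_def)

lemma unitized_cs: "cs l \<in> unitized J"
  unfolding unitized_def using ideal_zero by (auto intro!: exI[of _ l])

lemma unitized_add_ideal: "x \<in> unitized J \<Longrightarrow> y \<in> J \<Longrightarrow> x + y \<in> unitized J"
proof -
  assume "x \<in> unitized J" "y \<in> J"
  then obtain l where "x \<in> C" "x - cs l \<in> J" by (auto simp: unitized_def)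
  moreover have "x + y - cs l = (x - cs l) + y" by simp
  ultimately show ?thesis
    using \<open>y \<in> J\<close> ideal_add ideal_closed unfolding unitized_def by (metis (mono_tags, lifting) add_closed mem_Collect_eq)
qed

lemma unitized_mult: assumes "x \<in> unitized J" "y \<in> unitized J" shows "x * y \<in> unitized J"
proof -
  obtain l m where lm: "x \<in> C" "y \<in> C" "x - cs l \<in> J" "y - cs m \<in> J"
    using assms by (auto simp: unitized_def)
  have "x * y - cs (l * m) = (x - cs l) * y + cs l * (y - cs m)"
    by (simp add: algebra_simps cs_mult)
  then have "x * y - cs (l * m) \<in> J" using lm by (simp only: ideal_add ideal_mult_left ideal_mult_right cs_closed)
  then show ?thesis using lm unfolding unitized_def by blast
qed

lemma unitized_star: assumes "x \<in> unitized J" shows "star x \<in> unitized J"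
proof -
  obtain l where l: "x \<in> C" "x - cs l \<in> J" using assms by (auto simp: unitized_def)
  then have "star x - cs (cnj l) \<in> J" using ideal_star[of "x - cs l"] by (simp add: star_diff)
  then show ?thesis using l unfolding unitized_def by blast
qed

text \<open>The scalar part of an element of the unitization need not be determined by the element, so the scalar
  parts of the iterates are followed explicitly.\<close>
lemma sqrt_lim_unitized:
  assumes c: "c \<in> C" "nrm c \<le> 1" "c - rs g \<in> J" and g: "0 \<le> g" "g \<le> 1"
  shows "sqrt_lim c \<in> unitized J"
proof -
  obtain b where b: "sqrt_scalar g \<longlonglongrightarrow> b"
    using sqrt_scalar_convergent[OF g] by (auto simp: convergent_def)
  have "conv (\<lambda>n. cs (- of_real (sqrt_scalar g n))) (cs (- of_real b))"
  proof -
    have "nrm (cs (- of_real (sqrt_scalar g n)) - cs (- of_real b)) \<le> \<bar>b - sqrt_scalar g n\<bar>" for n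
      using nrm_cs_le[of "of_real (b - sqrt_scalar g n)"] unfolding norm_of_real by (simp add: cs_minus cs_diff)
    moreover have "(\<lambda>n. \<bar>b - sqrt_scalar g n\<bar>) \<longlonglongrightarrow> 0"
      using tendsto_rabs[OF tendsto_diff[OF tendsto_const b], of b] by simp
    ultimately have "(\<lambda>n. nrm (cs (- of_real (sqrt_scalar g n)) - cs (- of_real b))) \<longlonglongrightarrow> 0"
      by (intro LIMSEQ_zero_squeeze[OF _ nrm_nonneg])
    then show ?thesis by (simp add: conv_def)
  qed
  from conv_add[OF conv_sqrt_lim[OF c(1,2)] this]
  have lim: "conv (\<lambda>n. sqrt_iter c n - rs (sqrt_scalar g n)) (sqrt_lim c - rs b)"
    by (simp add: cs_minus)
  \<comment> \<open>Operators and scalars obey the same recursion, and a difference of squares is a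
    combination of the previous difference, which lies in the ideal.\<close>
  have "sqrt_iter c n - rs (sqrt_scalar g n) \<in> J" for n
  proof (induction n)
    case (Suc n)
    let ?b = "sqrt_iter c n" and ?s = "sqrt_scalar g n"
    have "complex_of_real ((g + ?s\<^sup>2) / 2) = 1/2 * (of_real g + of_real ?s * of_real ?s)"
      by (simp add: power2_eq_square)
    then have "rs ((g + ?s\<^sup>2) / 2) = cs (1/2) * (rs g + rs ?s * rs ?s)" by (simp only: cs_mult cs_add)
    then have "sqrt_iter c (Suc n) - rs (sqrt_scalar g (Suc n))
        = cs (1/2) * ((c - rs g) + ((?b - rs ?s) * ?b + rs ?s * (?b - rs ?s)))"
      by (simp add: algebra_simps)
    also have "\<dots> \<in> J"
      using c Suc by (intro ideal_mult_left ideal_add ideal_mult_right) auto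
    finally show ?case .
  qed (simp add: ideal_zero)
  then have "sqrt_lim c - rs b \<in> J" using ideal_limit[OF lim] by blast
  then show ?thesis using c unfolding unitized_def by blast
qed

text \<open>The unitary is v = y |y|^-1. With s = |y| and a = y* y = s^2 the inverse of s is s a^-1,
  and a^-1 is made from the given inverse of y. So all factors lie in the unitization once s
  does.\<close>

lemma polar_decomposition:
  assumes y: "y \<in> unitized J" and yi: "yi \<in> unitized J" "y * yi = 1" "yi * y = 1"
  obtains v s where "v \<in> unitized J" "pos s" "s * s = star y * y" "v * s = y" "star v * v = 1" "v * star v = 1"
proof -
  have yC: "y \<in> C" "yi \<in> C" using y yi unitized_closed by auto
  let ?a = "star y * y"
  have a: "pos ?a" using pos_star_mult yC by blast
  obtain l where l: "y - cs l \<in> J" using y by (auto simp: unitized_def)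
  \<comment> \<open>Modulo the ideal y* y is the nonnegative scalar |l|^2, so its square root can be
    followed by the scalar iteration.\<close>
  have al: "?a - rs ((cmod l)\<^sup>2) \<in> J"
  proof -
    have "?a - cs (cnj l * l) = star (y - cs l) * y + cs (cnj l) * (y - cs l)"
      using yC by (simp add: star_diff algebra_simps cs_mult cs_commute[of "cs l" "cnj l"])
    moreover have "star (y - cs l) * y + cs (cnj l) * (y - cs l) \<in> J"
      using l yC by (intro ideal_add ideal_mult_left ideal_mult_right ideal_star) auto
    moreover have "cnj l * l = complex_of_real ((cmod l)\<^sup>2)"
      by (metis complex_norm_square mult.commute of_real_power)
    ultimately show ?thesis by simp
  qed
  \<comment> \<open>\<open>M\<close> must dominate |l|^2 as well as the norm: the scalar part need
    not be determined by \<open>y\<close> and may exceed the norm, while \<open>?g\<close> has to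
    lie between 0 and 1.\<close>
  define M where "M = 1 + nrm ?a + (cmod l)\<^sup>2"
  have M: "M > 0" "nrm ?a \<le> M" "(cmod l)\<^sup>2 \<le> M"
    unfolding M_def using nrm_nonneg[of ?a] by (auto simp: add_pos_nonneg)
  define c where "c = 1 - rs (inverse M) * ?a"
  have c: "c \<in> C" "nrm c \<le> 1" "star c = c"
    using nrm_pos_normalized[of ?a M] pos_imp_bound[OF a M(2)] M yC
    unfolding c_def by (auto simp: star_diff star_mult cs_commute)
  let ?g = "1 - inverse M * (cmod l)\<^sup>2"
  have g: "0 \<le> ?g" "?g \<le> 1" using M by (auto simp: field_simps)
  have "c - rs ?g = - (rs (inverse M) * (?a - rs ((cmod l)\<^sup>2)))"
    unfolding c_def rs_diff rs_mult by (simp add: algebra_simps)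
  then have "c - rs ?g \<in> J" using al ideal_uminus ideal_mult_left by simp
  then have bU: "sqrt_lim c \<in> unitized J" using sqrt_lim_unitized c g by blast
  define s0 where "s0 = 1 - sqrt_lim c"
  define s where "s = rs (sqrt M) * s0"
  have "s0 \<in> unitized J"
  proof -
    obtain m where m: "sqrt_lim c - cs m \<in> J" using bU by (auto simp: unitized_def)
    have "s0 - cs (1 - m) = - (sqrt_lim c - cs m)" unfolding s0_def by (simp add: cs_diff)
    then have "s0 - cs (1 - m) \<in> J" by (simp only: ideal_uminus[OF m])
    moreover have "s0 \<in> C" using c unfolding s0_def by auto
    ultimately show ?thesis unfolding unitized_def by blast
  qed
  then have sU: "s \<in> unitized J" unfolding s_def by (rule unitized_mult[OF unitized_cs])
  have s0: "pos s0"
    unfolding pos_def s0_def using c nrm_sqrt_lim[of c] sqrt_lim_star[of c]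
    by (auto simp: star_diff intro!: exI[of _ 1])
  then have s: "pos s" unfolding s_def using M by (intro pos_scale) auto
  have ss: "s * s = ?a"
  proof -
    have "s * s = rs (sqrt M * sqrt M) * (s0 * s0)"
      unfolding s_def of_real_mult by (rule cs_mult_mult_cs) (use s0 in auto)
    also have "s0 * s0 = rs (inverse M) * ?a"
      unfolding s0_def sqrt_lim_square[OF c(1,2)] by (simp add: c_def)
    finally show ?thesis using M cs_inverse(2)[of "of_real M" ?a] by simp
  qed
  define ai where "ai = yi * star yi"
  have st1: "star yi * star y = 1" "star y * star yi = 1"
    using star_mult[OF yC] star_mult[OF yC(2,1)] yi by auto
  have ai: "ai \<in> unitized J" "ai \<in> C" "star ai = ai"
    using yi yC unitized_mult unitized_star by (auto simp: ai_def star_mult)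
  have aai: "?a * ai = 1" "ai * ?a = 1"
  proof -
    have "?a * ai = star y * (y * yi) * star yi" unfolding ai_def by (simp add: mult.assoc)
    then show "?a * ai = 1" using yi st1 by simp
    have "ai * ?a = yi * (star yi * star y) * y" unfolding ai_def by (simp add: mult.assoc)
    then show "ai * ?a = 1" using yi st1 by simp
  qed
  have "s * ?a = ?a * s" unfolding ss[symmetric] by (simp add: mult.assoc)
  then have "ai * (s * ?a) * ai = ai * (?a * s) * ai" by simp
  then have "ai * s * (?a * ai) = (ai * ?a) * s * ai" by (simp add: mult.assoc)
  then have sai: "ai * s = s * ai" using aai by simp
  define v where "v = y * (s * ai)"
  have sC: "s \<in> C" "star s = s" using s pos_star by auto
  have vs: "v * s = y"
  proof -
    have "v * s = y * (ai * (s * s))" unfolding v_def by (metis sai mult.assoc)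
    then show ?thesis using ss aai by simp
  qed
  have stv: "star v = ai * (s * star y)"
    unfolding v_def using yC ai sC by (simp add: star_mult mult.assoc)
  have "star v * v = ai * (s * (?a * (s * ai)))" unfolding stv by (simp add: v_def mult.assoc)
  also have "\<dots> = ai * (s * s) * (s * s) * ai" unfolding ss[symmetric] by (simp add: mult.assoc)
  also have "\<dots> = 1" unfolding ss aai by (simp add: aai)
  finally have v1: "star v * v = 1" .
  have "v * star v = y * (s * ai) * (ai * s) * star y" unfolding stv by (simp add: v_def mult.assoc)
  also have "\<dots> = y * (ai * (ai * (s * s))) * star y" by (metis sai mult.assoc)
  also have "\<dots> = y * yi * (star yi * star y)" unfolding ss aai by (simp add: ai_def mult.assoc)
  also have "\<dots> = 1" using yi st1 by simp
  finally have v2: "v * star v = 1" .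
  have "v \<in> unitized J" unfolding v_def by (intro unitized_mult y sU ai)
  then show ?thesis using that s ss vs v1 v2 by blast
qed

end

end

section \<open>Adjointable operators on Hilbert modules\<close>

text \<open>Only additivity is built in. That suffices for a unital ring containing the adjointable
  operators as a carrier set; their linearity over the scalars and over A follows from the existence
  of an adjoint.\<close>

typedef (overloaded) 'm endo = "{f :: 'm::ab_group_add \<Rightarrow> 'm. \<forall>x y. f (x + y) = f x + f y}"
  morphisms app Endo
  by (rule exI[of _ id]) simp

lemma app_add [simp]: "app T (x + y) = app T x + app T y"
  using app[of T] by simp

lemma app_Endo: "(\<And>x y. f (x + y) = f x + f y) \<Longrightarrow> app (Endo f) = f"
  by (simp add: Endo_inverse)

lemma endo_eqI: "(\<And>x. app S x = app T x) \<Longrightarrow> S = T"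
  by (auto simp: app_inject[symmetric])

lemma app_0 [simp]: "app T 0 = 0"
  using app_add[of T 0 0] by simp

lemma app_uminus [simp]: "app T (- x) = - app T x"
  using app_add[of T x "- x"] by (simp add: eq_neg_iff_add_eq_0 add.commute)

lemma app_diff [simp]: "app T (x - y) = app T x - app T y"
  using app_add[of T x "- y"] by simp

instantiation endo :: (ab_group_add) "{ring, monoid_mult}"
begin

definition "0 = Endo (\<lambda>x. 0)"
definition "1 = Endo (\<lambda>x. x)"
definition "S + T = Endo (\<lambda>x. app S x + app T x)"
definition "S - T = Endo (\<lambda>x. app S x - app T x)"
definition "- T = Endo (\<lambda>x. - app T x)"
definition "S * T = Endo (\<lambda>x. app S (app T x))"

lemma app_zero_endo [simp]: "app 0 x = 0"
  and app_one [simp]: "app 1 x = x"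
  and app_plus [simp]: "app (S + T) x = app S x + app T x"
  and app_minus [simp]: "app (S - T) x = app S x - app T x"
  and app_neg [simp]: "app (- T) x = - app T x"
  and app_times [simp]: "app (S * T) x = app S (app T x)"
  by (simp_all add: zero_endo_def one_endo_def plus_endo_def minus_endo_def uminus_endo_def times_endo_def app_Endo)

instance
  by standard (auto intro!: endo_eqI)

end

lemma app_sum: "app (sum f I) x = (\<Sum>i\<in>I. app (f i) x)"
  by (induction I rule: infinite_finite_induct) auto

section \<open>C*-algebras with explicit operations\<close>

locale cstar_alg =
  fixes sc :: "complex \<Rightarrow> 'a::{real_normed_algebra,banach} \<Rightarrow> 'a" and st :: "'a \<Rightarrow> 'a"
  assumes cstar: "cstar_algebra sc st"
begin

lemma sc_of_real [simp]: "sc (complex_of_real r) x = r *\<^sub>R x"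
  and norm_sc [simp]: "norm (sc a x) = cmod a * norm x"
  and sc_mult_left: "sc a (x * y) = sc a x * y"
  and sc_mult_right: "sc a (x * y) = x * sc a y"
  and st_st [simp]: "st (st x) = x"
  and st_add: "st (x + y) = st x + st y"
  and st_sc: "st (sc a x) = sc (cnj a) (st x)"
  and st_mult: "st (x * y) = st y * st x"
  and norm_st_mult: "norm (st x * x) = (norm x)\<^sup>2"
  and sc_one [simp]: "sc 1 x = x"
  and sc_sc: "sc a (sc b x) = sc (a * b) x"
  and sc_add_left: "sc (a + b) x = sc a x + sc b x"
  using cstar unfolding cstar_algebra_def cvec_def by meson+

lemma cvec_sc: "cvec sc"
  using cstar unfolding cstar_algebra_def by (elim conjE)

lemma st_zero [simp]: "st 0 = 0"
  using st_add[of 0 0] by simp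

lemma st_diff: "st (x - y) = st x - st y"
  using st_add[of "x - y" y] by simp

lemma norm_st [simp]: "norm (st x) = norm x"
proof -
  have le: "norm y \<le> norm (st y)" for y
  proof (cases "y = 0")
    case False
    have "norm y * norm y \<le> norm (st y) * norm y"
      using norm_mult_ineq[of "st y" y] by (simp add: norm_st_mult power2_eq_square)
    with False show ?thesis by simp
  qed simp
  show ?thesis using le[of x] le[of "st x"] by simp
qed

end

text \<open>Over a C*-algebra acting on itself the Cauchy--Schwarz inequality is immediate, while for a general
  Hilbert module it is a consequence of the order theory in the algebra of adjointable operators on
  the former.\<close>
locale ip_module = cstar_alg sc st for sc :: "complex \<Rightarrow> 'a::{real_normed_algebra,banach} \<Rightarrow> 'a" and st +
  fixes scm :: "complex \<Rightarrow> 'm::ab_group_add \<Rightarrow> 'm" and ip :: "'m \<Rightarrow> 'm \<Rightarrow> 'a"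
  assumes cvec_scm: "cvec scm"
    and ip_add_right: "ip x (y + z) = ip x y + ip x z"
    and ip_scm_right: "ip x (scm l y) = sc l (ip x y)"
    and ip_st: "ip y x = st (ip x y)"
    and ip_zeroD: "ip x x = 0 \<Longrightarrow> x = 0"
    and cauchy_schwarz: "norm (ip x y) \<le> hmnorm ip x * hmnorm ip y"
    and module_complete: "(\<And>e. e > 0 \<Longrightarrow> \<exists>N::nat. \<forall>m\<ge>N. \<forall>n\<ge>N. hmnorm ip (X m - X n) < e) \<Longrightarrow>
            \<exists>L. \<forall>e>0. \<exists>N::nat. \<forall>n\<ge>N. hmnorm ip (X n - L) < e"
begin

section \<open>The norm of an A-valued inner product\<close>

abbreviation "hn \<equiv> hmnorm ip"

lemma scm_one [simp]: "scm 1 x = x"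
  and scm_scm: "scm a (scm b x) = scm (a * b) x"
  and scm_add_right: "scm a (x + y) = scm a x + scm a y"
  and scm_add_left: "scm (a + b) x = scm a x + scm b x"
  using cvec_scm unfolding cvec_def by meson+

lemma ip_add_left: "ip (x + y) z = ip x z + ip y z"
  by (metis ip_st ip_add_right st_add)

lemma ip_scm_left: "ip (scm l x) y = sc (cnj l) (ip x y)"
  by (metis ip_st ip_scm_right st_sc)

lemma ip_zero_right [simp]: "ip x 0 = 0"
  using ip_add_right[of x 0 0] by simp

lemma ip_zero_left [simp]: "ip 0 x = 0"
  using ip_add_left[of 0 0 x] by simp

lemma ip_diff_right: "ip x (y - z) = ip x y - ip x z"
  using ip_add_right[of x "y - z" z] by simp

lemma ip_diff_left: "ip (x - y) z = ip x z - ip y z"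
  using ip_add_left[of "x - y" y z] by simp

lemma ip_uminus_right: "ip x (- y) = - ip x y"
  using ip_diff_right[of x 0 y] by simp

lemma ip_uminus_left: "ip (- x) y = - ip x y"
  using ip_diff_left[of 0 x y] by simp

lemma ip_sum_left: "ip (\<Sum>i\<in>I. f i) y = (\<Sum>i\<in>I. ip (f i) y)"
  by (induction I rule: infinite_finite_induct) (auto simp: ip_add_left)

lemma ip_right_eqI: assumes "\<And>z. ip z x = ip z y" shows "x = y"
  using ip_zeroD[of "x - y"] assms by (simp add: ip_diff_right)

lemma hn_nonneg [simp]: "0 \<le> hn x"
  by (simp add: hmnorm_def)

lemma hn_square: "(hn x)\<^sup>2 = norm (ip x x)"
  by (simp add: hmnorm_def)

lemma hn_zero [simp]: "hn 0 = 0"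
  by (simp add: hmnorm_def)

lemma hn_zeroD: "hn x = 0 \<Longrightarrow> x = 0"
  using ip_zeroD by (simp add: hmnorm_def)

lemma hn_uminus [simp]: "hn (- x) = hn x"
  by (simp add: hmnorm_def ip_uminus_left ip_uminus_right)

lemma hn_diff_commute: "hn (x - y) = hn (y - x)"
  using hn_uminus[of "x - y"] by simp

lemma hn_scm: "hn (scm l x) = cmod l * hn x"
  by (simp add: hmnorm_def ip_scm_left ip_scm_right real_sqrt_mult)

lemma hn_triangle: "hn (x + y) \<le> hn x + hn y"
proof (rule power2_le_imp_le)
  have "(hn (x + y))\<^sup>2 = norm (ip x x + ip x y + (ip y x + ip y y))"
    by (simp add: hn_square ip_add_left ip_add_right algebra_simps)
  also have "\<dots> \<le> (norm (ip x x) + norm (ip x y)) + (norm (ip y x) + norm (ip y y))"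
    by (intro norm_triangle_mono norm_triangle_ineq)
  also have "\<dots> \<le> ((hn x)\<^sup>2 + hn x * hn y) + (hn y * hn x + (hn y)\<^sup>2)"
    unfolding hn_square by (intro add_mono cauchy_schwarz order_refl)
  also have "\<dots> = (hn x + hn y)\<^sup>2" by (simp add: power2_eq_square algebra_simps)
  finally show "(hn (x + y))\<^sup>2 \<le> (hn x + hn y)\<^sup>2" .
qed simp

lemma hn_dist_triangle: "hn (x - z) \<le> hn (x - y) + hn (y - z)"
  using hn_triangle[of "x - y" "y - z"] by simp

lemma hn_triangle_diff: "hn (x - y) \<le> hn x + hn y"
  using hn_triangle[of x "- y"] by simp

section \<open>The C*-algebra of bounded adjointable operators\<close>

definition adj_pair :: "'m endo \<Rightarrow> 'm endo \<Rightarrow> bool" where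
  "adj_pair T S \<longleftrightarrow> (\<forall>x y. ip (app T x) y = ip x (app S y))"

definition L :: "'m endo set" where
  "L = {T. (\<exists>S. adj_pair T S) \<and> (\<exists>M\<ge>0. \<forall>x. hn (app T x) \<le> M * hn x)}"

definition adj :: "'m endo \<Rightarrow> 'm endo" where
  "adj T = (SOME S. adj_pair T S)"

text \<open>The infimum is only meaningful for bounded operators.\<close>
definition opn :: "'m endo \<Rightarrow> real" where
  "opn T = (if T \<in> L then Inf {M. 0 \<le> M \<and> (\<forall>x. hn (app T x) \<le> M * hn x)} else 0)"

definition scal :: "complex \<Rightarrow> 'm endo" where
  "scal l = Endo (scm l)"

lemma app_scal [simp]: "app (scal l) x = scm l x"
  unfolding scal_def by (subst app_Endo) (simp_all add: scm_add_right)

lemma adj_pair_unique: "adj_pair T S \<Longrightarrow> adj_pair T S' \<Longrightarrow> S = S'"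
  unfolding adj_pair_def by (intro endo_eqI ip_right_eqI) metis

lemma adj_eqI: "adj_pair T S \<Longrightarrow> adj T = S"
  unfolding adj_def by (rule some_equality) (auto intro: adj_pair_unique)

lemma adj_pair_adj: "T \<in> L \<Longrightarrow> adj_pair T (adj T)"
  unfolding L_def adj_def by (auto intro: someI)

lemma ip_adj: "T \<in> L \<Longrightarrow> ip (app T x) y = ip x (app (adj T) y)"
  using adj_pair_adj unfolding adj_pair_def by blast

lemma ip_adj': "T \<in> L \<Longrightarrow> ip x (app T y) = ip (app (adj T) x) y"
  by (metis ip_adj ip_st)

lemma adj_pair_sym: "adj_pair T S \<Longrightarrow> adj_pair S T"
  unfolding adj_pair_def by (metis ip_st)

text \<open>Cancel one factor in |S y|^2 = |<T S y, y>| \<le> M |S y| |y|. Consequently taking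
  adjoints does not increase the operator norm.\<close>

lemma adj_pair_bound:
  assumes "adj_pair T S" "M \<ge> 0" "\<And>x. hn (app T x) \<le> M * hn x"
  shows "hn (app S y) \<le> M * hn y"
proof (cases "hn (app S y) = 0")
  case False
  have "hn (app S y) * hn (app S y) = norm (ip (app T (app S y)) y)"
    using assms(1) hn_square[of "app S y"] by (simp add: adj_pair_def power2_eq_square)
  also have "\<dots> \<le> hn (app T (app S y)) * hn y" by (rule cauchy_schwarz)
  also have "\<dots> \<le> M * hn (app S y) * hn y" by (intro mult_right_mono assms) simp
  finally have "hn (app S y) * hn (app S y) \<le> (M * hn y) * hn (app S y)" by (simp add: mult_ac)
  then show ?thesis using False hn_nonneg[of "app S y"] by (metis mult_right_le_imp_le order_le_less)
qed (use assms in simp)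

lemma L_I: "adj_pair T S \<Longrightarrow> 0 \<le> M \<Longrightarrow> (\<And>x. hn (app T x) \<le> M * hn x) \<Longrightarrow> T \<in> L"
  unfolding L_def by blast

lemma opn_le: "T \<in> L \<Longrightarrow> 0 \<le> M \<Longrightarrow> (\<And>x. hn (app T x) \<le> M * hn x) \<Longrightarrow> opn T \<le> M"
  unfolding opn_def by (auto intro!: cInf_lower bdd_belowI[of _ 0])

lemma opn_nonneg: "0 \<le> opn T"
proof (cases "T \<in> L")
  case True
  then have "{M. 0 \<le> M \<and> (\<forall>x. hn (app T x) \<le> M * hn x)} \<noteq> {}" unfolding L_def by blast
  then show ?thesis using True unfolding opn_def by (auto intro!: cInf_greatest)
qed (simp add: opn_def)

lemma hn_app_le: assumes "T \<in> L" shows "hn (app T x) \<le> opn T * hn x"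
proof (cases "hn x = 0")
  case False
  then have pos: "hn x > 0" using hn_nonneg[of x] by linarith
  have "hn (app T x) / hn x \<le> Inf {M. 0 \<le> M \<and> (\<forall>x. hn (app T x) \<le> M * hn x)}"
    using assms pos unfolding L_def by (intro cInf_greatest) (auto simp: pos_divide_le_eq)
  then show ?thesis using assms pos by (simp add: opn_def pos_divide_le_eq)
qed (use hn_zeroD[of x] in auto)

lemma adj_L: assumes "T \<in> L" shows "adj T \<in> L"
proof (rule L_I)
  show "adj_pair (adj T) T" using adj_pair_adj[OF assms] adj_pair_sym by blast
  show "hn (app (adj T) x) \<le> opn T * hn x" for x
    using adj_pair_bound[OF adj_pair_adj[OF assms] opn_nonneg] hn_app_le[OF assms] by blast
qed (rule opn_nonneg)

lemma opn_adj_le: "T \<in> L \<Longrightarrow> opn (adj T) \<le> opn T"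
  using adj_pair_bound[OF adj_pair_adj opn_nonneg] hn_app_le adj_L by (intro opn_le opn_nonneg) blast+

lemma adj_adj: "T \<in> L \<Longrightarrow> adj (adj T) = T"
  by (rule adj_eqI[OF adj_pair_sym[OF adj_pair_adj]])

lemma add_L_bound: "S \<in> L \<Longrightarrow> T \<in> L \<Longrightarrow> hn (app (S + T) x) \<le> (opn S + opn T) * hn x"
  using hn_triangle[of "app S x" "app T x"] hn_app_le[of S x] hn_app_le[of T x] by (simp add: distrib_right)

lemma adj_pair_add: "adj_pair S S' \<Longrightarrow> adj_pair T T' \<Longrightarrow> adj_pair (S + T) (S' + T')"
  by (simp add: adj_pair_def ip_add_left ip_add_right)

lemma add_L: "S \<in> L \<Longrightarrow> T \<in> L \<Longrightarrow> S + T \<in> L"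
  by (rule L_I[OF adj_pair_add[OF adj_pair_adj adj_pair_adj] _ add_L_bound]) (auto simp: opn_nonneg)

lemma mult_L_bound: assumes "S \<in> L" "T \<in> L" shows "hn (app (S * T) x) \<le> (opn S * opn T) * hn x"
proof -
  have "hn (app (S * T) x) \<le> opn S * hn (app T x)" using hn_app_le[OF assms(1)] by simp
  also have "\<dots> \<le> opn S * (opn T * hn x)" by (intro mult_left_mono hn_app_le assms opn_nonneg)
  finally show ?thesis by (simp add: mult.assoc)
qed

lemma adj_pair_mult: "adj_pair S S' \<Longrightarrow> adj_pair T T' \<Longrightarrow> adj_pair (S * T) (T' * S')"
  by (simp add: adj_pair_def)

lemma mult_L: "S \<in> L \<Longrightarrow> T \<in> L \<Longrightarrow> S * T \<in> L"
  by (rule L_I[OF adj_pair_mult[OF adj_pair_adj adj_pair_adj] _ mult_L_bound]) (auto simp: opn_nonneg)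

lemma adj_pair_scal: "adj_pair (scal l) (scal (cnj l))"
  by (simp add: adj_pair_def ip_scm_left ip_scm_right)

lemma scal_L: "scal l \<in> L"
  by (rule L_I[OF adj_pair_scal, of "cmod l"]) (auto simp: hn_scm)

lemma app_scm: assumes "T \<in> L" shows "app T (scm l x) = scm l (app T x)"
  by (rule ip_right_eqI) (simp add: ip_adj'[OF assms] ip_scm_right)

lemma scal_minus_one: "scal (-1) = -1"
proof (rule endo_eqI)
  fix x
  have "scm (1 + -1) x = scm 1 x + scm (-1) x" by (rule scm_add_left)
  moreover have "scm 0 x = 0" using scm_add_left[of 0 0 x] by simp
  ultimately show "app (scal (-1)) x = app (-1) x" by (simp add: eq_neg_iff_add_eq_0 add.commute)
qed

lemma diff_L: "S \<in> L \<Longrightarrow> T \<in> L \<Longrightarrow> S - T \<in> L"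
  using add_L[OF _ mult_L[OF scal_L[of "-1"]], of S T] by (simp add: scal_minus_one)

lemma adj_diff: "S \<in> L \<Longrightarrow> T \<in> L \<Longrightarrow> adj (S - T) = adj S - adj T"
  by (rule adj_eqI) (simp add: adj_pair_def ip_diff_left ip_diff_right ip_adj)

lemma pointwise_limit_exists:
  fixes X :: "nat \<Rightarrow> 'm endo"
  assumes "\<And>n. X n \<in> L" and cau: "\<And>e. 0 < e \<Longrightarrow> \<exists>N. \<forall>m\<ge>N. \<forall>n\<ge>N. opn (X m - X n) < e"
  shows "\<exists>T. \<forall>e>0. \<exists>N. \<forall>n\<ge>N. \<forall>x. hn (app (X n) x - app T x) \<le> e * hn x"
proof -
  have diff: "hn (app (X m) x - app (X n) x) \<le> opn (X m - X n) * hn x" for m n x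
    using hn_app_le[OF diff_L[OF assms(1) assms(1)], of m n x] by simp
  have "\<exists>y. \<forall>e>0. \<exists>N. \<forall>n\<ge>N. hn (app (X n) x - y) < e" for x
  proof (rule module_complete[of "\<lambda>n. app (X n) x"])
    fix e :: real assume "e > 0"
    then have "e / (1 + hn x) > 0" by (simp add: add_pos_nonneg)
    then obtain N where N: "\<And>m n. m \<ge> N \<Longrightarrow> n \<ge> N \<Longrightarrow> opn (X m - X n) < e / (1 + hn x)"
      using cau by meson
    have "hn (app (X m) x - app (X n) x) < e" if "m \<ge> N" "n \<ge> N" for m n
    proof -
      have "hn (app (X m) x - app (X n) x) \<le> e / (1 + hn x) * hn x"
        using diff[of m x n] mult_right_mono[OF less_imp_le[OF N[OF that]] hn_nonneg[of x]] by linarith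
      also have "\<dots> < e" using \<open>e > 0\<close> hn_nonneg[of x] by (simp add: pos_divide_less_eq add_pos_nonneg)
      finally show ?thesis .
    qed
    then show "\<exists>N. \<forall>m\<ge>N. \<forall>n\<ge>N. hn (app (X m) x - app (X n) x) < e" by blast
  qed
  then obtain f where f: "\<And>x e. e > 0 \<Longrightarrow> \<exists>N. \<forall>n\<ge>N. hn (app (X n) x - f x) < e" by metis
  have unif: "\<exists>N. \<forall>n\<ge>N. \<forall>x. hn (app (X n) x - f x) \<le> e * hn x" if "e > 0" for e
  proof -
    obtain N where N: "\<And>m n. m \<ge> N \<Longrightarrow> n \<ge> N \<Longrightarrow> opn (X m - X n) < e" using cau \<open>e > 0\<close> by meson
    have "hn (app (X n) x - f x) \<le> e * hn x" if "n \<ge> N" for n x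
    proof (rule field_le_epsilon)
      fix d :: real assume "d > 0"
      then obtain K where K: "\<And>m. m \<ge> K \<Longrightarrow> hn (app (X m) x - f x) < d" using f by meson
      \<comment> \<open>This index is late enough both for convergence at \<open>x\<close> and for
        the Cauchy condition. It depends on \<open>x\<close>, but the estimate it gives for
        \<open>n\<close> does not.\<close>
      let ?m = "K + N"
      have "hn (app (X n) x - f x) \<le> hn (app (X n) x - app (X ?m) x) + hn (app (X ?m) x - f x)"
        by (rule hn_dist_triangle)
      also have "\<dots> \<le> e * hn x + d"
        using K[of ?m] diff[of n x ?m] mult_right_mono[OF less_imp_le[OF N[of n ?m]] hn_nonneg[of x]] that by auto
      finally show "hn (app (X n) x - f x) \<le> e * hn x + d" .
    qed
    then show ?thesis by blast
  qed
  have "f (x + y) = f x + f y" for x y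
  proof -
    have "hn (f (x + y) - (f x + f y)) \<le> 0 + d" if "d > 0" for d
    proof -
      have d3: "d / 3 > 0" using that by simp
      obtain K1 K2 K3 where K: "\<And>n. n \<ge> K1 \<Longrightarrow> hn (app (X n) x - f x) < d / 3"
        "\<And>n. n \<ge> K2 \<Longrightarrow> hn (app (X n) y - f y) < d / 3"
        "\<And>n. n \<ge> K3 \<Longrightarrow> hn (app (X n) (x + y) - f (x + y)) < d / 3"
        using f[OF d3] by meson
      let ?n = "K1 + K2 + K3" and ?A = "app (X (K1 + K2 + K3))"
      have eq: "f (x + y) - (f x + f y) = (?A x - f x) + (?A y - f y) - (?A (x + y) - f (x + y))" by simp
      have "hn (f (x + y) - (f x + f y)) \<le> hn (?A x - f x) + hn (?A y - f y) + hn (?A (x + y) - f (x + y))"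
        unfolding eq using hn_triangle_diff[of "(?A x - f x) + (?A y - f y)" "?A (x + y) - f (x + y)"]
          hn_triangle[of "?A x - f x" "?A y - f y"] by linarith
      then show ?thesis using K(1)[of ?n] K(2)[of ?n] K(3)[of ?n] by simp
    qed
    then have "hn (f (x + y) - (f x + f y)) \<le> 0" by (rule field_le_epsilon)
    then show ?thesis using hn_zeroD[of "f (x + y) - (f x + f y)"] hn_nonneg[of "f (x + y) - (f x + f y)"] by simp
  qed
  then have "app (Endo f) = f" by (rule app_Endo)
  then show ?thesis using unif by metis
qed

lemma ip_limit:
  fixes X :: "nat \<Rightarrow> 'm endo"
  assumes "\<forall>e>0. \<exists>N. \<forall>n\<ge>N. \<forall>x. hn (app (X n) x - app T x) \<le> e * hn x"
  shows "(\<lambda>n. ip (app (X n) x) y) \<longlonglongrightarrow> ip (app T x) y"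
proof (rule LIMSEQ_I)
  fix r :: real assume "r > 0"
  let ?e = "r / (1 + hn x * hn y)"
  have p: "0 < 1 + hn x * hn y" by (simp add: add_pos_nonneg)
  then have e: "?e > 0" using \<open>r > 0\<close> by simp
  then obtain N where N: "\<And>n x. n \<ge> N \<Longrightarrow> hn (app (X n) x - app T x) \<le> ?e * hn x" using assms by meson
  have "norm (ip (app (X n) x) y - ip (app T x) y) < r" if "n \<ge> N" for n
  proof -
    have "norm (ip (app (X n) x) y - ip (app T x) y) \<le> hn (app (X n) x - app T x) * hn y"
      using cauchy_schwarz[of "app (X n) x - app T x" y] by (simp add: ip_diff_left)
    also have "\<dots> \<le> ?e * hn x * hn y" by (intro mult_right_mono N that) simp
    also have "\<dots> < r" using p \<open>r > 0\<close> by (simp add: pos_divide_less_eq mult.assoc)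
    finally show ?thesis .
  qed
  then show "\<exists>N. \<forall>n\<ge>N. norm (ip (app (X n) x) y - ip (app T x) y) < r" by blast
qed

text \<open>Adjoints of a Cauchy sequence again form a Cauchy sequence. Its limit is the adjoint of
  the limit operator because the inner product is continuous, so the limit is adjointable.\<close>

lemma L_complete:
  assumes X: "\<And>n. X n \<in> L" and cau: "\<And>e. 0 < e \<Longrightarrow> \<exists>N. \<forall>m\<ge>N. \<forall>n\<ge>N. opn (X m - X n) < e"
  shows "\<exists>T\<in>L. (\<lambda>n. opn (X n - T)) \<longlonglongrightarrow> 0"
proof -
  obtain T where T: "\<forall>e>0. \<exists>N. \<forall>n\<ge>N. \<forall>x. hn (app (X n) x - app T x) \<le> e * hn x"
    using pointwise_limit_exists[OF assms] by blast
  have "\<exists>N. \<forall>m\<ge>N. \<forall>n\<ge>N. opn (adj (X m) - adj (X n)) < e" if "e > 0" for e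
  proof -
    have "opn (adj (X m) - adj (X n)) \<le> opn (X m - X n)" for m n
      using opn_adj_le[OF diff_L[OF X X]] by (simp add: adj_diff X)
    then show ?thesis using cau[OF that] by (meson le_less_trans)
  qed
  then obtain S where S: "\<forall>e>0. \<exists>N. \<forall>n\<ge>N. \<forall>x. hn (app (adj (X n)) x - app S x) \<le> e * hn x"
    using pointwise_limit_exists[of "\<lambda>n. adj (X n)"] adj_L[OF X] by blast
  have "adj_pair T S"
    unfolding adj_pair_def
  proof (intro allI)
    fix x y
    have "(\<lambda>n. ip (app (X n) x) y) \<longlonglongrightarrow> ip (app T x) y" by (rule ip_limit[OF T])
    moreover have "ip (app (adj (X n)) y) x = ip y (app (X n) x)" for n by (simp add: ip_adj' X)
    then have "(\<lambda>n. ip y (app (X n) x)) \<longlonglongrightarrow> ip (app S y) x" using ip_limit[OF S, of y x] by simp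
    moreover have "(\<lambda>n. ip y (app (X n) x)) \<longlonglongrightarrow> ip y (app T x)"
    proof -
      have "norm (ip y (app (X n) x) - ip y (app T x)) = norm (ip (app (X n) x) y - ip (app T x) y)" for n
        by (metis ip_st norm_st st_diff)
      moreover have "(\<lambda>n. norm (ip (app (X n) x) y - ip (app T x) y)) \<longlonglongrightarrow> 0"
        using ip_limit[OF T, of x y] by (simp add: LIM_zero tendsto_norm_zero)
      ultimately have "(\<lambda>n. norm (ip y (app (X n) x) - ip y (app T x))) \<longlonglongrightarrow> 0" by simp
      then show ?thesis by (rule LIM_zero_cancel[OF tendsto_norm_zero_cancel])
    qed
    ultimately have "ip (app S y) x = ip y (app T x)" using LIMSEQ_unique by blast
    then show "ip (app T x) y = ip x (app S y)" by (metis ip_st)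
  qed
  moreover obtain N where N: "\<And>n x. n \<ge> N \<Longrightarrow> hn (app (X n) x - app T x) \<le> 1 * hn x"
    using T by (meson zero_less_one)
  have "hn (app T x) \<le> (opn (X N) + 1) * hn x" for x
    using hn_triangle_diff[of "app (X N) x" "app (X N) x - app T x"] N[of N x] hn_app_le[OF X, of N x]
    by (simp add: distrib_right)
  ultimately have TL: "T \<in> L" using L_I[of T S "opn (X N) + 1"] opn_nonneg[of "X N"] by simp
  have "(\<lambda>n. opn (X n - T)) \<longlonglongrightarrow> 0"
  proof (rule LIMSEQ_I)
    fix r :: real assume "r > 0"
    then have "r / 2 > 0" by simp
    then obtain N where N: "\<And>n x. n \<ge> N \<Longrightarrow> hn (app (X n) x - app T x) \<le> r / 2 * hn x" using T by meson
    have "norm (opn (X n - T) - 0) < r" if "n \<ge> N" for n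
      using opn_le[OF diff_L[OF X TL], of "r / 2" n] N[OF that] opn_nonneg[of "X n - T"] \<open>r > 0\<close> by simp
    then show "\<exists>N. \<forall>n\<ge>N. norm (opn (X n - T) - 0) < r" by blast
  qed
  with TL show ?thesis by blast
qed

sublocale cstar_ring L adj scal opn
proof
  show "scal l \<in> L" for l by (rule scal_L)
  show "S \<in> L \<Longrightarrow> T \<in> L \<Longrightarrow> S + T \<in> L" "S \<in> L \<Longrightarrow> T \<in> L \<Longrightarrow> S * T \<in> L" for S T
    by (rule add_L mult_L; assumption)+
  show "T \<in> L \<Longrightarrow> adj T \<in> L" for T by (rule adj_L)
  show "scal (a + b) = scal a + scal b" "scal (a * b) = scal a * scal b" for a b
    by (rule endo_eqI; simp add: scm_add_left scm_scm)+
  show "scal 1 = 1" by (rule endo_eqI) simp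
  show "T \<in> L \<Longrightarrow> T * scal l = scal l * T" for T l
    by (rule endo_eqI) (simp add: app_scm)
  show "S \<in> L \<Longrightarrow> T \<in> L \<Longrightarrow> adj (S + T) = adj S + adj T" for S T
    by (intro adj_eqI adj_pair_add adj_pair_adj)
  show "S \<in> L \<Longrightarrow> T \<in> L \<Longrightarrow> adj (S * T) = adj T * adj S" for S T
    by (intro adj_eqI adj_pair_mult adj_pair_adj)
  show "T \<in> L \<Longrightarrow> adj (adj T) = T" for T by (rule adj_adj)
  show "adj (scal l) = scal (cnj l)" for l by (rule adj_eqI[OF adj_pair_scal])
  show "0 \<le> opn T" for T by (rule opn_nonneg)
  show "S \<in> L \<Longrightarrow> T \<in> L \<Longrightarrow> opn (S + T) \<le> opn S + opn T" for S T
    by (intro opn_le add_L add_L_bound) (auto simp: opn_nonneg)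
  show "S \<in> L \<Longrightarrow> T \<in> L \<Longrightarrow> opn (S * T) \<le> opn S * opn T" for S T
    by (intro opn_le mult_L mult_L_bound) (auto simp: opn_nonneg)
  show "opn (scal l) \<le> cmod l" for l by (intro opn_le scal_L) (auto simp: hn_scm)
  show "T = 0" if "T \<in> L" "opn T = 0" for T
    by (rule endo_eqI) (use hn_app_le[OF that(1)] that(2) in \<open>auto intro!: hn_zeroD antisym\<close>)
  \<comment> \<open>Here |T x|^2 = |<x, T* T x>|, and Cauchy-Schwarz bounds this by the norm of T* T
    times |x|^2.\<close>
  show "(opn T)\<^sup>2 \<le> opn (adj T * T)" if T: "T \<in> L" for T
  proof -
    have aT: "adj T * T \<in> L" using T adj_L mult_L by blast
    have "hn (app T x) \<le> sqrt (opn (adj T * T)) * hn x" for x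
    proof (rule power2_le_imp_le)
      have "(hn (app T x))\<^sup>2 = norm (ip x (app (adj T * T) x))"
        by (simp add: hn_square ip_adj[OF T])
      also have "\<dots> \<le> hn x * hn (app (adj T * T) x)" by (rule cauchy_schwarz)
      also have "\<dots> \<le> hn x * (opn (adj T * T) * hn x)" by (intro mult_left_mono hn_app_le aT) simp
      also have "\<dots> = (sqrt (opn (adj T * T)) * hn x)\<^sup>2"
        using opn_nonneg[of "adj T * T"] by (simp add: power_mult_distrib) (simp add: power2_eq_square)
      finally show "(hn (app T x))\<^sup>2 \<le> (sqrt (opn (adj T * T)) * hn x)\<^sup>2" .
    qed (simp add: opn_nonneg)
    then have "opn T \<le> sqrt (opn (adj T * T))" by (intro opn_le T) (auto simp: opn_nonneg)
    then show ?thesis using opn_nonneg by (metis real_le_lsqrt real_sqrt_ge_0_iff real_sqrt_le_iff real_sqrt_pow2 power_mono)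
  qed
  show "\<exists>T\<in>L. (\<lambda>n. opn (X n - T)) \<longlonglongrightarrow> 0"
    if "\<And>n. X n \<in> L" "\<And>e. 0 < e \<Longrightarrow> \<exists>N. \<forall>m\<ge>N. \<forall>n\<ge>N. opn (X m - X n) < e" for X
    using L_complete[OF that] .
qed

end

section \<open>The algebra A acting on itself by left multiplication\<close>

definition lmul :: "'a::ring \<Rightarrow> 'a endo" where
  "lmul a = Endo (\<lambda>x. a * x)"

lemma app_lmul [simp]: "app (lmul a) x = a * x"
  unfolding lmul_def by (subst app_Endo) (simp_all add: distrib_left)

lemma lmul_add: "lmul (a + b) = lmul a + lmul b"
  and lmul_diff: "lmul (a - b) = lmul a - lmul b"
  and lmul_mult: "lmul (a * b) = lmul a * lmul b"
  and lmul_zero: "lmul 0 = 0"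
  by (rule endo_eqI; simp add: algebra_simps)+

context cstar_alg
begin

lemma hmnorm_self: "hmnorm (\<lambda>x y. st x * y) x = norm x"
  by (simp add: hmnorm_def norm_st_mult)

lemma self_module: "ip_module sc st sc (\<lambda>x y. st x * y)"
proof
  show "\<exists>L. \<forall>e>0. \<exists>N. \<forall>n\<ge>N. hmnorm (\<lambda>x y. st x * y) (X n - L) < e"
    if "\<And>e. e > 0 \<Longrightarrow> \<exists>N::nat. \<forall>m\<ge>N. \<forall>n\<ge>N. hmnorm (\<lambda>x y. st x * y) (X m - X n) < e" for X :: "nat \<Rightarrow> 'a"
  proof -
    have "Cauchy X" using that unfolding hmnorm_self by (simp add: Cauchy_iff)
    then obtain L where "X \<longlonglongrightarrow> L" using Cauchy_convergent convergent_def by blast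
    then show ?thesis unfolding hmnorm_self using LIMSEQ_D by blast
  qed
  show "norm (st x * y) \<le> hmnorm (\<lambda>x y. st x * y) x * hmnorm (\<lambda>x y. st x * y) y" for x y
    using norm_mult_ineq[of "st x" y] by (simp add: hmnorm_self)
  show "x = 0" if "st x * x = 0" for x using norm_st_mult[of x] that by simp
qed (auto simp: cvec_sc distrib_left sc_mult_right st_mult)

text \<open>An isometric *-embedding of A, unital or not, in a unital C*-algebra where the theory of
  positive elements is available. The lower bound of the norm comes from applying the operator to
  \<open>st a\<close>.\<close>

lemma lmul_facts:
  defines "ipA \<equiv> \<lambda>x y. st x * y"
  shows "lmul a \<in> ip_module.L ipA" "ip_module.adj ipA (lmul a) = lmul (st a)"
    "ip_module.opn ipA (lmul a) = norm a" "lmul (r *\<^sub>R a) = ip_module.scal sc (of_real r) * lmul a"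
proof -
  interpret A: ip_module sc st sc ipA unfolding ipA_def by (rule self_module)
  have hn: "A.hn x = norm x" for x unfolding ipA_def by (rule hmnorm_self)
  have ap: "A.adj_pair (lmul b) (lmul (st b))" for b
    unfolding A.adj_pair_def by (simp add: ipA_def st_mult mult.assoc)
  then show L: "lmul a \<in> A.L"
    by (rule A.L_I[of _ _ "norm a"]) (auto simp: hn norm_mult_ineq)
  show "A.adj (lmul a) = lmul (st a)" by (rule A.adj_eqI[OF ap])
  have "A.opn (lmul a) \<le> norm a"
    by (rule A.opn_le[OF L]) (auto simp: hn norm_mult_ineq)
  moreover have "norm a \<le> A.opn (lmul a)"
  proof (cases "a = 0")
    case False
    have "norm a * norm a = norm (a * st a)" using norm_st_mult[of "st a"] by (simp add: power2_eq_square)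
    also have "\<dots> \<le> A.opn (lmul a) * norm a" using A.hn_app_le[OF L, of "st a"] by (simp add: hn)
    finally show ?thesis using False by simp
  qed (simp add: A.opn_nonneg)
  ultimately show "A.opn (lmul a) = norm a" by simp
  show "lmul (r *\<^sub>R a) = A.scal (of_real r) * lmul a"
    by (rule endo_eqI) simp
qed

text \<open>The sum dominates each of its summands in the order, and the norm is monotone on
  positive elements.\<close>

lemma norm_square_le_sum:
  assumes "finite I" "j \<in> I" shows "(norm (b j))\<^sup>2 \<le> norm (\<Sum>i\<in>I. st (b i) * b i)"
proof -
  interpret A: ip_module sc st sc "\<lambda>x y. st x * y" by (rule self_module)
  have p: "A.pos (lmul (st a * a))" for a
    using A.pos_star_mult[OF lmul_facts(1)[of a]] by (simp add: lmul_facts(2) lmul_mult)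
  have ps: "A.pos (lmul (\<Sum>i\<in>K. st (b i) * b i))" if "finite K" for K
    using that by (induction K) (auto simp: lmul_zero lmul_add intro!: A.pos_add p)
  have "lmul (\<Sum>i\<in>I. st (b i) * b i) - lmul (st (b j) * b j) = lmul (\<Sum>i\<in>I - {j}. st (b i) * b i)"
    using assms by (simp add: sum.remove lmul_add)
  then have "A.pos (lmul (\<Sum>i\<in>I. st (b i) * b i) - lmul (st (b j) * b j))" using ps[of "I - {j}"] assms by simp
  from A.nrm_mono_pos[OF p this lmul_facts(1)]
  show ?thesis by (simp add: lmul_facts(3) norm_st_mult)
qed

text \<open>The algebraic core of Cauchy-Schwarz: \<open>y\<close> stands for <y, y>,
  \<open>a\<close> for <x, y>, st p * p for <x, x> and st q * q for <z, z> with z = m y - x a. As p*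
  p \<le> m, the last term of \<open>q\<close> is at most m a* a, which leaves m a* a \<le> m^2
  y.\<close>

lemma cauchy_schwarz_norm:
  assumes m: "0 \<le> m" "norm (st p * p) \<le> m"
    and q: "st q * q = (m * m) *\<^sub>R y - m *\<^sub>R (st a * a) - m *\<^sub>R (st a * a) + st a * (st p * p) * a"
  shows "m * (norm a)\<^sup>2 \<le> m * m * norm y"
proof -
  interpret A: ip_module sc st sc "\<lambda>x y. st x * y" by (rule self_module)
  have p: "A.pos (lmul (st c * c))" for c
    using A.pos_star_mult[OF lmul_facts(1)[of c]] by (simp add: lmul_facts(2) lmul_mult)
  have "A.pos (A.rs m - lmul (st p * p))"
    by (rule A.pos_rs_diff) (use m lmul_facts in \<open>auto simp: st_mult\<close>)
  from A.pos_conjugate[OF this lmul_facts(1)[of a]]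
  have "A.pos (lmul (m *\<^sub>R (st a * a) - st a * (st p * p) * a))"
    using A.cs_left_commute[OF lmul_facts(1)[of "st a"]]
    by (simp add: lmul_facts(2,4) lmul_diff lmul_mult algebra_simps)
  from A.pos_add[OF p[of q] this]
  have "A.pos (lmul ((m * m) *\<^sub>R y) - lmul (m *\<^sub>R (st a * a)))"
    unfolding q by (simp flip: lmul_add lmul_diff)
  moreover have "A.pos (lmul (m *\<^sub>R (st a * a)))"
    unfolding lmul_facts(4) by (intro A.pos_scale p m)
  ultimately have "norm (m *\<^sub>R (st a * a)) \<le> norm ((m * m) *\<^sub>R y)"
    using A.nrm_mono_pos lmul_facts(1,3) by metis
  then show ?thesis using m by (simp add: norm_st_mult)
qed

end

section \<open>Hilbert modules and the Cauchy-Schwarz inequality\<close>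

locale hilbert_mod = cstar_alg sc st for sc :: "complex \<Rightarrow> 'a::{real_normed_algebra,banach} \<Rightarrow> 'a" and st +
  fixes scm :: "complex \<Rightarrow> 'm::ab_group_add \<Rightarrow> 'm" and ra :: "'m \<Rightarrow> 'a \<Rightarrow> 'm" and ip :: "'m \<Rightarrow> 'm \<Rightarrow> 'a"
  assumes hm: "hilbert_module sc st scm ra ip"
begin

lemma ra_add_left: "ra (x + y) a = ra x a + ra y a"
  and ra_add_right: "ra x (a + b) = ra x a + ra x b"
  and ra_mult: "ra x (a * b) = ra (ra x a) b"
  and ip_add: "ip x (y + z) = ip x y + ip x z"
  and ip_scm: "ip x (scm l y) = sc l (ip x y)"
  and ip_ra: "ip x (ra y a) = ip x y * a"
  and ip_sym: "ip y x = st (ip x y)"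
  and ip_pos: "positive_elt st (ip x x)"
  and ip_definite: "ip x x = 0 \<Longrightarrow> x = 0"
  using hm unfolding hilbert_module_def by metis+

lemma ip_ra_left: "ip (ra x a) y = st a * ip x y"
  by (metis ip_ra ip_sym st_mult)

lemma hilbert_cauchy_schwarz: "norm (ip x y) \<le> hmnorm ip x * hmnorm ip y"
proof -
  let ?a = "ip x y" and ?m = "norm (ip x x)"
  obtain p where p: "ip x x = st p * p" using ip_pos[of x] by (auto simp: positive_elt_def)
  \<comment> \<open>The usual vector y - x <x, y> / <x, x>, with the norm of <x, x> for the
    denominator and multiplied out.\<close>
  let ?z = "scm (of_real ?m) y - ra x ?a"
  obtain q where q: "ip ?z ?z = st q * q" using ip_pos[of ?z] by (auto simp: positive_elt_def)
  have ip_diff: "ip u (v - w) = ip u v - ip u w" for u v w using ip_add[of u "v - w" w] by simp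
  have ip_diff_l: "ip (v - w) u = ip v u - ip w u" for u v w by (metis ip_sym ip_diff st_diff)
  have ip_scm_l: "ip (scm (of_real ?m) v) w = ?m *\<^sub>R ip v w" for v w
    by (metis ip_sym ip_scm st_sc complex_cnj_complex_of_real sc_of_real)
  have "st q * q = (?m * ?m) *\<^sub>R ip y y - ?m *\<^sub>R (st ?a * ?a) - ?m *\<^sub>R (st ?a * ?a) + st ?a * (st p * p) * ?a"
    unfolding q[symmetric] using ip_sym[of y x]
    by (simp add: ip_diff ip_diff_l ip_scm_l ip_scm ip_ra ip_ra_left mult.assoc scaleR_diff_right left_diff_distrib flip: p)
  then have *: "?m * (norm ?a)\<^sup>2 \<le> ?m * ?m * norm (ip y y)"
    by (intro cauchy_schwarz_norm[of _ p q]) (auto simp: p)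
  have "(norm ?a)\<^sup>2 \<le> ?m * norm (ip y y)"
  proof (cases "?m = 0")
    case True
    then have "x = 0" using ip_definite by simp
    moreover have "ip 0 y = 0" using ip_diff_l[of 0 0 y] by simp
    ultimately show ?thesis by simp
  next
    case False
    then have "?m > 0" by simp
    with * show ?thesis by (metis mult.assoc mult_le_cancel_left_pos)
  qed
  then have "norm ?a \<le> sqrt (?m * norm (ip y y))" by (rule real_le_rsqrt)
  then show ?thesis by (simp add: hmnorm_def real_sqrt_mult)
qed

sublocale ip_module sc st scm ip
proof
  show "cvec scm" using hm unfolding hilbert_module_def by (elim conjE)
  show "\<exists>L. \<forall>e>0. \<exists>N. \<forall>n\<ge>N. hmnorm ip (X n - L) < e"
    if "\<And>e. e > 0 \<Longrightarrow> \<exists>N::nat. \<forall>m\<ge>N. \<forall>n\<ge>N. hmnorm ip (X m - X n) < e" for X :: "nat \<Rightarrow> 'm"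
  proof -
    have "\<forall>X. (\<forall>e>0. \<exists>N::nat. \<forall>m\<ge>N. \<forall>n\<ge>N. hmnorm ip (X m - X n) < e) \<longrightarrow>
        (\<exists>L. \<forall>e>0. \<exists>N::nat. \<forall>n\<ge>N. hmnorm ip (X n - L) < e)"
      using hm unfolding hilbert_module_def by (elim conjE)
    then have "(\<forall>e>0. \<exists>N::nat. \<forall>m\<ge>N. \<forall>n\<ge>N. hmnorm ip (X m - X n) < e) \<longrightarrow>
        (\<exists>L. \<forall>e>0. \<exists>N::nat. \<forall>n\<ge>N. hmnorm ip (X n - L) < e)" by (rule spec)
    then show ?thesis using that by (elim mp) blast
  qed
qed (rule ip_add ip_scm ip_sym hilbert_cauchy_schwarz | erule ip_definite)+

end

section \<open>Stable rank one and compact operators\<close>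

context cstar_alg
begin

text \<open>Says that 1 + q and 1 + d are inverse to each other in the unitization.\<close>
definition quasi_inverse :: "'a \<Rightarrow> 'a \<Rightarrow> bool" where
  "quasi_inverse q d \<longleftrightarrow> q + d + q * d = 0 \<and> q + d + d * q = 0"

text \<open>In the unitization this is the product (1 + q)(1 + r) with inverse (1 + p)(1 +
  d).\<close>

lemma quasi_inverse_compose:
  assumes "quasi_inverse q d" "quasi_inverse r p"
  shows "quasi_inverse (q + r + q * r) (p + d + p * d)"
proof -
  have *: "(q + r + q * r) + (p + d + p * d) + (q + r + q * r) * (p + d + p * d) = 0"
    if "q + d + q * d = 0" "r + p + r * p = 0" for q r p d :: 'a
  proof -
    have "(q + r + q * r) + (p + d + p * d) + (q + r + q * r) * (p + d + p * d)
      = (q + d + q * d) + (r + p + r * p) + q * (r + p + r * p) + (r + p + r * p) * d + q * ((r + p + r * p) * d)"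
      by (simp add: algebra_simps)
    then show ?thesis using that by simp
  qed
  show ?thesis
    using *[of q d r p] *[of p r d q] assms unfolding quasi_inverse_def by (simp add: add.commute)
qed

lemma quasi_inverse_small:
  assumes "norm p \<le> 1/2" shows "\<exists>r. quasi_inverse p r \<and> norm r \<le> 2 * norm p"
proof -
  \<comment> \<open>\<open>u n\<close> is (-p)^(n+1), defined by recursion because A may have no
    unit. The sum is the Neumann series of (1 + p)^-1 without its leading 1, and the ratio 1/2 gives
    the factor 2.\<close>
  define u where "u n = rec_nat (- p) (\<lambda>_ v. - (p * v)) n" for n
  have u0: "u 0 = - p" and uS: "u (Suc n) = - (p * u n)" for n by (auto simp: u_def)
  have nu: "norm (u n) \<le> norm p * (1/2) ^ n" for n
  proof (induction n)
    case (Suc n)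
    have "norm (u (Suc n)) \<le> norm p * norm (u n)" using norm_mult_ineq[of p "u n"] by (simp add: uS)
    also have "\<dots> \<le> 1/2 * (norm p * (1/2) ^ n)" by (intro mult_mono assms Suc) auto
    finally show ?case by simp
  qed (simp add: u0)
  have sg: "summable (\<lambda>n. norm p * (1/2) ^ n)" by (intro summable_mult summable_geometric) simp
  have su: "summable u" by (rule summable_comparison_test'[OF sg nu])
  have up: "u n * p = p * u n" for n
    by (induction n) (simp_all add: u0 uS mult.assoc)
  let ?r = "suminf u"
  have "?r = u 0 + (\<Sum>n. u (Suc n))" using suminf_split_head[OF su] by simp
  also have "(\<Sum>n. u (Suc n)) = - (p * ?r)"
    unfolding uS using suminf_minus[OF summable_mult[OF su, of p]] suminf_mult[OF su, of p] by simp
  finally have r1: "p + ?r + p * ?r = 0" by (simp add: u0 algebra_simps)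
  moreover have "?r * p = p * ?r"
    using suminf_mult2[OF su, of p] suminf_mult[OF su, of p] up by simp
  ultimately have "quasi_inverse p ?r" by (simp add: quasi_inverse_def)
  moreover have "norm ?r \<le> (\<Sum>n. norm p * (1/2) ^ n)"
    by (rule norm_suminf_le[OF nu sg])
  then have "norm ?r \<le> 2 * norm p" using suminf_mult[of "\<lambda>n. (1/2::real) ^ n" "norm p"] suminf_geometric[of "1/2::real"]
    by (simp add: summable_geometric)
  ultimately show ?thesis by blast
qed

text \<open>A single form for both cases of the definition. If A has a unit e, approximate e + a by
  an invertible y and put q = y - e; otherwise approximate (1, a) by an invertible (m, y) and divide
  by m.\<close>

lemma stable_rank_one_quasi_inverse:
  assumes sr: "stable_rank_one sc" and e: "0 < e"
  shows "\<exists>q d. norm (a - q) < e \<and> quasi_inverse q d"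
proof (cases "\<exists>u::'a. is_unit_of u")
  case True
  then obtain u :: 'a where u: "is_unit_of u" by blast
  then have u1: "u * x = x" "x * u = x" for x by (auto simp: is_unit_of_def)
  obtain y z where yz: "y * z = u" "z * y = u" "norm (u + a - y) < e"
    using sr u e unfolding stable_rank_one_def if_P[OF True] by blast
  have "quasi_inverse (y - u) (z - u)"
    unfolding quasi_inverse_def using yz u1 by (simp add: algebra_simps)
  moreover have "a - (y - u) = u + a - y" by simp
  ultimately show ?thesis using yz(3) by metis
next
  case False
  \<comment> \<open>With d \<le> 1/2 the scalar m has modulus at least 1/2, so its inverse n
    satisfies |1 - n| \<le> 2 d. The error is then below d + 2 d (|a| + 1) = d (3 + 2 |a|).\<close>
  define d where "d = min (1/2) (e / (3 + 2 * norm a))"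
  have n0: "0 < 3 + 2 * norm a" by (simp add: add_pos_nonneg)
  have d: "0 < d" "d \<le> 1/2" "d * (3 + 2 * norm a) \<le> e"
  proof -
    show "0 < d" using e n0 by (simp add: d_def)
    show "d \<le> 1/2" unfolding d_def by (rule min.cobounded1)
    have "d \<le> e / (3 + 2 * norm a)" unfolding d_def by (rule min.cobounded2)
    then show "d * (3 + 2 * norm a) \<le> e" using n0 by (simp add: pos_le_divide_eq)
  qed
  obtain m y where my: "unitz_invertible sc (m, y)" "cmod (1 - m) + norm (a - y) < d"
    using sr d(1) unfolding stable_rank_one_def if_not_P[OF False] by blast
  then obtain n w where nw: "unitz_mult sc (m, y) (n, w) = (1, 0)" "unitz_mult sc (n, w) (m, y) = (1, 0)"
    unfolding unitz_invertible_def by (metis surj_pair)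
  then have mn: "m * n = 1" "n * m = 1" "sc m w + sc n y + y * w = 0" "sc n y + sc m w + w * y = 0"
    by (auto simp: unitz_mult_def)
  have prod: "sc n y * sc m w = y * w" "sc m w * sc n y = w * y"
    by (metis sc_mult_left sc_mult_right sc_sc mn(1,2) sc_one)+
  have "quasi_inverse (sc n y) (sc m w)"
    unfolding quasi_inverse_def prod using mn(3,4) by (simp add: add.commute)
  moreover have "norm (a - sc n y) < e"
  proof -
    have m1: "cmod (1 - m) < d" "norm (a - y) < d" using my(2) norm_ge_zero[of "1 - m"] norm_ge_zero[of "a - y"] by linarith+
    have "1 \<le> cmod m + cmod (1 - m)" using norm_triangle_ineq[of m "1 - m"] by simp
    then have "1/2 \<le> cmod m" using m1 d by linarith
    then have "1/2 * cmod n \<le> cmod m * cmod n" by (rule mult_right_mono) simp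
    also have "\<dots> = 1" using mn(1) norm_mult[of m n] by simp
    finally have "cmod n \<le> 2" by simp
    moreover have "1 - n = - (n * (1 - m))" using mn by (simp add: algebra_simps)
    ultimately have n1: "cmod (1 - n) \<le> 2 * d"
      using m1 mult_mono[of "cmod n" 2 "cmod (1 - m)" d] by (simp add: norm_mult norm_minus_cancel)
    have "y = a - (a - y)" by simp
    then have ny: "norm y \<le> norm a + 1" using norm_triangle_ineq4[of a "a - y"] m1 d by simp
    have "sc (1 - n) y = y - sc n y" using sc_add_left[of "1 - n" n y] by (simp add: eq_diff_eq)
    then have eq: "a - sc n y = (a - y) + sc (1 - n) y" by simp
    have "norm (a - sc n y) \<le> norm (a - y) + cmod (1 - n) * norm y"
      unfolding eq using norm_triangle_ineq[of "a - y" "sc (1 - n) y"] by simp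
    also have "\<dots> < d + 2 * d * (norm a + 1)"
      by (rule add_less_le_mono[OF m1(2) mult_mono[OF n1 ny]]) (use d in auto)
    also have "\<dots> = d * (3 + 2 * norm a)" by (simp add: algebra_simps)
    finally show ?thesis using d by linarith
  qed
  ultimately show ?thesis by blast
qed

end

context hilbert_mod
begin

section \<open>Rank one and compact operators\<close>

lemma hn_ra: "hn (ra x a) \<le> hn x * norm a"
proof (rule power2_le_imp_le)
  have "(hn (ra x a))\<^sup>2 = norm (st a * (ip x x * a))"
    by (simp add: hn_square ip_ra ip_ra_left mult.assoc)
  also have "\<dots> \<le> norm (st a) * (norm (ip x x) * norm a)"
    by (meson mult_left_mono norm_ge_zero norm_mult_ineq order_trans)
  also have "\<dots> = (hn x * norm a)\<^sup>2"
    by (simp add: power_mult_distrib hn_square) (simp add: power2_eq_square)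
  finally show "(hn (ra x a))\<^sup>2 \<le> (hn x * norm a)\<^sup>2" .
qed simp

lemma app_ra: "T \<in> L \<Longrightarrow> app T (ra x a) = ra (app T x) a"
  by (rule ip_right_eqI) (simp add: ip_adj' ip_ra)

definition theta :: "'m \<Rightarrow> 'm \<Rightarrow> 'm endo" where
  "theta x y = Endo (\<lambda>z. ra x (ip y z))"

lemma app_theta [simp]: "app (theta x y) z = ra x (ip y z)"
  unfolding theta_def by (subst app_Endo) (simp_all add: ip_add_right ra_add_right)

lemma adj_pair_theta: "adj_pair (theta x y) (theta y x)"
  unfolding adj_pair_def by (simp add: ip_ra ip_ra_left flip: ip_st)

lemma hn_theta: "hn (app (theta x y) z) \<le> (hn x * hn y) * hn z"
  using hn_ra[of x "ip y z"] mult_left_mono[OF cauchy_schwarz[of y z] hn_nonneg[of x]] by simp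

lemma theta_L [simp, intro]: "theta x y \<in> L"
  by (rule L_I[OF adj_pair_theta _ hn_theta]) simp

lemma opn_theta: "opn (theta x y) \<le> hn x * hn y"
  by (rule opn_le[OF theta_L _ hn_theta]) simp

lemma adj_theta [simp]: "adj (theta x y) = theta y x"
  by (rule adj_eqI[OF adj_pair_theta])

lemma mult_theta: "T \<in> L \<Longrightarrow> T * theta x y = theta (app T x) y"
  by (rule endo_eqI) (simp add: app_ra)

lemma theta_mult: "T \<in> L \<Longrightarrow> theta x y * T = theta x (app (adj T) y)"
  by (rule endo_eqI) (simp add: ip_adj')

lemma theta_diff_left: "theta x y - theta x' y = theta (x - x') y"
proof (rule endo_eqI)
  fix z show "app (theta x y - theta x' y) z = app (theta (x - x') y) z"
    using ra_add_left[of "x - x'" x' "ip y z"] by (simp add: algebra_simps)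
qed

definition finite_rank :: "'m endo set" where
  "finite_rank = {\<Sum>i<n. theta (xs i) (ys i) | (n::nat) xs ys. True}"

definition Comp :: "'m endo set" where
  "Comp = {T \<in> L. compact_op ra ip (app T)}"

lemma sum_theta_finite_rank: "(\<Sum>i<(n::nat). theta (xs i) (ys i)) \<in> finite_rank"
  unfolding finite_rank_def by blast

lemma finite_rank_L: "R \<in> finite_rank \<Longrightarrow> R \<in> L"
  unfolding finite_rank_def by (auto intro!: sum_closed)

lemma finite_rank_add: assumes "R \<in> finite_rank" "R' \<in> finite_rank" shows "R + R' \<in> finite_rank"
proof -
  have one: "R + theta x y \<in> finite_rank" if R: "R \<in> finite_rank" for R x y
  proof -
    obtain n :: nat and xs ys where "R = (\<Sum>i<n. theta (xs i) (ys i))" using R unfolding finite_rank_def by blast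
    then have "R + theta x y = (\<Sum>i<Suc n. theta ((xs(n := x)) i) ((ys(n := y)) i))" by simp
    then show ?thesis using sum_theta_finite_rank by metis
  qed
  obtain n :: nat and xs ys where R': "R' = (\<Sum>i<n. theta (xs i) (ys i))" using assms(2) unfolding finite_rank_def by blast
  have "R + (\<Sum>i<n. theta (xs i) (ys i)) \<in> finite_rank" for n :: nat
    by (induction n) (use assms(1) one in \<open>auto simp flip: add.assoc\<close>)
  then show ?thesis using R' by simp
qed

lemma finite_rank_mult:
  assumes "R \<in> finite_rank" "T \<in> L" shows "T * R \<in> finite_rank" "R * T \<in> finite_rank"
proof -
  obtain n :: nat and xs ys where R: "R = (\<Sum>i<n. theta (xs i) (ys i))" using assms(1) unfolding finite_rank_def by blast
  have "T * R = (\<Sum>i<n. theta (app T (xs i)) (ys i))" unfolding R by (simp add: sum_distrib_left mult_theta assms(2))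
  then show "T * R \<in> finite_rank" using sum_theta_finite_rank by simp
  have "R * T = (\<Sum>i<n. theta (xs i) (app (adj T) (ys i)))" unfolding R by (simp add: sum_distrib_right theta_mult assms(2))
  then show "R * T \<in> finite_rank" using sum_theta_finite_rank by simp
qed

lemma finite_rank_adj: assumes "R \<in> finite_rank" shows "adj R \<in> finite_rank"
proof -
  obtain n :: nat and xs ys where R: "R = (\<Sum>i<n. theta (xs i) (ys i))" using assms(1) unfolding finite_rank_def by blast
  then have "adj R = (\<Sum>i<n. theta (ys i) (xs i))" by (simp add: star_sum)
  then show ?thesis using sum_theta_finite_rank by simp
qed

text \<open>Replaces the pointwise bounds of \<open>compact_op\<close> by the operator norm, in
  which the ideal properties are proved.\<close>

lemma Comp_iff: assumes T: "T \<in> L" shows "T \<in> Comp \<longleftrightarrow> (\<forall>e>0. \<exists>R\<in>finite_rank. opn (T - R) \<le> e)"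
proof
  assume "T \<in> Comp"
  then have c: "compact_op ra ip (app T)" by (simp add: Comp_def)
  show "\<forall>e>0. \<exists>R\<in>finite_rank. opn (T - R) \<le> e"
  proof (intro allI impI)
    fix e :: real assume "e > 0"
    then obtain n :: nat and xs ys where n: "\<And>z. hn (app T z - (\<Sum>i<n. ra (xs i) (ip (ys i) z))) \<le> e * hn z"
      using c unfolding compact_op_def by meson
    let ?R = "\<Sum>i<n. theta (xs i) (ys i)"
    have "opn (T - ?R) \<le> e"
      by (rule opn_le) (use n T \<open>e > 0\<close> in \<open>auto simp: app_sum intro!: diff_closed sum_closed\<close>)
    then show "\<exists>R\<in>finite_rank. opn (T - R) \<le> e" using sum_theta_finite_rank by blast
  qed
next
  assume *: "\<forall>e>0. \<exists>R\<in>finite_rank. opn (T - R) \<le> e"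
  show "T \<in> Comp"
    unfolding Comp_def compact_op_def
  proof (intro CollectI conjI T allI impI)
    fix e :: real assume "e > 0"
    then obtain R where R: "R \<in> finite_rank" "opn (T - R) \<le> e" using * by blast
    obtain n :: nat and xs ys where n: "R = (\<Sum>i<n. theta (xs i) (ys i))" using R(1) unfolding finite_rank_def by blast
    have "hn (app T z - (\<Sum>i<n. ra (xs i) (ip (ys i) z))) \<le> e * hn z" for z
      using hn_app_le[OF diff_closed[OF T finite_rank_L[OF R(1)]], of z] mult_right_mono[OF R(2) hn_nonneg[of z]]
      by (simp add: n app_sum)
    then show "\<exists>(n::nat) xs ys. \<forall>z. hn (app T z - (\<Sum>i<n. ra (xs i) (ip (ys i) z))) \<le> e * hn z" by blast
  qed
qed

lemma Comp_L: "T \<in> Comp \<Longrightarrow> T \<in> L"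
  by (simp add: Comp_def)

lemma finite_rank_Comp: "R \<in> finite_rank \<Longrightarrow> R \<in> Comp"
  using Comp_iff[OF finite_rank_L, of R] by (auto intro!: bexI[of _ R])

lemma theta_Comp: "theta x y \<in> Comp"
  using sum_theta_finite_rank[of "\<lambda>_. x" "\<lambda>_. y" 1] finite_rank_Comp by simp

lemma Comp_approx: "T \<in> Comp \<Longrightarrow> e > 0 \<Longrightarrow> \<exists>R\<in>finite_rank. opn (T - R) \<le> e"
  using Comp_iff Comp_L by blast

lemma closed_ideal_Comp: "closed_ideal Comp"
  unfolding closed_ideal_def
proof (intro conjI ballI allI impI)
  show "Comp \<subseteq> L" using Comp_L by blast
  show "0 \<in> Comp" using sum_theta_finite_rank[of undefined undefined 0] finite_rank_Comp by simp
next
  fix S T assume S: "S \<in> Comp" and T: "T \<in> Comp"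
  have "\<exists>R\<in>finite_rank. opn (S + T - R) \<le> e" if "e > 0" for e
  proof -
    have "e / 2 > 0" using that by simp
    then obtain R Q where RQ: "R \<in> finite_rank" "opn (S - R) \<le> e / 2" "Q \<in> finite_rank" "opn (T - Q) \<le> e / 2"
      using Comp_approx[OF S] Comp_approx[OF T] by meson
    have "opn ((S - R) + (T - Q)) \<le> e / 2 + e / 2"
      by (rule nrm_add_le) (use RQ S T Comp_L finite_rank_L in auto)
    then have "opn (S + T - (R + Q)) \<le> e" by (simp add: algebra_simps)
    then show ?thesis using RQ finite_rank_add by blast
  qed
  then show "S + T \<in> Comp" using Comp_iff[OF add_closed[OF Comp_L[OF S] Comp_L[OF T]]] by blast
next
  fix T A assume T: "T \<in> Comp" and A: "A \<in> L"
  have TL: "T \<in> L" using T Comp_L by blast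
  have *: "\<exists>R\<in>finite_rank. opn A * opn (T - R) \<le> e" if "e > 0" for e
  proof -
    have p: "0 < 1 + opn A" using nrm_nonneg[of A] by linarith
    then have "0 < e / (1 + opn A)" using that by simp
    then obtain R where R: "R \<in> finite_rank" "opn (T - R) \<le> e / (1 + opn A)"
      using Comp_approx[OF T] by blast
    have "opn A * opn (T - R) \<le> (1 + opn A) * (e / (1 + opn A))"
      by (intro mult_mono R) (use p in auto)
    then show ?thesis using R p by auto
  qed
  have "\<exists>R\<in>finite_rank. opn (A * T - R) \<le> e" if "e > 0" for e
  proof -
    obtain R where R: "R \<in> finite_rank" "opn A * opn (T - R) \<le> e" using *[OF \<open>e > 0\<close>] by blast
    have "opn (A * (T - R)) \<le> opn A * opn (T - R)"
      by (rule nrm_mult) (use A TL R finite_rank_L in auto)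
    then have "opn (A * T - A * R) \<le> e" using R(2) by (simp add: right_diff_distrib)
    then show ?thesis using finite_rank_mult(1)[OF R(1) A] by blast
  qed
  then show "A * T \<in> Comp" using Comp_iff[OF mult_closed[OF A TL]] by blast
  have "\<exists>R\<in>finite_rank. opn (T * A - R) \<le> e" if "e > 0" for e
  proof -
    obtain R where R: "R \<in> finite_rank" "opn A * opn (T - R) \<le> e" using *[OF \<open>e > 0\<close>] by blast
    have "opn ((T - R) * A) \<le> opn (T - R) * opn A"
      by (rule nrm_mult) (use A TL R finite_rank_L in auto)
    then have "opn (T * A - R * A) \<le> e" using R(2) by (simp add: left_diff_distrib mult.commute)
    then show ?thesis using finite_rank_mult(2)[OF R(1) A] by blast
  qed
  then show "T * A \<in> Comp" using Comp_iff[OF mult_closed[OF TL A]] by blast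
next
  fix T assume T: "T \<in> Comp"
  have TL: "T \<in> L" using T Comp_L by blast
  have "\<exists>R\<in>finite_rank. opn (adj T - R) \<le> e" if "e > 0" for e
  proof -
    obtain R where R: "R \<in> finite_rank" "opn (T - R) \<le> e" using Comp_approx[OF T \<open>e > 0\<close>] by blast
    have "opn (adj (T - R)) \<le> e" using R TL finite_rank_L by simp
    then show ?thesis using R TL finite_rank_L finite_rank_adj[OF R(1)] by (auto simp: star_diff)
  qed
  then show "adj T \<in> Comp" using Comp_iff[OF star_closed[OF TL]] by blast
next
  fix X T assume cv: "conv X T" and X: "\<forall>n. X n \<in> Comp"
  have TL: "T \<in> L" using cv by (simp add: conv_def)
  have "\<exists>R\<in>finite_rank. opn (T - R) \<le> e" if "e > 0" for e
  proof -
    have "(\<lambda>n. opn (X n - T)) \<longlonglongrightarrow> 0" using cv by (simp add: conv_def)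
    moreover have e2: "0 < e / 2" using that by simp
    ultimately obtain n where "norm (opn (X n - T) - 0) < e / 2"
      using LIMSEQ_D by (metis order_refl)
    then have n: "opn (X n - T) < e / 2" by simp
    obtain R where R: "R \<in> finite_rank" "opn (X n - R) \<le> e / 2"
      using Comp_approx[of "X n", OF _ e2] X by blast
    have "opn (T - R) \<le> opn (T - X n) + opn (X n - R)"
      by (rule nrm_dist_triangle) (use TL X Comp_L R finite_rank_L in auto)
    then have "opn (T - R) \<le> e" using n R nrm_diff_commute[of T "X n"] TL X Comp_L by auto
    then show ?thesis using R by blast
  qed
  then show "T \<in> Comp" using Comp_iff[OF TL] by blast
qed

section \<open>Invertible elements in the unitization of the compact operators\<close>

abbreviation "KU \<equiv> unitized Comp"

definition KU_inverse :: "'m endo \<Rightarrow> 'm endo \<Rightarrow> bool" where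
  "KU_inverse y yi \<longleftrightarrow> y \<in> KU \<and> yi \<in> KU \<and> y * yi = 1 \<and> yi * y = 1"

lemmas KU_L = unitized_closed[OF closed_ideal_Comp]

text \<open>z + theta (x, y) is invertible as soon as 1 + <y, z^-1 x> is; in the latter, x is moved to x (1 + r) with
  (1 + r)^-1 = 1 + p, which turns it into (1 + p + <y, z^-1 x>) (1 + r).\<close>
lemma KU_inverse_add_theta:
  assumes sr: "stable_rank_one sc" and z: "KU_inverse z zi" and e: "0 < e"
  shows "\<exists>y yi. KU_inverse y yi \<and> opn (y - (z + theta x0 y0)) < e"
proof -
  have zL: "z \<in> KU" "zi \<in> KU" "z \<in> L" "zi \<in> L" "z * zi = 1" "zi * z = 1"
    using z KU_L by (auto simp: KU_inverse_def)
  have zz: "app z (app zi w) = w" "app zi (app z w) = w" for w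
    using app_times[of z zi w] app_times[of zi z w] zL by simp_all
  let ?a = "ip y0 (app zi x0)"
  define k where "k = hn x0 * hn y0"
  have k: "0 \<le> k" by (simp add: k_def)
  \<comment> \<open>The bound 1/2 admits the Neumann series for 1 + p. Replacing \<open>x0\<close>
    by x0 (1 + r) changes the rank one operator by at most |r| k \<le> 2 e' k; the 1 in k + 1 covers
    k = 0.\<close>
  define e' where "e' = min (1/2) (e / (2 * (k + 1)))"
  have e': "0 < e'" "e' \<le> 1/2" "2 * e' * k < e"
  proof -
    show "0 < e'" using e k by (simp add: e'_def)
    show "e' \<le> 1/2" unfolding e'_def by (rule min.cobounded1)
    have "e' \<le> e / (2 * (k + 1))" unfolding e'_def by (rule min.cobounded2)
    then have "e' * (2 * (k + 1)) \<le> e" using k by (simp add: pos_le_divide_eq)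
    then show "2 * e' * k < e" using \<open>0 < e'\<close> by (simp add: algebra_simps)
  qed
  obtain q d where q: "norm (?a - q) < e'" "quasi_inverse q d"
    using stable_rank_one_quasi_inverse[OF sr e'(1)] by blast
  define p where "p = q - ?a"
  have np: "norm p < e'" using q by (simp add: p_def norm_minus_commute)
  then obtain r where r: "quasi_inverse p r" "norm r \<le> 2 * norm p"
    using quasi_inverse_small[of p] e' by auto
  then have rp: "quasi_inverse r p" by (simp add: quasi_inverse_def add.commute)
  define g where "g = ?a + ?a * r"
  have "g = q + r + q * r"
  proof -
    have "g = q + r + q * r - (p + r + p * r)" unfolding g_def p_def by (simp add: algebra_simps)
    also have "p + r + p * r = 0" using r(1) by (simp add: quasi_inverse_def)
    finally show ?thesis by simp
  qed
  then obtain f where f: "quasi_inverse g f" using quasi_inverse_compose[OF q(2) rp] by blast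
  define x where "x = x0 + ra x0 r"
  define w where "w = app zi x"
  have g: "ip y0 w = g"
    unfolding w_def x_def g_def using zL by (simp add: app_ra ip_add_right ip_ra)
  define y where "y = z + theta x y0"
  \<comment> \<open>The Sherman-Morrison formula: the inverse of z + theta (x, y0) is z^-1 - theta
    (w (1 + g)^-1, (z^-1)* y0) with w = z^-1 x, and (1 + g)^-1 = 1 + f.\<close>
  define yi where "yi = zi + theta (- (w + ra w f)) (app (adj zi) y0)"
  have ra_neg: "ra (- v) c = - ra v c" for v c
    using ra_add_left[of v "- v" c] ra_add_left[of 0 0 c] by (simp add: eq_neg_iff_add_eq_0 add.commute)
  have app_yi: "app yi v = app zi v - ra (w + ra w f) (ip y0 (app zi v))" for v
    unfolding yi_def app_plus app_theta ra_neg using zL by (simp flip: ip_adj')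
  have app_y: "app y v = app z v + ra x (ip y0 v)" for v by (simp add: y_def)
  have ra_zero: "ra v 0 = 0" for v using ra_add_right[of v 0 0] by simp
  have ra_diff: "ra v (a - b) = ra v a - ra v b" for v a b using ra_add_right[of v "a - b" b] by simp
  have ra_diff_l: "ra (v - v') a = ra v a - ra v' a" for v v' a using ra_add_left[of "v - v'" v' a] by simp
  have 1: "y * yi = 1"
  proof (rule endo_eqI)
    fix v
    let ?t = "ip y0 (app zi v)"
    have "app y (app yi v) = v - ra (app z (w + ra w f)) ?t + ra x (?t - ip y0 (w + ra w f) * ?t)"
      unfolding app_yi app_y using zL by (simp add: zz app_ra ip_diff_right ip_ra del: app_add)
    also have "app z (w + ra w f) = x + ra x f" using zL by (simp add: app_ra w_def zz)
    also have "ip y0 (w + ra w f) = g + g * f" by (simp add: ip_add_right ip_ra g)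
    also have "v - ra (x + ra x f) ?t + ra x (?t - (g + g * f) * ?t) = v - ra x ((g + f + g * f) * ?t)"
      by (simp add: ra_add_left ra_add_right ra_diff ra_mult[symmetric] algebra_simps)
    also have "\<dots> = v" using f by (simp add: quasi_inverse_def ra_zero)
    finally show "app (y * yi) v = app 1 v" by simp
  qed
  have 2: "yi * y = 1"
  proof (rule endo_eqI)
    fix v
    let ?t = "ip y0 v"
    have "app yi (app y v) = v + ra w ?t - ra (w + ra w f) (?t + g * ?t)"
      unfolding app_yi app_y using zL by (simp add: zz app_ra ip_add_right ip_ra g flip: w_def)
    also have "\<dots> = v - ra w ((g + f + f * g) * ?t)"
      by (simp add: ra_add_left ra_add_right ra_diff ra_mult[symmetric] algebra_simps)
    also have "\<dots> = v" using f by (simp add: quasi_inverse_def ra_zero)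
    finally show "app (yi * y) v = app 1 v" by simp
  qed
  have "y \<in> KU" "yi \<in> KU"
    unfolding y_def yi_def by (intro unitized_add_ideal[OF closed_ideal_Comp] zL theta_Comp)+
  moreover have "opn (y - (z + theta x0 y0)) < e"
  proof -
    have "y - (z + theta x0 y0) = theta (ra x0 r) y0"
      using theta_diff_left[of x y0 x0] by (simp add: y_def x_def)
    then have "opn (y - (z + theta x0 y0)) \<le> hn (ra x0 r) * hn y0" using opn_theta by simp
    also have "\<dots> \<le> hn x0 * norm r * hn y0" by (intro mult_right_mono hn_ra) simp
    also have "\<dots> = norm r * k" by (simp add: k_def)
    also have "\<dots> \<le> 2 * e' * k" using r(2) np k by (intro mult_right_mono) auto
    finally show ?thesis using e' by linarith
  qed
  ultimately show ?thesis using 1 2 unfolding KU_inverse_def by blast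
qed

lemma KU_inverse_dense:
  assumes sr: "stable_rank_one sc" and "finite I" "0 < e"
  shows "\<exists>y yi. KU_inverse y yi \<and> opn (y - (\<Sum>i\<in>I. theta (f i) (g i))) < e"
  using assms(2,3)
proof (induction I arbitrary: e rule: finite_induct)
  case empty
  \<comment> \<open>The empty sum is approximated by a small nonzero scalar, which is
    invertible.\<close>
  let ?l = "e / 2"
  have "KU_inverse (rs ?l) (rs (inverse ?l))"
    unfolding KU_inverse_def using empty unitized_cs[OF closed_ideal_Comp] by (simp flip: cs_mult)
  moreover have "opn (rs ?l - 0) < e" using nrm_rs_le[of ?l] empty by simp
  ultimately show ?case by auto
next
  case (insert j I)
  then have e2: "0 < e / 2" by simp
  obtain z zi where z: "KU_inverse z zi" "opn (z - (\<Sum>i\<in>I. theta (f i) (g i))) < e / 2"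
    using insert.IH[OF e2] by blast
  obtain y yi where y: "KU_inverse y yi" "opn (y - (z + theta (f j) (g j))) < e / 2"
    using KU_inverse_add_theta[OF sr z(1) e2] by blast
  let ?S = "\<Sum>i\<in>I. theta (f i) (g i)"
  have m: "y \<in> L" "z \<in> L" "?S \<in> L" using y z KU_L by (auto simp: KU_inverse_def intro!: sum_closed)
  have "opn ((y - (z + theta (f j) (g j))) + (z - ?S)) < e"
    using nrm_triangle[of "y - (z + theta (f j) (g j))" "z - ?S"] m y(2) z(2) by auto
  then show ?case using y(1) insert by (auto simp: algebra_simps)
qed

end

section \<open>Approximation by unitaries\<close>

lemma hsubmodule_sum_ra:
  assumes E: "hsubmodule scm ra E" and S: "finite S" "S \<subseteq> E"
  shows "(\<Sum>x\<in>S. ra x (c x)) \<in> E"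
  using S by (induction S rule: finite_induct) (use E in \<open>auto simp: hsubmodule_def\<close>)

context hilbert_mod
begin

lemma hn_unitary: assumes "v \<in> L" "adj v * v = 1" shows "hn (app v z) = hn z"
proof -
  have "ip (app v z) (app v z) = ip z (app (adj v * v) z)" using assms(1) by (simp add: ip_adj)
  then show ?thesis using assms(2) by (simp add: hmnorm_def)
qed

text \<open>Writing D for (1 - h^2)^n, the operator D T D is the sum of the theta(D y, D y), so its norm bounds the
  square of the norm of each D x.\<close>
lemma sum_theta_power_bound:
  fixes S :: "'m set"
  defines "T \<equiv> \<Sum>x\<in>S. theta x x"
  assumes S: "finite S" and k: "0 < k" and h: "h = rs k * T" "opn h \<le> 1" and x: "x \<in> S"
  shows "(hn (app ((1 - h * h) ^ n) x))\<^sup>2 \<le> inverse k * sqrt (1 / (2 * real n + 1))"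
proof -
  have TL: "T \<in> L" "adj T = T" unfolding T_def by (auto simp: star_sum intro!: sum_closed)
  have hL: "h \<in> L" "adj h = h" using TL unfolding h(1) by (auto simp: star_mult cs_commute)
  let ?P = "h * h" and ?D = "(1 - h * h) ^ n"
  have P: "pos ?P" "opn ?P \<le> 1"
    using hL h(2) pos_square[of h] nrm_mult[of h h] mult_le_one[of "opn h" "opn h"] by auto
  have "pos (1 - ?P)" using pos_rs_diff[of ?P 1] P by (simp add: pos_star)
  then have D: "pos ?D" by (rule pos_power)
  then have DL: "?D \<in> L" "adj ?D = ?D" using pos_star by auto
  have "opn (1 - ?P) \<le> 1" using pos_imp_bound[OF P] by simp
  then have "opn ?D \<le> 1"
  proof (induction n)
    case 0
    show ?case using nrm_cs_le[of 1] by simp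
  next
    case (Suc n)
    have "1 - ?P \<in> L" "(1 - ?P) ^ n \<in> L" using hL by auto
    then have "opn ((1 - ?P) * (1 - ?P) ^ n) \<le> opn (1 - ?P) * opn ((1 - ?P) ^ n)" by (rule nrm_mult)
    then show ?case using Suc mult_le_one[of "opn (1 - ?P)" "opn ((1 - ?P) ^ n)"] by simp
  qed
  have PD: "?P * ?D = ?D * ?P"
  proof -
    have "(1 - ?P) * ?P = ?P * (1 - ?P)" by (simp add: algebra_simps)
    then show ?thesis using power_commuting_commutes[of "1 - ?P" ?P n] by simp
  qed
  \<comment> \<open>The C*-identity doubles the exponent: the square of the norm is that of (1 -
    h^2)^(2n) h^2, whence 2n + 1.\<close>
  have hD: "opn (h * ?D) \<le> sqrt (1 / (2 * real n + 1))"
  proof (rule real_le_rsqrt)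
    have "adj (h * ?D) * (h * ?D) = ?D * (?P * ?D)" using hL DL by (simp add: star_mult mult.assoc)
    also have "\<dots> = (1 - ?P) ^ (n + n) * ?P" unfolding PD by (simp add: power_add mult.assoc)
    finally have "(opn (h * ?D))\<^sup>2 \<le> opn ((1 - ?P) ^ (n + n) * ?P)"
      using nrm_star_mult[of "h * ?D"] hL DL by auto
    also have "\<dots> \<le> 1 / (2 * real n + 1)"
      using nrm_one_minus_power_mult[OF P, of "n + n"] by (simp add: pos_le_divide_eq add_pos_nonneg mult.commute)
    finally show "(opn (h * ?D))\<^sup>2 \<le> 1 / (2 * real n + 1)" .
  qed
  have T: "T = rs (inverse k) * h" unfolding h(1) using k cs_inverse(1)[of "of_real k" T] by simp
  have "?D * T * ?D = rs (inverse k) * (?D * (h * ?D))"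
    unfolding T using cs_left_commute[OF DL(1)] by (simp add: mult.assoc)
  then have "opn (?D * T * ?D) = inverse k * opn (?D * (h * ?D))"
    using nrm_rs_mult[of "?D * (h * ?D)" "inverse k"] k hL DL by auto
  also have "\<dots> \<le> inverse k * (1 * sqrt (1 / (2 * real n + 1)))"
  proof (intro mult_left_mono)
    have "opn (?D * (h * ?D)) \<le> opn ?D * opn (h * ?D)" using hL DL by (intro nrm_mult) auto
    also have "\<dots> \<le> 1 * sqrt (1 / (2 * real n + 1))" using \<open>opn ?D \<le> 1\<close> hD by (intro mult_mono) auto
    finally show "opn (?D * (h * ?D)) \<le> 1 * sqrt (1 / (2 * real n + 1))" .
  qed (use k in simp)
  finally have bound: "opn (?D * T * ?D) \<le> inverse k * sqrt (1 / (2 * real n + 1))" by simp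
  define e where "e y = app ?D y" for y
  have DTD: "?D * T * ?D = (\<Sum>y\<in>S. theta (e y) (e y))"
    unfolding T_def sum_distrib_left sum_distrib_right e_def
    using DL by (simp add: mult_theta theta_mult)
  \<comment> \<open>The left side comes from the summand y = x of <D T D e x, e x>. So |e x|^4 is at
    most the norm of D T D times |e x|^2.\<close>
  have "(norm (ip (e x) (e x)))\<^sup>2 \<le> norm (\<Sum>y\<in>S. st (ip (e y) (e x)) * ip (e y) (e x))"
    using norm_square_le_sum[OF S x, of "\<lambda>y. ip (e y) (e x)"] .
  also have "(\<Sum>y\<in>S. st (ip (e y) (e x)) * ip (e y) (e x)) = ip (app (?D * T * ?D) (e x)) (e x)"
    unfolding DTD app_sum ip_sum_left app_theta ip_ra_left ..
  also have "norm \<dots> \<le> hn (app (?D * T * ?D) (e x)) * hn (e x)" by (rule cauchy_schwarz)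
  also have "\<dots> \<le> opn (?D * T * ?D) * hn (e x) * hn (e x)"
    using TL DL by (intro mult_right_mono hn_app_le) auto
  finally have "(hn (e x))\<^sup>2 * (hn (e x))\<^sup>2 \<le> opn (?D * T * ?D) * (hn (e x))\<^sup>2"
    by (simp add: hn_square[symmetric] power2_eq_square mult.assoc)
  then have "(hn (e x))\<^sup>2 \<le> opn (?D * T * ?D)"
  proof (cases "hn (e x) = 0")
    case False
    then have "0 < (hn (e x))\<^sup>2" by simp
    with \<open>(hn (e x))\<^sup>2 * (hn (e x))\<^sup>2 \<le> _\<close> show ?thesis by (rule mult_right_le_imp_le)
  qed (simp add: opn_nonneg)
  then show ?thesis using bound unfolding e_def by linarith
qed

text \<open>With z = Q x the difference v x - u x splits into v (x - P z), v (s - P) z, (y - X) z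
  and u (P z) - u x. The outer two are controlled by (1 - P)^n x since v and u are isometric, the
  inner two by precisions chosen after the bound for |z|.\<close>

lemma unitary_approximation:
  assumes sr: "stable_rank_one sc" and E: "hsubmodule scm ra E"
    and u_add: "\<And>x y. x \<in> E \<Longrightarrow> y \<in> E \<Longrightarrow> u (x + y) = u x + u y"
    and u_ip: "\<And>x y. x \<in> E \<Longrightarrow> y \<in> E \<Longrightarrow> ip (u x) (u y) = ip x y"
    and u_ra: "\<And>x a. x \<in> E \<Longrightarrow> u (ra x a) = ra (u x) a"
    and S: "finite S" "S \<subseteq> E" and eps: "0 < \<epsilon>"
  shows "\<exists>v. unitary_Kunitz scm ra ip v \<and> (\<forall>x\<in>S. hn (v x - u x) < \<epsilon>)"
proof -
  define T where "T = (\<Sum>x\<in>S. theta x x)"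
  define k where "k = inverse (1 + opn T)"
  define h where "h = rs k * T"
  \<comment> \<open>Chosen so that P = T B. This expands \<open>P\<close> into rank one operators
    with left vectors in S, so its range lies in \<open>E\<close>.\<close>
  define B where "B = rs (k * k) * T"
  define P where "P = h * h"
  have TL: "T \<in> L" "adj T = T" unfolding T_def by (auto simp: star_sum intro!: sum_closed)
  have oT: "0 < 1 + opn T" using nrm_nonneg[of T] by linarith
  then have k: "0 < k" by (simp add: k_def)
  have hL: "h \<in> L" "adj h = h" using TL unfolding h_def by (auto simp: star_mult cs_commute)
  have BL: "B \<in> L" "adj B = B" using TL unfolding B_def by (auto simp: star_mult cs_commute)
  have "opn h = k * opn T" unfolding h_def using k TL by (intro nrm_rs_mult) auto
  then have h1: "opn h \<le> 1" using oT unfolding k_def by (simp add: pos_divide_le_eq inverse_eq_divide)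
  have P: "pos P" unfolding P_def by (rule pos_square[OF hL])
  have PL: "P \<in> L" using P by blast
  have PTB: "P = (\<Sum>x\<in>S. theta x (app B x))"
  proof -
    have "P = rs (k * k) * (T * T)"
      unfolding P_def h_def of_real_mult by (rule cs_mult_mult_cs[OF TL(1)])
    also have "\<dots> = T * B" unfolding B_def by (rule cs_left_commute[OF TL(1), symmetric])
    finally have "P = (\<Sum>x\<in>S. theta x x * B)" unfolding T_def sum_distrib_right .
    then show ?thesis by (simp add: theta_mult BL)
  qed
  \<comment> \<open>The operator uP. The map \<open>u\<close> is controlled only on
    \<open>E\<close>, but this formula makes sense on all of F and is visibly adjointable.\<close>
  define X where "X = (\<Sum>x\<in>S. theta (u x) (app B x))"
  have XL: "X \<in> L" unfolding X_def by (auto intro!: sum_closed)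
  have PE: "app P z \<in> E" for z
    unfolding PTB app_sum app_theta by (rule hsubmodule_sum_ra[OF E S])
  have uP: "u (app P z) = app X z" for z
  proof -
    have u_sum: "u (\<Sum>x\<in>R. ra x (c x)) = (\<Sum>x\<in>R. ra (u x) (c x))" if "finite R" "R \<subseteq> E" for R c
      using that
    proof (induction R rule: finite_induct)
      case empty
      have "0 \<in> E" using E by (simp add: hsubmodule_def)
      then show ?case using u_add[of 0 0] by simp
    next
      case (insert x R)
      have "ra x (c x) \<in> E" using insert E by (simp add: hsubmodule_def)
      moreover have "(\<Sum>x\<in>R. ra x (c x)) \<in> E" using insert by (intro hsubmodule_sum_ra[OF E]) auto
      ultimately have "u (ra x (c x) + (\<Sum>x\<in>R. ra x (c x))) = ra (u x) (c x) + u (\<Sum>x\<in>R. ra x (c x))"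
        using insert.prems u_add[of "ra x (c x)"] u_ra[of x "c x"] by simp
      then show ?case using insert by simp
    qed
    show ?thesis unfolding PTB X_def app_sum app_theta by (rule u_sum[OF S])
  qed
  have XX: "adj X * X = P * P"
  proof (rule endo_eqI, rule ip_right_eqI)
    fix w z
    have "ip w (app (adj X * X) z) = ip (app X w) (app X z)" using XL by (simp add: ip_adj)
    also have "\<dots> = ip (app P w) (app P z)" unfolding uP[symmetric] by (rule u_ip[OF PE PE])
    also have "\<dots> = ip w (app (P * P) z)" using PL pos_star[OF P] by (simp add: ip_adj)
    finally show "ip w (app (adj X * X) z) = ip w (app (P * P) z)" .
  qed
  obtain n where n: "\<And>x. x \<in> S \<Longrightarrow> hn (app ((1 - P) ^ n) x) < \<epsilon> / 4"
  proof -
    \<comment> \<open>Obtained by solving k^-1 sqrt (1 / (2n + 1)) < (\<epsilon> / 4)^2 for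
      n.\<close>
    let ?c = "(k * (\<epsilon> / 4)\<^sup>2)\<^sup>2"
    have c: "0 < ?c" using k eps by simp
    obtain n :: nat where n: "1 / ?c < real n" using reals_Archimedean2 by blast
    then have "1 / ?c < 2 * real n + 1" by linarith
    then have "1 / (2 * real n + 1) < ?c" using c by (simp add: field_simps)
    then have "sqrt (1 / (2 * real n + 1)) < sqrt ?c" by (rule real_sqrt_less_mono)
    then have "sqrt (1 / (2 * real n + 1)) < k * (\<epsilon> / 4)\<^sup>2" using k by simp
    then have lt: "inverse k * sqrt (1 / (2 * real n + 1)) < (\<epsilon> / 4)\<^sup>2" using k by (simp add: field_simps)
    have "hn (app ((1 - P) ^ n) x) < \<epsilon> / 4" if "x \<in> S" for x
    proof (rule power2_less_imp_less)
      show "(hn (app ((1 - P) ^ n) x))\<^sup>2 < (\<epsilon> / 4)\<^sup>2"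
        using sum_theta_power_bound[OF S(1) k h_def[unfolded T_def] h1 that, of n] lt unfolding P_def by linarith
    qed (use eps in simp)
    then show ?thesis using that by blast
  qed
  obtain Q where Q: "Q \<in> L" "1 - (1 - P) ^ n = P * Q" using one_minus_power_factor[OF PL] by blast
  have res: "x - app P (app Q x) = app ((1 - P) ^ n) x" for x
  proof -
    have "app (1 - (1 - P) ^ n) x = app (P * Q) x" by (simp only: Q(2))
    then show ?thesis by (simp add: algebra_simps)
  qed
  \<comment> \<open>Bounds |Q x| on all of \<open>S\<close>, and stays fixed while y approaches
    \<open>X\<close>.\<close>
  define K where "K = 1 + (\<Sum>x\<in>S. hn (app Q x))"
  have K: "0 < K" unfolding K_def by (simp add: sum_nonneg add_pos_nonneg)
  have Kx: "hn (app Q x) \<le> K" if "x \<in> S" for x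
    unfolding K_def using member_le_sum[OF that, of "\<lambda>x. hn (app Q x)"] S(1) by simp
  have e4: "0 < \<epsilon> / (4 * K)" using eps K by simp
  obtain d where d: "0 < d" "\<And>s. pos s \<Longrightarrow> opn (s * s - P * P) < d \<Longrightarrow> opn (s - P) < \<epsilon> / (4 * K)"
    using pos_sqrt_continuous[OF P e4] by blast
  \<comment> \<open>From |y* y - X* X| \<le> (|y| + |X|) |y - X| and |y| \<le> |X| + 1.\<close>
  define c where "c = 2 * opn X + 1"
  have c: "0 < c" unfolding c_def using nrm_nonneg[of X] by linarith
  define d' where "d' = min (min 1 (\<epsilon> / (4 * K))) (d / c)"
  have d': "0 < d'" "d' \<le> 1" "d' \<le> \<epsilon> / (4 * K)" "d' * c \<le> d"
  proof -
    show "0 < d'" using d(1) c e4 by (simp add: d'_def)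
    show "d' \<le> 1" "d' \<le> \<epsilon> / (4 * K)" by (auto simp: d'_def)
    have "d' \<le> d / c" unfolding d'_def by (rule min.cobounded2)
    then show "d' * c \<le> d" using c by (simp add: pos_le_divide_eq)
  qed
  obtain y yi where y: "KU_inverse y yi" "opn (y - X) < d'"
    using KU_inverse_dense[OF sr S(1) d'(1)] unfolding X_def by blast
  have yL: "y \<in> L" using y KU_L by (auto simp: KU_inverse_def)
  have "y \<in> KU" "yi \<in> KU" "y * yi = 1" "yi * y = 1" using y by (auto simp: KU_inverse_def)
  then obtain v s where v: "v \<in> KU" "pos s" "s * s = adj y * y" "v * s = y" "adj v * v = 1" "v * adj v = 1"
    by (rule polar_decomposition[OF closed_ideal_Comp])
  have vL: "v \<in> L" using v KU_L by blast
  have "opn (s * s - P * P) < d"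
  proof -
    have oy: "opn y \<le> opn X + 1"
      using nrm_triangle[of "y - X" X] yL XL y(2) d'(2) by auto
    have "s * s - P * P = adj y * (y - X) + adj (y - X) * X"
      unfolding v(3) XX[symmetric] using yL XL by (simp add: star_diff algebra_simps)
    moreover have "opn (adj y * (y - X)) \<le> (opn X + 1) * opn (y - X)"
      by (rule order_trans[OF nrm_mult mult_right_mono]) (use yL XL oy in auto)
    moreover have "opn (adj (y - X) * X) \<le> opn (y - X) * opn X"
      using nrm_mult[of "adj (y - X)" X] nrm_star[of "y - X"] yL XL by auto
    ultimately have "opn (s * s - P * P) \<le> (opn X + 1) * opn (y - X) + opn (y - X) * opn X"
      using nrm_add_le[of "adj y * (y - X)" "adj (y - X) * X"] yL XL by auto
    also have "\<dots> = opn (y - X) * c" by (simp add: c_def algebra_simps)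
    also have "\<dots> < d' * c" using y(2) c by simp
    finally show ?thesis using d'(4) by linarith
  qed
  then have sP: "opn (s - P) < \<epsilon> / (4 * K)" using d(2) v(2) by blast
  have "hn (app v x - u x) < \<epsilon>" if x: "x \<in> S" for x
  proof -
    let ?z = "app Q x"
    have zb: "a * hn ?z \<le> \<epsilon> / 4" if "0 \<le> a" "a \<le> \<epsilon> / (4 * K)" for a
    proof -
      have "a * hn ?z \<le> \<epsilon> / (4 * K) * K" by (intro mult_mono that Kx x) (use e4 in auto)
      then show ?thesis using K by simp
    qed
    have 1: "hn (app v (x - app P ?z)) < \<epsilon> / 4"
      unfolding hn_unitary[OF vL v(5)] res by (rule n[OF x])
    have "hn (app (s - P) ?z) \<le> \<epsilon> / 4"
      using hn_app_le[of "s - P" ?z] zb[of "opn (s - P)"] sP v(2) PL by auto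
    then have 2: "hn (app v (app (s - P) ?z)) \<le> \<epsilon> / 4" unfolding hn_unitary[OF vL v(5)] .
    have 3: "hn (app (y - X) ?z) \<le> \<epsilon> / 4"
      using hn_app_le[of "y - X" ?z] zb[of "opn (y - X)"] y(2) d'(3) yL XL by auto
    have xE: "x \<in> E" using x S by blast
    have "ip (u (app P ?z) - u x) (u (app P ?z) - u x) = ip (app P ?z - x) (app P ?z - x)"
      by (simp add: ip_diff_left ip_diff_right u_ip PE xE)
    then have "hn (app X ?z - u x) = hn (x - app P ?z)"
      unfolding uP using hn_diff_commute[of x] by (simp add: hmnorm_def)
    then have 4: "hn (app X ?z - u x) < \<epsilon> / 4" unfolding res using n[OF x] by simp
    have "app v (app s ?z) = app y ?z" using v(4) app_times by metis
    then have "app v x - u x = (app v (x - app P ?z) - app v (app (s - P) ?z)) + (app (y - X) ?z + (app X ?z - u x))"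
      by simp
    then have "hn (app v x - u x) \<le> (hn (app v (x - app P ?z)) + hn (app v (app (s - P) ?z))) + (hn (app (y - X) ?z) + hn (app X ?z - u x))"
      using hn_triangle hn_triangle_diff by (smt (verit, best))
    then show ?thesis using 1 2 3 4 by linarith
  qed
  moreover have "unitary_Kunitz scm ra ip (app v)"
    unfolding unitary_Kunitz_def
  proof
    obtain l where "v - scal l \<in> Comp" using v(1) by (auto simp: unitized_def)
    then show "\<exists>l k. compact_op ra ip k \<and> (\<forall>z. app v z = scm l z + k z)"
      unfolding Comp_def by (intro exI[of _ l] exI[of _ "app (v - scal l)"]) auto
    have "app v (app (adj v) z) = z" for z using v(6) app_times[of v "adj v" z] by simp
    then have "range (app v) = UNIV" by (metis surjI)
    moreover have "ip (app v x) (app v y) = ip x y" for x y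
      using ip_adj[OF vL, of x "app v y"] app_times[of "adj v" v y] v(5) by simp
    ultimately show "hiso scm ra ip scm ra ip UNIV UNIV (app v)"
      unfolding hiso_def using app_scm[OF vL] app_ra[OF vL] by auto
  qed
  ultimately show ?thesis by blast
qed

end

lemma unitary_approximation_hiso:
  assumes "cstar_algebra sc st" "stable_rank_one sc" "hilbert_module sc st scm ra ip"
    and "hsubmodule scm ra E1" "hiso scm ra ip scm ra ip E1 E2 u" "finite S" "S \<subseteq> E1" "0 < \<epsilon>"
  shows "\<exists>v. unitary_Kunitz scm ra ip v \<and> (\<forall>x\<in>S. hmnorm ip (v x - u x) < \<epsilon>)"
proof -
  interpret hilbert_mod sc st scm ra ip by unfold_locales (use assms in auto)
  show ?thesis
    by (rule unitary_approximation[of E1]) (use assms in \<open>auto simp: hiso_def\<close>)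
qed

section \<open>Composition, inverses and images of isomorphisms\<close>

lemma hiso_comp:
  assumes "hiso s1 r1 i1 s2 r2 i2 E F u" "hiso s2 r2 i2 s3 r3 i3 F G v"
  shows "hiso s1 r1 i1 s3 r3 i3 E G (v \<circ> u)"
proof -
  have "\<And>x. x \<in> E \<Longrightarrow> u x \<in> F" using assms(1) unfolding hiso_def by blast
  then show ?thesis using assms unfolding hiso_def by (auto simp: image_comp[symmetric])
qed

lemma hiso_subset:
  assumes "hiso s1 r1 i1 s2 r2 i2 E F u" "E' \<subseteq> E"
  shows "hiso s1 r1 i1 s2 r2 i2 E' (u ` E') u"
  using assms unfolding hiso_def by (auto simp: subset_iff)

lemma hiso_image_submodule:
  assumes E: "hsubmodule s1 r1 E" and u: "hiso s1 r1 i1 s2 r2 i2 E F u"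
  shows "hsubmodule s2 r2 F"
proof -
  have u': "\<And>x y. x \<in> E \<Longrightarrow> y \<in> E \<Longrightarrow> u x + u y = u (x + y)"
    "\<And>l x. x \<in> E \<Longrightarrow> s2 l (u x) = u (s1 l x)" "\<And>a x. x \<in> E \<Longrightarrow> r2 (u x) a = u (r1 x a)" "F = u ` E"
    using u by (auto simp: hiso_def)
  have "0 \<in> E" using E by (simp add: hsubmodule_def)
  then have "u 0 = 0" using u'(1)[of 0 0] by simp
  then have "0 \<in> u ` E" using \<open>0 \<in> E\<close> by (metis imageI)
  then show ?thesis using E unfolding hsubmodule_def u'(4) by (auto simp: u')
qed

context hilbert_mod
begin

lemma hiso_inj_on:
  assumes u: "hiso scm ra ip scm2 ra2 ip2 E F u"
  shows "inj_on u E"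
proof (rule inj_onI)
  fix x y assume xy: "x \<in> E" "y \<in> E" "u x = u y"
  then have "ip x x = ip x y" "ip y x = ip y y"
    using u unfolding hiso_def by metis+
  then have "ip (x - y) (x - y) = 0" by (simp add: ip_diff_left ip_diff_right)
  then show "x = y" using ip_zeroD by fastforce
qed

lemma hiso_inverse:
  assumes E: "hsubmodule scm ra E" and u: "hiso scm ra ip scm2 ra2 ip2 E F u"
  shows "hiso scm2 ra2 ip2 scm ra ip F E (inv_into E u)"
proof -
  have inj: "inj_on u E" by (rule hiso_inj_on[OF u])
  have F: "u ` E = F" using u by (simp add: hiso_def)
  have E': "\<And>x y. x \<in> E \<Longrightarrow> y \<in> E \<Longrightarrow> x + y \<in> E" "\<And>l x. x \<in> E \<Longrightarrow> scm l x \<in> E" "\<And>a x. x \<in> E \<Longrightarrow> ra x a \<in> E"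
    using E by (auto simp: hsubmodule_def)
  have u': "\<And>x y. x \<in> E \<Longrightarrow> y \<in> E \<Longrightarrow> u x + u y = u (x + y)" "\<And>x y. x \<in> E \<Longrightarrow> y \<in> E \<Longrightarrow> ip2 (u x) (u y) = ip x y"
    "\<And>l x. x \<in> E \<Longrightarrow> scm2 l (u x) = u (scm l x)" "\<And>a x. x \<in> E \<Longrightarrow> ra2 (u x) a = u (ra x a)"
    using u by (auto simp: hiso_def)
  have "inv_into E u ` F = E" unfolding F[symmetric] using inj by (rule inv_into_image_cancel) simp
  then show ?thesis unfolding hiso_def F[symmetric] using inj E' u' by auto
qed

text \<open>A point in the closure of the image has a preimage since v is onto, and the preimage is
  in the closure of \<open>G\<close> since v is isometric.\<close>

lemma unitary_image_closed_submodule: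
  assumes "closed_submodule scm ra ip G" "hiso scm ra ip scm ra ip UNIV UNIV v"
  shows "closed_submodule scm ra ip (v ` G)"
proof -
  have v: "v (x + y) = v x + v y" "ip (v x) (v y) = ip x y" "surj v"
    for x y using assms(2) by (auto simp: hiso_def)
  have G: "hsubmodule scm ra G" "hclosure ip G \<subseteq> G" using assms(1) by (auto simp: closed_submodule_def)
  have vd: "v (x - y) = v x - v y" for x y using v(1)[of "x - y" y] by simp
  have sub: "hsubmodule scm ra (v ` G)"
    by (rule hiso_image_submodule[OF G(1) hiso_subset[OF assms(2)]]) simp
  have "hclosure ip (v ` G) \<subseteq> v ` G"
  proof
    fix z assume z: "z \<in> hclosure ip (v ` G)"
    obtain x where x: "z = v x" using v(3) by auto
    have "hn (v a - v b) = hn (a - b)" for a b unfolding vd[symmetric] hmnorm_def v(2) ..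
    then have "x \<in> hclosure ip G" using z unfolding hclosure_def x by auto
    then show "z \<in> v ` G" using G(2) x by blast
  qed
  with sub show ?thesis by (simp add: closed_submodule_def)
qed

end

theorem theorem5:
  fixes sc :: "complex \<Rightarrow> 'a::{real_normed_algebra,banach} \<Rightarrow> 'a" and st :: "'a \<Rightarrow> 'a"
  assumes "cstar_algebra sc st" and "stable_rank_one sc"
  shows
  "(\<forall>(scm1 :: complex \<Rightarrow> 'm::ab_group_add \<Rightarrow> 'm) ra1 ip1 (scm2 :: complex \<Rightarrow> 'n::ab_group_add \<Rightarrow> 'n) ra2 ip2
       E1 E2 u S (\<epsilon>::real).
      cg_hilbert_module sc st scm1 ra1 ip1 \<and> cg_hilbert_module sc st scm2 ra2 ip2
      \<and> closed_submodule scm1 ra1 ip1 E1 \<and> countably_generated scm1 ra1 ip1 E1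
      \<and> closed_submodule scm2 ra2 ip2 E2 \<and> countably_generated scm2 ra2 ip2 E2
      \<and> (\<exists>w. hiso scm1 ra1 ip1 scm2 ra2 ip2 UNIV UNIV w)
      \<and> hiso scm1 ra1 ip1 scm2 ra2 ip2 E1 E2 u
      \<and> finite S \<and> S \<subseteq> E1 \<and> \<epsilon> > 0
      \<longrightarrow> (\<exists>v. hiso scm1 ra1 ip1 scm2 ra2 ip2 UNIV UNIV v
               \<and> (\<forall>\<xi>\<in>S. hmnorm ip2 (v \<xi> - u \<xi>) < \<epsilon>)))
   \<and>
   (\<forall>(scm :: complex \<Rightarrow> 'm::ab_group_add \<Rightarrow> 'm) ra ip E1 E2 u S (\<epsilon>::real).
      cg_hilbert_module sc st scm ra ip
      \<and> closed_submodule scm ra ip E1 \<and> countably_generated scm ra ip E1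
      \<and> closed_submodule scm ra ip E2 \<and> countably_generated scm ra ip E2
      \<and> hiso scm ra ip scm ra ip E1 E2 u
      \<and> finite S \<and> S \<subseteq> E1 \<and> \<epsilon> > 0
      \<longrightarrow> (\<exists>v. unitary_Kunitz scm ra ip v
               \<and> (\<forall>\<xi>\<in>S. hmnorm ip (v \<xi> - u \<xi>) < \<epsilon>)))
   \<and>
   (\<forall>(scm1 :: complex \<Rightarrow> 'm::ab_group_add \<Rightarrow> 'm) ra1 ip1 (scm2 :: complex \<Rightarrow> 'n::ab_group_add \<Rightarrow> 'n) ra2 ip2
       E1 E2 u S (\<epsilon>::real).
      cg_hilbert_module sc st scm1 ra1 ip1 \<and> cg_hilbert_module sc st scm2 ra2 ip2
      \<and> closed_submodule scm1 ra1 ip1 E1 \<and> countably_generated scm1 ra1 ip1 E1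
      \<and> closed_submodule scm2 ra2 ip2 E2 \<and> countably_generated scm2 ra2 ip2 E2
      \<and> (\<exists>G w. closed_submodule scm2 ra2 ip2 G \<and> countably_generated scm2 ra2 ip2 G
              \<and> hiso scm1 ra1 ip1 scm2 ra2 ip2 UNIV G w)
      \<and> hiso scm1 ra1 ip1 scm2 ra2 ip2 E1 E2 u
      \<and> finite S \<and> S \<subseteq> E1 \<and> \<epsilon> > 0
      \<longrightarrow> (\<exists>v G'. closed_submodule scm2 ra2 ip2 G'
               \<and> hiso scm1 ra1 ip1 scm2 ra2 ip2 UNIV G' v
               \<and> (\<forall>\<xi>\<in>S. hmnorm ip2 (v \<xi> - u \<xi>) < \<epsilon>)))"
proof -
  \<comment> \<open>In the second module, the case of a single module is applied to u w^-1, an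
    isomorphism from the image of \<open>E1\<close> under \<open>w\<close> onto \<open>E2\<close>.
    Composing the resulting unitary with \<open>w\<close> approximates \<open>u\<close> on
    \<open>S\<close>; the choice of \<open>G\<close> separates the equal and the embedded
    case.\<close>
  have main: "\<exists>v. hiso scm2 ra2 ip2 scm2 ra2 ip2 UNIV UNIV v
      \<and> hiso scm1 ra1 ip1 scm2 ra2 ip2 UNIV (v ` G) (v \<circ> w) \<and> (\<forall>\<xi>\<in>S. hmnorm ip2 ((v \<circ> w) \<xi> - u \<xi>) < \<epsilon>)"
    if "hilbert_module sc st scm1 ra1 ip1" "hilbert_module sc st scm2 ra2 ip2"
      "hsubmodule scm1 ra1 E1" "hiso scm1 ra1 ip1 scm2 ra2 ip2 UNIV G w"
      "hiso scm1 ra1 ip1 scm2 ra2 ip2 E1 E2 u" "finite S" "S \<subseteq> E1" "0 < \<epsilon>"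
    for scm1 :: "complex \<Rightarrow> 'm \<Rightarrow> 'm" and ra1 ip1 and scm2 :: "complex \<Rightarrow> 'n \<Rightarrow> 'n" and ra2 ip2 E1 E2 G u w S \<epsilon>
  proof -
    note H = that
    interpret M: hilbert_mod sc st scm1 ra1 ip1 by unfold_locales (use assms that in auto)
    have w: "hiso scm1 ra1 ip1 scm2 ra2 ip2 E1 (w ` E1) w" using hiso_subset[OF H(4)] by blast
    have inj: "inj_on w E1" by (rule M.hiso_inj_on[OF w])
    have wi: "hiso scm2 ra2 ip2 scm1 ra1 ip1 (w ` E1) E1 (inv_into E1 w)"
      by (rule M.hiso_inverse[OF H(3) w])
    have sub: "hsubmodule scm2 ra2 (w ` E1)" by (rule hiso_image_submodule[OF H(3) w])
    obtain v where v: "unitary_Kunitz scm2 ra2 ip2 v"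
      "\<forall>x\<in>w ` S. hmnorm ip2 (v x - (u \<circ> inv_into E1 w) x) < \<epsilon>"
      using unitary_approximation_hiso[OF assms H(2) sub hiso_comp[OF wi H(5)], of "w ` S" \<epsilon>] H(6-8) by blast
    have vi: "hiso scm2 ra2 ip2 scm2 ra2 ip2 UNIV UNIV v" using v(1) by (simp add: unitary_Kunitz_def)
    have "hiso scm1 ra1 ip1 scm2 ra2 ip2 UNIV (v ` G) (v \<circ> w)"
      by (rule hiso_comp[OF that(4) hiso_subset[OF vi]]) simp
    moreover have "hmnorm ip2 ((v \<circ> w) \<xi> - u \<xi>) < \<epsilon>" if "\<xi> \<in> S" for \<xi>
      using v(2) that \<open>S \<subseteq> E1\<close> inj by (auto simp: inv_into_f_f subset_iff)
    ultimately show ?thesis using vi by blast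
  qed
  show ?thesis
  proof (intro conjI allI impI; elim conjE exE)
    fix scm1 :: "complex \<Rightarrow> 'm \<Rightarrow> 'm" and ra1 ip1 and scm2 :: "complex \<Rightarrow> 'n \<Rightarrow> 'n" and ra2 ip2 E1 E2 u S and \<epsilon> :: real and w
    assume a: "cg_hilbert_module sc st scm1 ra1 ip1" "cg_hilbert_module sc st scm2 ra2 ip2"
      "closed_submodule scm1 ra1 ip1 E1" "hiso scm1 ra1 ip1 scm2 ra2 ip2 UNIV UNIV w"
      "hiso scm1 ra1 ip1 scm2 ra2 ip2 E1 E2 u" "finite S" "S \<subseteq> E1" "0 < \<epsilon>"
    have "hilbert_module sc st scm1 ra1 ip1" "hilbert_module sc st scm2 ra2 ip2" "hsubmodule scm1 ra1 E1"
      using a(1-3) by (auto simp: cg_hilbert_module_def closed_submodule_def)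
    from main[OF this a(4-8)] obtain v where v: "hiso scm2 ra2 ip2 scm2 ra2 ip2 UNIV UNIV v"
      "hiso scm1 ra1 ip1 scm2 ra2 ip2 UNIV (range v) (v \<circ> w)" "\<forall>\<xi>\<in>S. hmnorm ip2 ((v \<circ> w) \<xi> - u \<xi>) < \<epsilon>" by blast
    moreover have "range v = UNIV" using v(1) by (simp add: hiso_def)
    ultimately show "\<exists>v. hiso scm1 ra1 ip1 scm2 ra2 ip2 UNIV UNIV v \<and> (\<forall>\<xi>\<in>S. hmnorm ip2 (v \<xi> - u \<xi>) < \<epsilon>)" by metis
  next
    fix scm :: "complex \<Rightarrow> 'm \<Rightarrow> 'm" and ra ip E1 E2 u S and \<epsilon> :: real
    assume a: "cg_hilbert_module sc st scm ra ip" "closed_submodule scm ra ip E1"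
      "hiso scm ra ip scm ra ip E1 E2 u" "finite S" "S \<subseteq> E1" "0 < \<epsilon>"
    have "hilbert_module sc st scm ra ip" "hsubmodule scm ra E1"
      using a(1,2) by (auto simp: cg_hilbert_module_def closed_submodule_def)
    from unitary_approximation_hiso[OF assms this a(3-6)]
    show "\<exists>v. unitary_Kunitz scm ra ip v \<and> (\<forall>\<xi>\<in>S. hmnorm ip (v \<xi> - u \<xi>) < \<epsilon>)" .
  next
    fix scm1 :: "complex \<Rightarrow> 'm \<Rightarrow> 'm" and ra1 ip1 and scm2 :: "complex \<Rightarrow> 'n \<Rightarrow> 'n" and ra2 ip2 E1 E2 u S and \<epsilon> :: real and G w
    assume a: "cg_hilbert_module sc st scm1 ra1 ip1" "cg_hilbert_module sc st scm2 ra2 ip2"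
      "closed_submodule scm1 ra1 ip1 E1" "hiso scm1 ra1 ip1 scm2 ra2 ip2 UNIV G w"
      "hiso scm1 ra1 ip1 scm2 ra2 ip2 E1 E2 u" "finite S" "S \<subseteq> E1" "0 < \<epsilon>" and G: "closed_submodule scm2 ra2 ip2 G"
    have h: "hilbert_module sc st scm1 ra1 ip1" "hilbert_module sc st scm2 ra2 ip2" "hsubmodule scm1 ra1 E1"
      using a(1-3) by (auto simp: cg_hilbert_module_def closed_submodule_def)
    interpret N: hilbert_mod sc st scm2 ra2 ip2 by unfold_locales (use assms h in auto)
    from main[OF h a(4-8)] obtain v where v: "hiso scm2 ra2 ip2 scm2 ra2 ip2 UNIV UNIV v"
      "hiso scm1 ra1 ip1 scm2 ra2 ip2 UNIV (v ` G) (v \<circ> w)" "\<forall>\<xi>\<in>S. hmnorm ip2 ((v \<circ> w) \<xi> - u \<xi>) < \<epsilon>" by blast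
    then show "\<exists>v G'. closed_submodule scm2 ra2 ip2 G' \<and> hiso scm1 ra1 ip1 scm2 ra2 ip2 UNIV G' v
        \<and> (\<forall>\<xi>\<in>S. hmnorm ip2 (v \<xi> - u \<xi>) < \<epsilon>)"
      using N.unitary_image_closed_submodule[OF G v(1)] by blast
  qed
qed

end
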